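(* Let $2\le k<\lambda\le\omega$ and let $\zeta,\xi<\varepsilon_0$ be such that $\mathbb A_k(\xi)$ is the $k$-normal form of the natural number $\mathbb A_k(\zeta)$. Then $\mathbb A_\lambda(\zeta^{\uparrow\lambda}_k)\le\mathbb A_\lambda(\xi^{\uparrow\lambda}_k)$.
   Context: Ordinals: $\varepsilon_0$ is the least ordinal $\varepsilon$ with $\omega^\varepsilon=\varepsilon$. Every $0<\xi<\varepsilon_0$ has a unique $\omega$-normal form $\xi=\omega^{\alpha}b+\gamma$ with $\alpha<\xi$, $b$ a positive natural number, $\gamma<\omega^\alpha$. $\mathrm{coeffs}(0)=\{0\}$, $\mathrm{coeffs}(\omega^\alpha b+\gamma)=\mathrm{coeffs}(\alpha)\cup\mathrm{coeffs}(\gamma)\cup\{b\}$, $\mathrm{mc}(\xi)=\max\mathrm{coeffs}(\xi)$. Fundamental sequences: $0[n]=1[n]=0$; $(\omega^\alpha b+\gamma)[n]=\omega^\alpha b+\gamma[n]$ if $\gamma>0$; $\omega^{\alpha+1}[n]=\omega^\alpha n$; $(\omega^\alpha(b+1))[n]=\omega^\alpha b+(\omega^\alpha)[n]$ if $b>0$; $(\omega^\alpha)[n]=\omega^{\alpha[n]}$ if $\alpha$ is a limit. For $2\le k<\omega$, $\mathbb A_k:\varepsilon_0\to\mathbb N$: $\mathbb A_k(\xi)=\xi+1$ if $\xi<\omega$; if $\xi\ge\omega$, write $\xi=\alpha+b$ with $\alpha$ a limit, $b<\omega$; $\mathbb A_k^{(0)}(\xi)=\mathbb A_k(\xi-1)$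 if $b>0$, $=\mathrm{mc}(\xi)$ if $b=0$; $\mathbb A_k^{(i+1)}(\xi)=\mathbb A_k(\alpha[\mathbb A_k^{(i)}(\xi)])$; $\mathbb A_k(\xi)=\mathbb A_k^{(k)}(\xi)$. $\Omega$ is the first uncountable ordinal, $\varepsilon_{\Omega+1}$ the least $\varepsilon>\Omega$ with $\omega^\varepsilon=\varepsilon$. Each $0<\xi<\varepsilon_{\Omega+1}$ has a unique $\Omega$-normal form $\Omega^\alpha\beta+\gamma$ with $0<\beta<\Omega$, $\gamma<\Omega^\alpha$; $\mathrm{coeffs}_\Omega$ and $\mathrm{mc}_\Omega$ are defined as for $\omega$ using $\Omega$-normal forms. $\mathbb A_\omega:\varepsilon_{\Omega+1}\to\Omega$: $\mathbb A_\omega(\xi)$ is the least $\theta>\mathrm{mc}_\Omega(\xi)$ such that $\mathbb A_\omega(\zeta)<\theta$ for all $\zeta<\xi$ with $\mathrm{mc}_\Omega(\zeta)<\theta$. $k$-normal forms: for a positive integer $m$ and $\xi<\varepsilon_0$, $\mathbb A_k(\xi)$ is the $k$-normal form of $m$ if $m=\mathbb A_k(\xi)$ and there is a sequence $\xi_0,\dots,\xi_n<\varepsilon_0$ with $\xi_0=0$, $\xi_n=\xi$, and for each $i<n$, $\xi_{i+1}$ is the maximum $\zeta<\varepsilon_0$ with $\mathbb A_k(\zeta)\le m$ and $\mathrm{mc}(\zeta)\ge\mathbb A_k(\xi_i)$ if such a maximum exists, $\xi_{i+1}=0$ otherwise. (Each positive integer is taken to have exactly one $k$-normal form.) Base change for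 $2\le k<\lambda\le\omega$: let $\kappa=\omega$ if $\lambda<\omega$, $\kappa=\Omega$ if $\lambda=\omega$. Define by simultaneous recursion on natural numbers and ordinals below $\varepsilon_0$: $0^{\uparrow\lambda}_k=0$; if $m>0$ has $k$-normal form $\mathbb A_k(\xi)$, $m^{\uparrow\lambda}_k=\mathbb A_\lambda(\xi^{\uparrow\lambda}_k)$; if $\xi=\omega^\alpha b+\gamma$ in $\omega$-normal form, $\xi^{\uparrow\lambda}_k=\kappa^{\alpha^{\uparrow\lambda}_k}b^{\uparrow\lambda}_k+\gamma^{\uparrow\lambda}_k$. *)

theory Defs
  imports Main "HOL-Library.Countable_Set"
begin

section \<open>Ordinals\<close>

text \<open>
  The ambient universe of ordinals: the initial segment of length \<open>\<omega>\<^sub>2\<close>. It contains every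
  ordinal below \<open>\<epsilon>\<^bsub>\<Omega>+1\<^esub>\<close>, and is closed under all ordinal operations used here, because
  \<open>\<omega>\<^sub>2\<close> is regular (\<open>ord_bounded\<close>): every \<open>LEAST\<close> below is attained.
\<close>

definition omega2 :: "nat set set rel" where
  "omega2 = cardSuc (cardSuc natLeq)"

lemma omega1_card: "Card_order (cardSuc natLeq)" and omega1_inf: "infinite (Field (cardSuc natLeq))"
  using natLeq_Card_order by (auto simp: cardSuc_Card_order cardSuc_finite Field_natLeq)

lemma omega2_card: "Card_order omega2" and omega2_inf: "infinite (Field omega2)"
  and omega2_reg: "regularCard omega2" and omega2_wo: "Well_order omega2"
  unfolding omega2_def using omega1_card omega1_inf
  by (auto simp: cardSuc_Card_order cardSuc_finite infinite_cardSuc_regularCard cardSuc_Well_order)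

typedef ordinal = "Field omega2"
  using omega2_inf by (metis finite.emptyI ex_in_conv)

instantiation ordinal :: wellorder
begin

definition less_eq_ordinal :: "ordinal \<Rightarrow> ordinal \<Rightarrow> bool" where
  "x \<le> y \<longleftrightarrow> (Rep_ordinal x, Rep_ordinal y) \<in> omega2"

definition less_ordinal :: "ordinal \<Rightarrow> ordinal \<Rightarrow> bool" where
  "x < y \<longleftrightarrow> x \<le> y \<and> x \<noteq> (y::ordinal)"

instance
proof
  note wo = omega2_wo[unfolded order_on_defs]
  show "(x < y) = (x \<le> y \<and> \<not> y \<le> x)" for x y :: ordinal
    using wo by (auto simp: less_eq_ordinal_def less_ordinal_def antisym_def)
      (metis Rep_ordinal_inject)
  show "x \<le> x" for x :: ordinal
    using wo Rep_ordinal[of x] by (auto simp: less_eq_ordinal_def refl_on_def)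
  show "x \<le> z" if "x \<le> y" "y \<le> z" for x y z :: ordinal
    using wo that by (auto simp: less_eq_ordinal_def trans_def)
  show "x = y" if "x \<le> y" "y \<le> x" for x y :: ordinal
    using that antisymD[of omega2 "Rep_ordinal x" "Rep_ordinal y"] omega2_wo
    by (simp add: less_eq_ordinal_def Rep_ordinal_inject order_on_defs)
  show "x \<le> y \<or> y \<le> x" for x y :: ordinal
    using wo Rep_ordinal[of x] Rep_ordinal[of y] 
    by (cases "x = y") (auto simp: less_eq_ordinal_def total_on_def refl_on_def Rep_ordinal_inject)
  show "P a" if step: "\<And>x. (\<And>y. y < x \<Longrightarrow> P y) \<Longrightarrow> P x" for P and a :: ordinal
  proof -
    have "wf {(x,y). x < (y::ordinal)}"
    proof (rule wf_subset)
      show "wf (inv_image (omega2 - Id) Rep_ordinal)" using wo by auto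
      show "{(x,y). x < (y::ordinal)} \<subseteq> inv_image (omega2 - Id) Rep_ordinal"
        by (auto simp: less_ordinal_def less_eq_ordinal_def Rep_ordinal_inject)
    qed
    then show ?thesis by (rule wf_induct_rule) (use step in auto)
  qed
qed

end

context
  includes cardinal_syntax
begin

lemma ord_bounded: "\<exists>u. \<forall>d<b. f d < u" for f :: "ordinal \<Rightarrow> ordinal" and b :: ordinal
proof -
  let ?K = "(Rep_ordinal \<circ> f) ` {..<b}"
  let ?U = "underS omega2 (Rep_ordinal b)"
  have 1: "{..<b} = Abs_ordinal ` ?U"
  proof (intro set_eqI iffI)
    fix x assume "x \<in> {..<b}"
    then have "Rep_ordinal x \<in> ?U"
      by (auto simp: underS_def less_ordinal_def less_eq_ordinal_def Rep_ordinal_inject)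
    then show "x \<in> Abs_ordinal ` ?U" by (metis Rep_ordinal_inverse image_eqI)
  next
    fix x assume "x \<in> Abs_ordinal ` ?U"
    then obtain y where y: "y \<in> ?U" "x = Abs_ordinal y" by auto
    then have "y \<in> Field omega2" by (auto simp: underS_def Field_def)
    then show "x \<in> {..<b}" using y
      by (auto simp: underS_def less_ordinal_def less_eq_ordinal_def Abs_ordinal_inverse)
  qed
  have "|?K| \<le>o |?U|" unfolding 1 image_comp by (rule card_of_image)
  moreover have "|?U| <o omega2" by (rule card_of_underS[OF omega2_card Rep_ordinal])
  ultimately have "|?K| <o omega2" using ordLeq_ordLess_trans by blast
  then have "\<not> |?K| =o omega2" using not_ordLess_ordIso by blast
  moreover have "?K \<subseteq> Field omega2" using Rep_ordinal by auto
  ultimately have "\<not> cofinal ?K omega2" using omega2_reg unfolding regularCard_def by blast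
  then obtain a where a: "a \<in> Field omega2" "\<forall>c\<in>?K. \<not> (a \<noteq> c \<and> (a,c) \<in> omega2)"
    unfolding cofinal_def by blast
  obtain a' where a': "a' \<in> Field omega2" "a \<noteq> a'" "(a,a') \<in> omega2"
    using infinite_Card_order_limit[OF omega2_card omega2_inf a(1)] by blast
  have "f d < Abs_ordinal a'" if "d < b" for d
  proof -
    have "\<not> Abs_ordinal a < f d" using a that
      by (auto simp: less_ordinal_def less_eq_ordinal_def Abs_ordinal_inverse Rep_ordinal_inverse)
    moreover have "Abs_ordinal a < Abs_ordinal a'" using a a'
      by (auto simp: less_ordinal_def less_eq_ordinal_def Abs_ordinal_inverse Abs_ordinal_inject)
    ultimately show ?thesis by auto
  qed
  then show ?thesis by blast
qed

lemma ord_no_top: "\<exists>u. a < (u::ordinal)"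
proof -
  obtain b where b: "b \<in> Field omega2" "Rep_ordinal a \<noteq> b" "(Rep_ordinal a, b) \<in> omega2"
    using infinite_Card_order_limit[OF omega2_card omega2_inf Rep_ordinal[of a]] by blast
  then have "a < Abs_ordinal b"
    by (auto simp: less_ordinal_def less_eq_ordinal_def Abs_ordinal_inverse Rep_ordinal_inverse)
  then show ?thesis by blast
qed

lemma ex_uncountable: "\<exists>x::ordinal. uncountable {..<x}"
proof -
  have wo1: "Well_order (cardSuc natLeq)" using omega1_card unfolding card_order_on_def by blast
  have "cardSuc natLeq <o omega2" unfolding omega2_def by (rule cardSuc_greater[OF omega1_card])
  then obtain a where a: "a \<in> Field omega2" "cardSuc natLeq =o Restr omega2 (underS omega2 a)"
    using ordLess_iff_ordIso_Restr[OF omega2_wo wo1] by blast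
  have F: "Field (Restr omega2 (underS omega2 a)) = underS omega2 a"
    by (rule well_order_on_Field[OF well_order_on_Restr[OF omega2_wo], symmetric])
      (auto simp: underS_def Field_def)
  from a(2) obtain h where "iso (cardSuc natLeq) (Restr omega2 (underS omega2 a)) h"
    unfolding ordIso_def by auto
  then have bij: "bij_betw h (Field (cardSuc natLeq)) (underS omega2 a)"
    unfolding iso_def F by blast
  have unc: "uncountable (underS omega2 a)"
  proof
    assume "countable (underS omega2 a)"
    then have "countable (Field (cardSuc natLeq))"
      using bij countable_image_inj_on[of h "Field (cardSuc natLeq)"] by (simp add: bij_betw_def)
    then obtain g :: "_ \<Rightarrow> nat" where "inj_on g (Field (cardSuc natLeq))"
      by (auto simp: countable_def)
    then have "|Field (cardSuc natLeq)| \<le>o |UNIV::nat set|" 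
      using card_of_ordLeq[of "Field (cardSuc natLeq)" "UNIV::nat set"] by auto
    from ordIso_ordLeq_trans[OF ordIso_symmetric[OF card_of_Field_ordIso[OF omega1_card]] this]
    have "cardSuc natLeq \<le>o natLeq" using card_of_nat by (rule ordLeq_ordIso_trans)
    with not_ordLess_ordLeq[OF cardSuc_greater[OF natLeq_Card_order]] show False by contradiction
  qed
  have "underS omega2 a \<subseteq> Rep_ordinal ` {..<Abs_ordinal a}"
  proof
    fix y assume y: "y \<in> underS omega2 a"
    then have yF: "y \<in> Field omega2" by (auto simp: underS_def Field_def)
    then have "Abs_ordinal y < Abs_ordinal a" using y a(1)
      by (auto simp: underS_def less_ordinal_def less_eq_ordinal_def Abs_ordinal_inverse Abs_ordinal_inject)
    then show "y \<in> Rep_ordinal ` {..<Abs_ordinal a}"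
      using yF by (metis Abs_ordinal_inverse image_eqI lessThan_iff)
  qed
  then have "uncountable {..<Abs_ordinal a}"
    using unc countable_subset[OF _ countable_image[of "{..<Abs_ordinal a}" Rep_ordinal]] by auto
  then show ?thesis by blast
qed

end

lemma wf_ord: "wf {(x,y). x < (y::ordinal)}"
  by (rule wf)


subsection \<open>Arithmetic\<close>

instantiation ordinal :: "{zero, one, plus, times}"
begin

definition zero_ordinal :: ordinal where "0 = (LEAST x::ordinal. True)"

definition one_ordinal :: ordinal where "1 = (LEAST x::ordinal. 0 < x)"

function plus_ordinal :: "ordinal \<Rightarrow> ordinal \<Rightarrow> ordinal" where
  "plus_ordinal a b = (LEAST c. a \<le> c \<and> (\<forall>d<b. plus_ordinal a d < c))"
  by auto
termination by (relation "inv_image {(x,y). x < y} snd") (auto simp: wf_ord)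

declare plus_ordinal.simps [simp del]

function times_ordinal :: "ordinal \<Rightarrow> ordinal \<Rightarrow> ordinal" where
  "times_ordinal a b = (LEAST c. \<forall>d<b. times_ordinal a d + a \<le> c)"
  by auto
termination by (relation "inv_image {(x,y). x < y} snd") (auto simp: wf_ord)

declare times_ordinal.simps [simp del]

instance ..

end

text \<open>\<open>a \<up> b = sup {1, a \<up> d \<sqdot> a | d < b}\<close>; only bases \<open>a \<ge> 1\<close> are of interest.\<close>

function opow :: "ordinal \<Rightarrow> ordinal \<Rightarrow> ordinal" (infixr "\<up>" 80) where
  "opow a b = (LEAST c. 1 \<le> c \<and> (\<forall>d<b. opow a d * a \<le> c))"
  by auto
termination by (relation "inv_image {(x,y). x < y} snd") (auto simp: wf_ord)

declare opow.simps [simp del]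

lemma zero_le_ord [simp]: "0 \<le> (a::ordinal)"
  unfolding zero_ordinal_def by (rule Least_le) simp

lemma not_less_zero_ord [simp]: "\<not> a < (0::ordinal)"
  by (simp add: not_less)

lemma pos_iff: "0 < a \<longleftrightarrow> a \<noteq> (0::ordinal)"
  using zero_le_ord[of a] by (auto simp: less_le simp del: zero_le_ord)

lemma zero_less_one [simp]: "0 < (1::ordinal)"
  unfolding one_ordinal_def using ord_no_top[of 0] by (metis LeastI)

lemma one_le_iff: "1 \<le> a \<longleftrightarrow> 0 < (a::ordinal)"
  unfolding one_ordinal_def
  by (metis Least_le less_le_trans one_ordinal_def zero_less_one)

lemma less_one_iff [simp]: "a < 1 \<longleftrightarrow> a = (0::ordinal)"
  by (metis not_less one_le_iff pos_iff)

lemma one_neq_zero [simp]: "1 \<noteq> (0::ordinal)" "0 \<noteq> (1::ordinal)"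
  using zero_less_one less_irrefl by metis+

lemma ord_bounded': "\<exists>u. a \<le> u \<and> (\<forall>d<b. f d < u)" for f :: "ordinal \<Rightarrow> ordinal"
proof -
  obtain u where "\<forall>d<b. f d < u" using ord_bounded[of b f] by auto
  then show ?thesis by (intro exI[of _ "max a u"]) (auto simp: less_max_iff_disj)
qed

subsubsection \<open>Addition\<close>

lemma plus_props: "a \<le> a + b \<and> (\<forall>d<b. a + d < a + (b::ordinal))"
  unfolding plus_ordinal.simps[of a b]
  by (rule LeastI_ex) (rule ord_bounded')

lemma plus_le: "a \<le> c \<Longrightarrow> (\<And>d. d < b \<Longrightarrow> a + d < c) \<Longrightarrow> a + b \<le> (c::ordinal)"
  unfolding plus_ordinal.simps[of a b] by (rule Least_le) auto

lemma add_less [simp]: "a + b < a + c \<longleftrightarrow> b < (c::ordinal)"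
proof -
  have "b < c \<Longrightarrow> a + b < a + c" for b c using plus_props by blast
  from this[of b c] this[of c b] show ?thesis by (cases b c rule: linorder_cases) auto
qed

lemma add_le [simp]: "a + b \<le> a + c \<longleftrightarrow> b \<le> (c::ordinal)"
  by (simp add: not_less[symmetric])

lemma add_eq [simp]: "a + b = a + c \<longleftrightarrow> b = (c::ordinal)"
  by (simp add: order.eq_iff)

lemma le_add1o [simp]: "a \<le> a + (b::ordinal)"
  using plus_props by blast

lemma add_0_right [simp]: "a + 0 = (a::ordinal)"
  by (rule antisym[OF plus_le]) auto

lemma le_add2o: "b \<le> a + (b::ordinal)"
proof (induction b rule: less_induct)
  case (less b)
  show ?case
  proof (rule ccontr)
    assume "\<not> b \<le> a + b"
    then have "a + b < b" by simp
    with less have "a + b \<le> a + (a + b)" by blast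
    with \<open>a + b < b\<close> show False by simp
  qed
qed

lemma add_0_left [simp]: "0 + a = (a::ordinal)"
proof (induction a rule: less_induct)
  case (less a)
  then have "0 + a \<le> a" by (intro plus_le) auto
  then show ?case by (metis antisym le_add2o)
qed

lemma le_imp_diff: assumes "a \<le> (b::ordinal)" shows "\<exists>c. b = a + c"
proof -
  define c where "c = (LEAST c. b \<le> a + c)"
  have 1: "b \<le> a + c" unfolding c_def by (rule LeastI[of _ b]) (rule le_add2o)
  have "a + c \<le> b"
  proof (rule plus_le[OF assms])
    fix d assume "d < c" 
    then have "\<not> b \<le> a + d" unfolding c_def by (rule not_less_Least)
    then show "a + d < b" by simp
  qed
  with 1 show ?thesis by (meson antisym)
qed

lemma add_assoc_ord: "(a + b) + c = a + (b + (c::ordinal))"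
proof (induction c rule: less_induct)
  case (less c)
  show ?case
  proof (rule antisym)
    show "(a + b) + c \<le> a + (b + c)" by (rule plus_le) (auto simp: less)
    show "a + (b + c) \<le> (a + b) + c"
    proof (rule plus_le)
      show "a \<le> a + b + c" by (meson le_add1o order_trans)
      fix d assume d: "d < b + c"
      show "a + d < a + b + c"
      proof (cases "b \<le> d")
        case True
        then obtain e where e: "d = b + e" using le_imp_diff by blast
        then have "e < c" using d by simp
        then show ?thesis using less e by (metis add_less)
      next
        case False
        then have "a + d < a + b" by simp
        then show ?thesis by (meson le_add1o less_le_trans)
      qed
    qed
  qed
qed

instance ordinal :: monoid_add
  by standard (auto simp: add_assoc_ord)

lemma add_right_mono_ord: "a \<le> b \<Longrightarrow> a + c \<le> b + (c::ordinal)"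
proof (induction c rule: less_induct)
  case (less c)
  show ?case
  proof (rule plus_le)
    show "a \<le> b + c" using less.prems le_add1o by (rule order_trans)
    show "a + d < b + c" if "d < c" for d
      by (rule le_less_trans[OF less.IH[OF that less.prems]]) (simp add: that)
  qed
qed

lemma less_add1 [simp]: "a < a + (1::ordinal)"
  using add_less[of a 0 1] by simp

lemma add1_le_iff: "a + 1 \<le> b \<longleftrightarrow> a < (b::ordinal)"
proof
  show "a < b" if "a + 1 \<le> b" using less_add1 that by (rule less_le_trans)
  show "a + 1 \<le> b" if "a < b" using that by (intro plus_le) auto
qed

lemma less_add1_iff: "a < b + 1 \<longleftrightarrow> a \<le> (b::ordinal)"
  using add1_le_iff[of b a] by auto

lemma add1_inj [simp]: "a + 1 = b + 1 \<longleftrightarrow> a = (b::ordinal)"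
  by (auto simp: order.eq_iff add1_le_iff less_add1_iff)

subsubsection \<open>Multiplication\<close>

lemma times_props: "d < b \<Longrightarrow> a * d + a \<le> a * (b::ordinal)"
proof -
  obtain u where "\<forall>d<b. a * d + a < u" using ord_bounded[of b "\<lambda>d. a * d + a"] by auto
  then have "\<exists>c. \<forall>d<b. a * d + a \<le> c" by (intro exI[of _ u]) (simp add: less_imp_le)
  then have "\<forall>d<b. a * d + a \<le> a * b"
    unfolding times_ordinal.simps[of a b] by (rule LeastI_ex)
  then show "d < b \<Longrightarrow> a * d + a \<le> a * b" by simp
qed

lemma times_le: "(\<And>d. d < b \<Longrightarrow> a * d + a \<le> c) \<Longrightarrow> a * b \<le> (c::ordinal)"
  unfolding times_ordinal.simps[of a b] by (rule Least_le) auto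

lemma mult_0_right_ord [simp]: "a * 0 = (0::ordinal)"
  by (rule antisym[OF times_le]) auto

lemma mult_mono_ord: "b \<le> c \<Longrightarrow> a * b \<le> a * (c::ordinal)"
  by (rule times_le) (rule times_props, rule less_le_trans)

lemma mult_less_ord [simp]: "0 < a \<Longrightarrow> a * b < a * c \<longleftrightarrow> b < (c::ordinal)"
proof -
  assume a: "0 < a"
  have "a * b < a * c" if "b < c" for b c
    by (rule less_le_trans[OF _ times_props[OF that]]) (use a add_less[of "a * b" 0 a] in simp)
  then show ?thesis using mult_mono_ord[of c b a] by (auto simp: not_less[symmetric])
qed

lemma mult_0_left_ord [simp]: "0 * a = (0::ordinal)"
proof (induction a rule: less_induct)
  case (less a)
  have "0 * a \<le> 0" by (rule times_le) (auto simp: less)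
  then show ?case by (simp add: antisym)
qed

lemma mult_add1: "a * (b + 1) = a * b + (a::ordinal)"
proof (rule antisym)
  show "a * (b + 1) \<le> a * b + a"
    by (rule times_le) (simp add: less_add1_iff add_right_mono_ord mult_mono_ord)
  show "a * b + a \<le> a * (b + 1)" by (rule times_props) simp
qed

lemma mult_1_right_ord [simp]: "a * 1 = (a::ordinal)"
  using mult_add1[of a 0] by simp

lemma mult_1_left_ord [simp]: "1 * a = (a::ordinal)"
proof (induction a rule: less_induct)
  case (less a)
  show ?case
  proof (rule antisym)
    show "1 * a \<le> a" by (rule times_le) (auto simp: less add1_le_iff)
    show "a \<le> 1 * a"
    proof (rule ccontr)
      assume "\<not> a \<le> 1 * a"
      then have "1 * a < a" by simp
      then have "1 * (1 * a) = 1 * a" using less by blast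
      moreover have "1 * (1 * a) < 1 * a" using \<open>1 * a < a\<close> mult_less_ord[of 1 "1 * a" a] by simp
      ultimately show False by simp
    qed
  qed
qed

lemma le_mult_ord: "0 < a \<Longrightarrow> b \<le> a * (b::ordinal)"
proof (induction b rule: less_induct)
  case (less b)
  show ?case
  proof (rule ccontr)
    assume "\<not> b \<le> a * b"
    then have "a * b < b" by simp
    with less have "a * b \<le> a * (a * b)" by blast
    with mult_less_ord[OF less.prems, of "a * b" b] \<open>a * b < b\<close> show False by simp
  qed
qed

lemma mult_pos_ord: "0 < a \<Longrightarrow> 0 < b \<Longrightarrow> 0 < a * (b::ordinal)"
  by (rule less_le_trans[OF _ le_mult_ord])

lemma division_ord:
  assumes "0 < (a::ordinal)" shows "\<exists>b c. x = a * b + c \<and> c < a"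
proof -
  define b where "b = (LEAST b. x < a * b)"
  have 1: "x < a * b" unfolding b_def
    by (rule LeastI[of _ "x + 1"], rule less_le_trans[OF less_add1 le_mult_ord[OF assms]])
  have "\<exists>d<b. x < a * d + a"
  proof (rule ccontr)
    assume "\<not> ?thesis"
    then have "a * b \<le> x" by (intro times_le) (meson not_less)
    with 1 show False by simp
  qed
  then obtain d where d: "d < b" "x < a * d + a" by blast
  have "\<not> x < a * d" using d(1) unfolding b_def by (rule not_less_Least)
  then obtain c where "x = a * d + c" using le_imp_diff[of "a * d" x] by (auto simp: not_less)
  with d show ?thesis by auto
qed

subsubsection \<open>Exponentiation\<close>

lemma opow_props: "1 \<le> a \<up> b \<and> (\<forall>d<b. a \<up> d * a \<le> a \<up> b)"
proof -
  obtain u where "1 \<le> u \<and> (\<forall>d<b. a \<up> d * a < u)"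
    using ord_bounded'[of 1 b "\<lambda>d. a \<up> d * a"] by blast
  then have "\<exists>c. 1 \<le> c \<and> (\<forall>d<b. a \<up> d * a \<le> c)" by (intro exI[of _ u]) (simp add: less_imp_le)
  then show ?thesis unfolding opow.simps[of a b] by (rule LeastI_ex)
qed

lemma opow_le: "1 \<le> c \<Longrightarrow> (\<And>d. d < b \<Longrightarrow> a \<up> d * a \<le> c) \<Longrightarrow> a \<up> b \<le> c"
  unfolding opow.simps[of a b] by (rule Least_le) auto

lemma opow_pos [simp]: "0 < a \<up> b"
  using opow_props one_le_iff by blast

lemma opow_0 [simp]: "a \<up> 0 = 1"
  by (rule antisym[OF opow_le]) (auto simp: one_le_iff)

lemma opow_mono: "b \<le> c \<Longrightarrow> a \<up> b \<le> a \<up> c"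
  using opow_props[of a c] by (intro opow_le) auto

lemma opow_less [simp]: "1 < a \<Longrightarrow> a \<up> b < a \<up> c \<longleftrightarrow> b < c"
proof -
  assume a: "1 < a"
  have "a \<up> b < a \<up> c" if "b < c" for b c
    using opow_props[of a c] that a mult_less_ord[OF opow_pos, of a b 1 a] by (auto intro: less_le_trans)
  then show ?thesis using opow_mono[of c b a] by (auto simp: not_less[symmetric])
qed

lemma opow_le_iff [simp]: "1 < a \<Longrightarrow> a \<up> b \<le> a \<up> c \<longleftrightarrow> b \<le> c"
  by (simp add: not_less[symmetric])

lemma mult_right_mono_ord: "a \<le> b \<Longrightarrow> a * c \<le> b * (c::ordinal)"
proof (induction c rule: less_induct)
  case (less c)
  show ?case
  proof (rule times_le)
    fix d assume d: "d < c"
    then have "a * d \<le> b * d" using less by blast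
    then have "a * d + a \<le> b * d + a" by (rule add_right_mono_ord)
    also have "\<dots> \<le> b * d + b" using less.prems by simp
    also have "\<dots> \<le> b * c" by (rule times_props[OF d])
    finally show "a * d + a \<le> b * c" .
  qed
qed

lemma opow_add1: assumes "1 \<le> a" shows "a \<up> (b + 1) = a \<up> b * a"
proof (rule antisym)
  have "1 \<le> a \<up> b * a" using assms by (simp add: one_le_iff mult_pos_ord)
  then show "a \<up> (b + 1) \<le> a \<up> b * a"
    by (rule opow_le) (simp add: less_add1_iff mult_right_mono_ord opow_mono)
  show "a \<up> b * a \<le> a \<up> (b + 1)" using opow_props by simp
qed

lemma opow_1 [simp]: "1 \<le> a \<Longrightarrow> a \<up> 1 = a"
  using opow_add1[of a 0] by simp

lemma le_opow: "1 < a \<Longrightarrow> b \<le> a \<up> b"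
proof (induction b rule: less_induct)
  case (less b)
  show ?case
  proof (rule ccontr)
    assume "\<not> b \<le> a \<up> b"
    then have "a \<up> b < b" by simp
    with less have "a \<up> b \<le> a \<up> (a \<up> b)" by blast
    with opow_less[OF less.prems, of "a \<up> b" b] \<open>a \<up> b < b\<close> show False by simp
  qed
qed

definition is_limit :: "ordinal \<Rightarrow> bool" where
  "is_limit a \<longleftrightarrow> a \<noteq> 0 \<and> (\<nexists>d. a = d + 1)"

lemma is_limit_add1: "is_limit a \<Longrightarrow> d < a \<Longrightarrow> d + 1 < a"
  using add1_le_iff[of d a] by (auto simp: is_limit_def less_le)

text \<open>
  Together with \<open>add_0_right\<close>, \<open>add_assoc_ord\<close>, \<open>mult_0_right_ord\<close>, \<open>mult_add1\<close>, \<open>opow_0\<close> and \<open>opow_add1\<close>, the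
  following three facts are the usual recursive clauses of ordinal arithmetic.
\<close>

lemma plus_limit: assumes "is_limit b" shows "a + b = (LEAST c. \<forall>d<b. a + d \<le> c)"
proof (rule Least_equality[symmetric])
  show "\<forall>d<b. a + d \<le> a + b" by auto
  fix c assume c: "\<forall>d<b. a + d \<le> c"
  show "a + b \<le> c"
  proof (rule plus_le)
    show "a \<le> c" using c[rule_format, of 0] assms by (simp add: is_limit_def pos_iff)
    fix d assume "d < b"
    then have "a + (d + 1) \<le> c" using c is_limit_add1 assms by blast
    moreover have "a + d < a + (d + 1)" by simp
    ultimately show "a + d < c" by (rule less_le_trans[rotated])
  qed
qed

lemma times_limit: assumes "is_limit b" shows "a * b = (LEAST c. \<forall>d<b. a * d \<le> c)"
proof (rule Least_equality[symmetric])
  show "\<forall>d<b. a * d \<le> a * b" by (auto intro: mult_mono_ord)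
  fix c assume c: "\<forall>d<b. a * d \<le> c"
  show "a * b \<le> c" by (rule times_le) (simp add: c assms is_limit_add1 flip: mult_add1)
qed

lemma opow_limit: assumes "is_limit b" "1 \<le> a" shows "a \<up> b = (LEAST c. \<forall>d<b. a \<up> d \<le> c)"
proof (rule Least_equality[symmetric])
  show "\<forall>d<b. a \<up> d \<le> a \<up> b" by (auto intro: opow_mono)
  fix c assume c: "\<forall>d<b. a \<up> d \<le> c"
  show "a \<up> b \<le> c"
  proof (rule opow_le)
    show "1 \<le> c" using c[rule_format, of 0] assms by (simp add: is_limit_def pos_iff)
    show "a \<up> d * a \<le> c" if "d < b" for d
      using that c is_limit_add1[OF assms(1) that] by (simp flip: opow_add1[OF assms(2)])
  qed
qed

subsubsection \<open>The first infinite and the first uncountable ordinal; epsilon numbers\<close>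

primrec ord_of_nat :: "nat \<Rightarrow> ordinal" where
  "ord_of_nat 0 = 0"
| "ord_of_nat (Suc n) = ord_of_nat n + 1"

definition omega :: ordinal where
  "omega = (LEAST x. infinite {..<x})"

definition Omega :: ordinal where
  "Omega = (LEAST x. uncountable {..<x})"

definition nat_of_ord :: "ordinal \<Rightarrow> nat" where
  "nat_of_ord a = (THE n. ord_of_nat n = a)"

definition eps0 :: ordinal where
  "eps0 = (LEAST e. omega \<up> e = e)"

definition eps_Omega1 :: ordinal where
  "eps_Omega1 = (LEAST e. Omega < e \<and> omega \<up> e = e)"

lemma uncountable_Omega: "uncountable {..<Omega}"
  unfolding Omega_def by (rule LeastI_ex) (rule ex_uncountable)

lemma infinite_omega: "infinite {..<omega}"
  unfolding omega_def by (rule LeastI_ex) (use ex_uncountable countable_finite in blast)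

lemma finite_less_omega: "a < omega \<Longrightarrow> finite {..<a}"
  unfolding omega_def using not_less_Least by blast

lemma lessThan_add1: "{..<a + 1} = insert a {..<a::ordinal}"
  by (auto simp: less_add1_iff)

lemma lessThan_0_ord [simp]: "{..<0::ordinal} = {}"
  by auto

lemma ord_of_nat_less_omega [simp]: "ord_of_nat n < omega"
proof -
  have fin: "finite {..<ord_of_nat n}"
    by (induction n) (auto simp: lessThan_add1)
  show ?thesis
  proof (rule ccontr)
    assume "\<not> ord_of_nat n < omega"
    then have "{..<omega} \<subseteq> {..<ord_of_nat n}" by auto
    then show False using fin infinite_omega finite_subset by blast
  qed
qed

lemma ord_of_nat_less [simp]: "ord_of_nat m < ord_of_nat n \<longleftrightarrow> m < n"
proof -
  have "m < n \<Longrightarrow> ord_of_nat m < ord_of_nat n" for m n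
    by (induction n) (auto simp: less_add1_iff less_Suc_eq)
  from this[of m n] this[of n m] show ?thesis by (cases m n rule: linorder_cases) auto
qed

lemma ord_of_nat_le [simp]: "ord_of_nat m \<le> ord_of_nat n \<longleftrightarrow> m \<le> n"
  by (simp add: not_less[symmetric])

lemma ord_of_nat_eq [simp]: "ord_of_nat m = ord_of_nat n \<longleftrightarrow> m = n"
  by (simp add: order.eq_iff)

lemma less_omega_iff: "a < omega \<longleftrightarrow> (\<exists>n. a = ord_of_nat n)"
proof
  show "\<exists>n. a = ord_of_nat n" if "a < omega" using that
  proof (induction a rule: less_induct)
    case (less a)
    show ?case
    proof (cases "a = 0")
      case True then show ?thesis by (intro exI[of _ 0]) simp
    next
      case False
      define d where "d = Max {..<a}"
      have fin: "finite {..<a}" using less.prems by (rule finite_less_omega)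
      then have d: "d < a" unfolding d_def using False Max_in[OF fin] lessThan_iff[of 0 a]
        by (metis empty_iff lessThan_iff pos_iff)
      have "d + 1 = a"
      proof (rule ccontr)
        assume "d + 1 \<noteq> a"
        then have "d + 1 < a" using d add1_le_iff[of d a] by (auto simp: less_le)
        then have "d + 1 \<le> d" unfolding d_def using fin by (intro Max_ge) auto
        then show False by (simp add: add1_le_iff)
      qed
      moreover obtain n where "d = ord_of_nat n" using less.IH[OF d less_trans[OF d less.prems]] by auto
      ultimately show ?thesis by (intro exI[of _ "Suc n"]) simp
    qed
  qed
qed auto

lemma nat_of_ord_of_nat [simp]: "nat_of_ord (ord_of_nat n) = n"
  unfolding nat_of_ord_def by auto

lemma ord_of_nat_of_ord [simp]: "a < omega \<Longrightarrow> ord_of_nat (nat_of_ord a) = a"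
  by (auto simp: less_omega_iff)

lemma ord_of_nat_1 [simp]: "ord_of_nat (Suc 0) = 1"
  by simp

lemma one_less_omega [simp]: "1 < omega" and zero_less_omega [simp]: "0 < omega"
  using ord_of_nat_less_omega[of "Suc 0"] ord_of_nat_less_omega[of 0] by simp_all

lemma omega_less_Omega: "omega < Omega"
proof (rule ccontr)
  assume "\<not> omega < Omega"
  then have "{..<Omega} \<subseteq> {..<omega}" by auto
  also have "\<dots> \<subseteq> range ord_of_nat" by (auto simp: less_omega_iff)
  finally have "{..<Omega} \<subseteq> range ord_of_nat" .
  from countable_subset[OF this] have "countable {..<Omega}" by simp
  with uncountable_Omega show False by contradiction
qed

lemma ex_eps: "\<exists>e. a < e \<and> omega \<up> e = e"
proof (rule ccontr)
  assume no: "\<not> ?thesis"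
  define f where "f n = ((\<lambda>x. omega \<up> x) ^^ n) (a + 1)" for n
  have f0: "f 0 = a + 1" and fS: "f (Suc n) = omega \<up> f n" for n by (auto simp: f_def)
  have gt: "a < f n" for n
  proof (induction n)
    case (Suc n)
    also have "f n \<le> f (Suc n)" unfolding fS by (rule le_opow) simp
    finally show ?case .
  qed (simp add: f0)
  have inc: "f n < f (Suc n)" for n
    using gt[of n] no le_opow[OF one_less_omega, of "f n"] unfolding fS by (metis le_less)
  obtain u where u: "\<forall>d<omega. f (nat_of_ord d) < u"
    using ord_bounded[of omega "\<lambda>d. f (nat_of_ord d)"] by auto
  define s where "s = (LEAST s. \<forall>n. f n \<le> s)"
  have ub: "f n \<le> u" for n using u[rule_format, of "ord_of_nat n"] by simp
  have s: "\<forall>n. f n \<le> s" unfolding s_def by (rule LeastI[of _ u]) (simp add: ub)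
  have "omega \<up> s \<le> s"
  proof (rule opow_le)
    show "1 \<le> s" using s[rule_format, of 0] gt[of 0] by (simp add: one_le_iff pos_iff) (metis not_less_zero_ord zero_le_ord order.antisym)
    fix d assume "d < s"
    then have "\<not> (\<forall>n. f n \<le> d)" unfolding s_def by (rule not_less_Least)
    then obtain n where n: "d < f n" by (auto simp: not_le)
    have "omega \<up> d * omega = omega \<up> (d + 1)" by (rule opow_add1[symmetric]) (simp add: one_le_iff)
    also have "\<dots> \<le> f (Suc n)" unfolding fS by (rule opow_mono) (use n in \<open>simp add: add1_le_iff\<close>)
    finally show "omega \<up> d * omega \<le> s" using s by (meson order_trans)
  qed
  moreover have "a < s" using gt[of 0] s by (meson less_le_trans)
  ultimately show False using no le_opow[OF one_less_omega, of s] by (metis antisym)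
qed

lemma eps0_fixed: "omega \<up> eps0 = eps0"
  unfolding eps0_def by (rule LeastI_ex) (use ex_eps in blast)

lemma eps_Omega1_props: "Omega < eps_Omega1" "omega \<up> eps_Omega1 = eps_Omega1"
proof -
  have "Omega < eps_Omega1 \<and> omega \<up> eps_Omega1 = eps_Omega1"
    unfolding eps_Omega1_def by (rule LeastI_ex) (use ex_eps in blast)
  then show "Omega < eps_Omega1" "omega \<up> eps_Omega1 = eps_Omega1" by auto
qed

lemma less_opow_below_eps0: "a < eps0 \<Longrightarrow> a < omega \<up> a"
  using not_less_Least[of a "\<lambda>e. omega \<up> e = e"] le_opow[OF one_less_omega, of a]
  unfolding eps0_def by (metis le_less)

lemma opow_base_mono: "a \<le> b \<Longrightarrow> a \<up> c \<le> b \<up> c"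
proof (induction c rule: less_induct)
  case (less c)
  show ?case
  proof (rule opow_le)
    show "1 \<le> b \<up> c" by (simp add: one_le_iff)
    fix d assume d: "d < c"
    have "a \<up> d * a \<le> b \<up> d * a" using less d by (intro mult_right_mono_ord) auto
    also have "\<dots> \<le> b \<up> d * b" using less by (intro mult_mono_ord)
    also have "\<dots> \<le> b \<up> c" using d opow_props by blast
    finally show "a \<up> d * a \<le> b \<up> c" .
  qed
qed

lemma one_less_Omega [simp]: "1 < Omega"
  using one_less_omega omega_less_Omega by (rule less_trans)

lemma less_opow_below_eps_Omega1: assumes "a < eps_Omega1" shows "a < Omega \<up> a"
proof (rule ccontr)
  assume "\<not> a < Omega \<up> a"
  then have eq: "Omega \<up> a = a" using le_opow[OF one_less_Omega, of a] by auto
  have "a \<noteq> 0" using eq by auto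
  then have "Omega \<up> 1 \<le> Omega \<up> a" by (intro opow_mono) (simp add: one_le_iff pos_iff)
  then have "Omega \<le> a" using eq one_less_Omega by (simp add: less_imp_le)
  moreover have "Omega \<noteq> a"
  proof
    assume "Omega = a"
    then have "Omega \<up> Omega = Omega \<up> 1" using eq by (simp add: less_imp_le)
    moreover have "Omega \<up> 1 < Omega \<up> Omega" by simp
    ultimately show False by simp
  qed
  ultimately have gt: "Omega < a" by simp
  have "omega \<up> a \<le> a" using opow_base_mono[of omega Omega a] omega_less_Omega eq by simp
  then have "omega \<up> a = a" using le_opow[OF one_less_omega, of a] by simp
  with gt have "eps_Omega1 \<le> a" unfolding eps_Omega1_def by (intro Least_le) simp
  with assms show False by simp
qed

section \<open>Normal forms and coefficients\<close>

text \<open>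
  The \<open>\<kappa>\<close>-normal form \<open>\<xi> = \<kappa>\<^sup>\<alpha>\<beta> + \<gamma>\<close>, for \<open>\<kappa> = \<omega>\<close> (so that \<open>\<beta>\<close> is a positive natural number) and
  \<open>\<kappa> = \<Omega>\<close>. The condition \<open>\<alpha> < \<xi>\<close> is automatic below \<open>\<epsilon>\<^sub>0\<close> and \<open>\<epsilon>\<^bsub>\<Omega>+1\<^esub>\<close>, respectively.
\<close>

definition is_nf :: "ordinal \<Rightarrow> ordinal \<Rightarrow> ordinal \<Rightarrow> ordinal \<Rightarrow> ordinal \<Rightarrow> bool" where
  "is_nf \<kappa> \<xi> \<alpha> \<beta> \<gamma> \<longleftrightarrow>
     \<xi> = \<kappa> \<up> \<alpha> * \<beta> + \<gamma> \<and> \<alpha> < \<xi> \<and> 0 < \<beta> \<and> \<beta> < \<kappa> \<and> \<gamma> < \<kappa> \<up> \<alpha>"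

definition nf_exp :: "ordinal \<Rightarrow> ordinal \<Rightarrow> ordinal" where
  "nf_exp \<kappa> \<xi> = (THE \<alpha>. \<exists>\<beta> \<gamma>. is_nf \<kappa> \<xi> \<alpha> \<beta> \<gamma>)"

definition nf_coeff :: "ordinal \<Rightarrow> ordinal \<Rightarrow> ordinal" where
  "nf_coeff \<kappa> \<xi> = (THE \<beta>. \<exists>\<alpha> \<gamma>. is_nf \<kappa> \<xi> \<alpha> \<beta> \<gamma>)"

definition nf_rest :: "ordinal \<Rightarrow> ordinal \<Rightarrow> ordinal" where
  "nf_rest \<kappa> \<xi> = (THE \<gamma>. \<exists>\<alpha> \<beta>. is_nf \<kappa> \<xi> \<alpha> \<beta> \<gamma>)"

lemma mult_add_less: "\<lbrakk>b < c; r < a\<rbrakk> \<Longrightarrow> a * b + r < a * (c::ordinal)"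
proof -
  assume "b < c" "r < a"
  then have "a * b + r < a * b + a" by simp
  also have "\<dots> \<le> a * c" using \<open>b < c\<close> by (rule times_props)
  finally show ?thesis .
qed

lemma is_nf_bounds:
  assumes "is_nf \<kappa> \<xi> \<alpha> \<beta> \<gamma>"
  shows "\<kappa> \<up> \<alpha> \<le> \<xi>" "\<xi> < \<kappa> \<up> (\<alpha> + 1)" "1 < \<kappa>" "\<gamma> < \<xi>" "\<alpha> < \<xi>"
proof -
  from assms have *: "\<xi> = \<kappa> \<up> \<alpha> * \<beta> + \<gamma>" "\<alpha> < \<xi>" "0 < \<beta>" "\<beta> < \<kappa>" "\<gamma> < \<kappa> \<up> \<alpha>"
    by (auto simp: is_nf_def)
  show k: "1 < \<kappa>" using *(3,4) by (meson one_le_iff le_less_trans)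
  have "\<kappa> \<up> \<alpha> * 1 \<le> \<kappa> \<up> \<alpha> * \<beta>" using *(3) by (intro mult_mono_ord) (simp add: one_le_iff)
  then have "\<kappa> \<up> \<alpha> \<le> \<kappa> \<up> \<alpha> * \<beta>" by simp
  also have "\<dots> \<le> \<xi>" unfolding *(1) by simp
  finally show "\<kappa> \<up> \<alpha> \<le> \<xi>" .
  with *(5) show "\<gamma> < \<xi>" by (rule less_le_trans)
  show "\<xi> < \<kappa> \<up> (\<alpha> + 1)" unfolding *(1) opow_add1[OF less_imp_le[OF k]]
    using *(4,5) by (rule mult_add_less)
  show "\<alpha> < \<xi>" by fact
qed

lemma is_nf_unique:
  assumes nf: "is_nf \<kappa> \<xi> \<alpha> \<beta> \<gamma>" and nf': "is_nf \<kappa> \<xi> \<alpha>' \<beta>' \<gamma>'"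
  shows "\<alpha> = \<alpha>'" "\<beta> = \<beta>'" "\<gamma> = \<gamma>'"
proof -
  have k: "1 < \<kappa>" using is_nf_bounds[OF nf] by blast
  have "\<kappa> \<up> \<alpha> < \<kappa> \<up> (\<alpha>' + 1)" "\<kappa> \<up> \<alpha>' < \<kappa> \<up> (\<alpha> + 1)"
    using le_less_trans[OF is_nf_bounds(1)[OF nf] is_nf_bounds(2)[OF nf']]
      le_less_trans[OF is_nf_bounds(1)[OF nf'] is_nf_bounds(2)[OF nf]] .
  then show 1: "\<alpha> = \<alpha>'" using k by (simp add: less_add1_iff)
  have e: "\<kappa> \<up> \<alpha> * \<beta> + \<gamma> = \<kappa> \<up> \<alpha> * \<beta>' + \<gamma>'" "\<gamma> < \<kappa> \<up> \<alpha>" "\<gamma>' < \<kappa> \<up> \<alpha>"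
    using nf nf' 1 unfolding is_nf_def by auto
  have "\<not> \<beta> < \<beta>'"
  proof
    assume "\<beta> < \<beta>'"
    then have "\<kappa> \<up> \<alpha> * \<beta> + \<gamma> < \<kappa> \<up> \<alpha> * \<beta>'" using e by (intro mult_add_less)
    also have "\<dots> \<le> \<kappa> \<up> \<alpha> * \<beta>' + \<gamma>'" by simp
    finally show False using e by simp
  qed
  moreover have "\<not> \<beta>' < \<beta>"
  proof
    assume "\<beta>' < \<beta>"
    then have "\<kappa> \<up> \<alpha> * \<beta>' + \<gamma>' < \<kappa> \<up> \<alpha> * \<beta>" using e by (intro mult_add_less)
    also have "\<dots> \<le> \<kappa> \<up> \<alpha> * \<beta> + \<gamma>" by simp
    finally show False using e by simp
  qed
  ultimately show 2: "\<beta> = \<beta>'" by simp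
  show "\<gamma> = \<gamma>'" using e 2 by simp
qed

lemma is_nf_nf: assumes "is_nf \<kappa> \<xi> \<alpha> \<beta> \<gamma>"
  shows "nf_exp \<kappa> \<xi> = \<alpha>" "nf_coeff \<kappa> \<xi> = \<beta>" "nf_rest \<kappa> \<xi> = \<gamma>"
  unfolding nf_exp_def nf_coeff_def nf_rest_def
  by (rule the_equality; use assms is_nf_unique[OF assms] in blast)+

lemma ex_nf_is_nf: "\<exists>\<alpha> \<beta> \<gamma>. is_nf \<kappa> \<xi> \<alpha> \<beta> \<gamma> \<Longrightarrow>
    is_nf \<kappa> \<xi> (nf_exp \<kappa> \<xi>) (nf_coeff \<kappa> \<xi>) (nf_rest \<kappa> \<xi>)"
  using is_nf_nf by auto

lemma nf_ex:
  assumes k: "1 < \<kappa>" and x: "0 < \<xi>"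
  shows "\<exists>\<alpha> \<beta> \<gamma>. \<xi> = \<kappa> \<up> \<alpha> * \<beta> + \<gamma> \<and> \<kappa> \<up> \<alpha> \<le> \<xi> \<and> 0 < \<beta> \<and> \<beta> < \<kappa> \<and> \<gamma> < \<kappa> \<up> \<alpha>"
proof -
  define e where "e = (LEAST e. \<xi> < \<kappa> \<up> e)"
  have 1: "\<xi> < \<kappa> \<up> e" unfolding e_def
    by (rule LeastI[of _ "\<xi> + 1"], rule less_le_trans[OF less_add1 le_opow[OF k]])
  have "\<exists>d<e. \<xi> < \<kappa> \<up> d * \<kappa>"
  proof (rule ccontr)
    assume "\<not> ?thesis"
    then have "\<kappa> \<up> e \<le> \<xi>" using x by (intro opow_le) (simp add: one_le_iff, meson not_less)
    with 1 show False by simp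
  qed
  then obtain a where a: "a < e" "\<xi> < \<kappa> \<up> a * \<kappa>" by blast
  have le: "\<kappa> \<up> a \<le> \<xi>" using not_less_Least[OF a(1)[unfolded e_def]] by simp
  obtain b c where bc: "\<xi> = \<kappa> \<up> a * b + c" "c < \<kappa> \<up> a"
    using division_ord[OF opow_pos] by blast
  have "b \<noteq> 0" using bc le by auto
  moreover have "b < \<kappa>"
  proof (rule ccontr)
    assume "\<not> b < \<kappa>"
    then have "\<kappa> \<up> a * \<kappa> \<le> \<kappa> \<up> a * b" by (intro mult_mono_ord) simp
    also have "\<dots> \<le> \<xi>" unfolding bc by simp
    finally show False using a by simp
  qed
  ultimately show ?thesis using bc le by (intro exI[of _ a] exI[of _ b] exI[of _ c]) (simp add: pos_iff)
qed

lemma ex_nf_omega: assumes "0 < \<xi>" "\<xi> < eps0" shows "\<exists>\<alpha> \<beta> \<gamma>. is_nf omega \<xi> \<alpha> \<beta> \<gamma>"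
proof -
  obtain \<alpha> \<beta> \<gamma> where *: "\<xi> = omega \<up> \<alpha> * \<beta> + \<gamma>" "omega \<up> \<alpha> \<le> \<xi>" "0 < \<beta>" "\<beta> < omega" "\<gamma> < omega \<up> \<alpha>"
    using nf_ex[OF one_less_omega assms(1)] by blast
  have "\<alpha> \<le> \<xi>" using le_opow[OF one_less_omega] *(2) by (rule order_trans)
  then have "\<alpha> < omega \<up> \<alpha>" using assms(2) by (intro less_opow_below_eps0) simp
  then have "\<alpha> < \<xi>" using *(2) by (rule less_le_trans)
  then show ?thesis using * unfolding is_nf_def by blast
qed

lemma ex_nf_Omega: assumes "0 < \<xi>" "\<xi> < eps_Omega1" shows "\<exists>\<alpha> \<beta> \<gamma>. is_nf Omega \<xi> \<alpha> \<beta> \<gamma>"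
proof -
  obtain \<alpha> \<beta> \<gamma> where *: "\<xi> = Omega \<up> \<alpha> * \<beta> + \<gamma>" "Omega \<up> \<alpha> \<le> \<xi>" "0 < \<beta>" "\<beta> < Omega" "\<gamma> < Omega \<up> \<alpha>"
    using nf_ex[OF one_less_Omega assms(1)] by blast
  have "\<alpha> \<le> \<xi>" using le_opow[OF one_less_Omega] *(2) by (rule order_trans)
  then have "\<alpha> < Omega \<up> \<alpha>" using assms(2) by (intro less_opow_below_eps_Omega1) simp
  then have "\<alpha> < \<xi>" using *(2) by (rule less_le_trans)
  then show ?thesis using * unfolding is_nf_def by blast
qed

function coeffs :: "ordinal \<Rightarrow> ordinal \<Rightarrow> ordinal set" where
  "coeffs \<kappa> \<xi> =
     (if \<exists>\<alpha> \<beta> \<gamma>. is_nf \<kappa> \<xi> \<alpha> \<beta> \<gamma>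
      then coeffs \<kappa> (nf_exp \<kappa> \<xi>) \<union> coeffs \<kappa> (nf_rest \<kappa> \<xi>) \<union> {nf_coeff \<kappa> \<xi>}
      else {0})"
  by auto
termination
proof (relation "inv_image {(x,y). x < y} snd", goal_cases)
  case 1 show ?case by (simp add: wf_ord)
qed (use is_nf_bounds[OF ex_nf_is_nf] in auto)

declare coeffs.simps [simp del]

definition mc :: "ordinal \<Rightarrow> ordinal \<Rightarrow> ordinal" where
  "mc \<kappa> \<xi> = Max (coeffs \<kappa> \<xi>)"

lemma finite_coeffs: "finite (coeffs \<kappa> \<xi>)"
  by (induction \<kappa> \<xi> rule: coeffs.induct) (subst coeffs.simps, auto)

lemma coeffs_0 [simp]: "coeffs \<kappa> 0 = {0}"
  by (subst coeffs.simps) (auto simp: is_nf_def)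

lemma coeffs_nf: "is_nf \<kappa> \<xi> \<alpha> \<beta> \<gamma> \<Longrightarrow> coeffs \<kappa> \<xi> = coeffs \<kappa> \<alpha> \<union> coeffs \<kappa> \<gamma> \<union> {\<beta>}"
  by (subst coeffs.simps) (auto simp: is_nf_nf)

section \<open>Fundamental sequences\<close>

definition opred :: "ordinal \<Rightarrow> ordinal" where
  "opred a = (THE d. a = d + 1)"

lemma opred_add1 [simp]: "opred (a + 1) = a"
  unfolding opred_def by auto

text \<open>The value at arguments \<open>\<xi> \<ge> \<epsilon>\<^sub>0\<close> is irrelevant.\<close>

function fundseq :: "ordinal \<Rightarrow> nat \<Rightarrow> ordinal" where
  "fundseq \<xi> n =
     (if \<xi> = 0 \<or> \<xi> = 1 \<or> eps0 \<le> \<xi> then 0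
      else let \<alpha> = nf_exp omega \<xi>; \<beta> = nf_coeff omega \<xi>; \<gamma> = nf_rest omega \<xi> in
        if 0 < \<gamma> then omega \<up> \<alpha> * \<beta> + fundseq \<gamma> n
        else if 1 < \<beta> then omega \<up> \<alpha> * opred \<beta> + fundseq (omega \<up> \<alpha>) n
        else if is_limit \<alpha> then omega \<up> fundseq \<alpha> n
        else omega \<up> opred \<alpha> * ord_of_nat n)"
  by auto
termination
proof (relation "inv_image {(x,y). x < y} fst", goal_cases)
  case 1 show ?case by (simp add: wf_ord)
next
  case (2 \<xi> n x xa xb)
  then have "is_nf omega \<xi> (nf_exp omega \<xi>) (nf_coeff omega \<xi>) (nf_rest omega \<xi>)"
    by (intro ex_nf_is_nf ex_nf_omega) (auto simp: pos_iff)
  from is_nf_bounds[OF this] 2 show ?case by simp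
next
  case (3 \<xi> n x xa xb)
  then have "is_nf omega \<xi> x xa xb"
    using ex_nf_is_nf[OF ex_nf_omega[of \<xi>]] by (simp add: pos_iff not_le)
  then have e: "\<xi> = omega \<up> x * xa + xb" by (simp add: is_nf_def)
  have "omega \<up> x * 1 < omega \<up> x * xa" using 3 by (subst mult_less_ord) auto
  also have "\<dots> \<le> \<xi>" unfolding e by simp
  finally show ?case by simp
next
  case (4 \<xi> n x xa xb)
  then have "is_nf omega \<xi> x xa xb"
    using ex_nf_is_nf[OF ex_nf_omega[of \<xi>]] by (simp add: pos_iff not_le)
  from is_nf_bounds[OF this] show ?case by simp
qed

declare fundseq.simps [simp del]

lemma nf_omega_coeff_pred:
  assumes "0 < \<beta>" "\<beta> < omega" shows "\<beta> = opred \<beta> + 1" 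
proof -
  obtain n where n: "\<beta> = ord_of_nat n" using assms less_omega_iff by blast
  then obtain m where "n = Suc m" using assms by (cases n) auto
  with n show ?thesis by simp
qed

lemma not_limit_opred: "a \<noteq> 0 \<Longrightarrow> \<not> is_limit a \<Longrightarrow> a = opred a + 1"
  by (auto simp: is_limit_def)

lemma eps0_pos: "0 < eps0" 
  using opow_pos[of omega eps0] unfolding eps0_fixed .

lemma fundseq_less: "0 < \<xi> \<Longrightarrow> \<xi> < eps0 \<Longrightarrow> fundseq \<xi> n < \<xi>"
proof (induction \<xi> rule: less_induct)
  case (less \<xi>)
  show ?case
  proof (cases "\<xi> = 1")
    case True then show ?thesis by (subst fundseq.simps) simp
  next
    case False
    define \<alpha> \<beta> \<gamma> where d: "\<alpha> = nf_exp omega \<xi>" "\<beta> = nf_coeff omega \<xi>" "\<gamma> = nf_rest omega \<xi>"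
    have nf: "is_nf omega \<xi> \<alpha> \<beta> \<gamma>" unfolding d using less.prems by (intro ex_nf_is_nf ex_nf_omega)
    then have e: "\<xi> = omega \<up> \<alpha> * \<beta> + \<gamma>" "\<alpha> < \<xi>" "0 < \<beta>" "\<beta> < omega" "\<gamma> < omega \<up> \<alpha>"
      by (auto simp: is_nf_def)
    note b = is_nf_bounds[OF nf]
    have eq: "fundseq \<xi> n = (if 0 < \<gamma> then omega \<up> \<alpha> * \<beta> + fundseq \<gamma> n
        else if 1 < \<beta> then omega \<up> \<alpha> * opred \<beta> + fundseq (omega \<up> \<alpha>) n
        else if is_limit \<alpha> then omega \<up> fundseq \<alpha> n
        else omega \<up> opred \<alpha> * ord_of_nat n)"
      unfolding fundseq.simps[of \<xi> n] Let_def d[symmetric]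
      using less.prems False by (auto simp: pos_iff)
    consider "0 < \<gamma>" | "\<gamma> = 0" "1 < \<beta>" | "\<gamma> = 0" "\<beta> = 1" "is_limit \<alpha>" | "\<gamma> = 0" "\<beta> = 1" "\<not> is_limit \<alpha>"
      using e(3) by (metis less_one_iff not_less_iff_gr_or_eq pos_iff)
    then show ?thesis
    proof cases
      case 1
      then have "fundseq \<gamma> n < \<gamma>" using less.IH[OF b(4)] less.prems b(4) by simp
      then show ?thesis using 1 unfolding eq by (simp add: e(1))
    next
      case 2
      have "omega \<up> \<alpha> * 1 < omega \<up> \<alpha> * \<beta>" using 2 by (subst mult_less_ord) auto
      then have l: "omega \<up> \<alpha> < \<xi>" using e(1) 2 by simp
      then have "fundseq (omega \<up> \<alpha>) n < omega \<up> \<alpha>" using less.IH[OF l] less.prems by simp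
      moreover have "opred \<beta> < \<beta>" using nf_omega_coeff_pred[OF e(3,4)] less_add1 by metis
      ultimately have "omega \<up> \<alpha> * opred \<beta> + fundseq (omega \<up> \<alpha>) n < omega \<up> \<alpha> * \<beta>"
        by (intro mult_add_less)
      then show ?thesis using 2 unfolding eq by (simp add: e(1))
    next
      case 3
      then have "fundseq \<alpha> n < \<alpha>"
        using less.IH[OF b(5)] less.prems b(5) by (simp add: is_limit_def pos_iff)
      then show ?thesis using 3 unfolding eq by (simp add: e(1))
    next
      case 4
      have "\<alpha> \<noteq> 0" using False e(1) 4 by auto
      then have "\<alpha> = opred \<alpha> + 1" using 4 by (intro not_limit_opred)
      then have "omega \<up> \<alpha> = omega \<up> opred \<alpha> * omega" using opow_add1[of omega "opred \<alpha>"] by (simp add: one_le_iff)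
      then show ?thesis using 4 unfolding eq by (simp add: e(1))
    qed
  qed
qed

section \<open>The functions \<open>\<AA>\<^sub>k\<close> and \<open>\<AA>\<^sub>\<omega>\<close>\<close>

text \<open>Every \<open>\<xi> \<ge> \<omega>\<close> is uniquely of the form \<open>\<alpha> + b\<close> with \<open>\<alpha>\<close> a limit and \<open>b\<close> finite.\<close>

definition limit_part :: "ordinal \<Rightarrow> ordinal" where
  "limit_part \<xi> = (THE \<alpha>. is_limit \<alpha> \<and> (\<exists>b. \<xi> = \<alpha> + ord_of_nat b))"

definition finite_part :: "ordinal \<Rightarrow> nat" where
  "finite_part \<xi> = (THE b. \<exists>\<alpha>. is_limit \<alpha> \<and> \<xi> = \<alpha> + ord_of_nat b)"

lemma limit_add_nat: "is_limit a \<Longrightarrow> d < a \<Longrightarrow> d + ord_of_nat n < a"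
proof (induction n)
  case (Suc n)
  then show ?case using is_limit_add1[of a "d + ord_of_nat n"] by (simp add: add_assoc_ord)
qed simp

lemma limit_decomp_unique:
  assumes "is_limit \<alpha>" "is_limit \<alpha>'" "\<alpha> + ord_of_nat b = \<alpha>' + ord_of_nat b'"
  shows "\<alpha> = \<alpha>'" "b = b'"
proof -
  have *: False if "is_limit \<alpha>'" "\<alpha> < \<alpha>'" "\<alpha> + ord_of_nat b = \<alpha>' + ord_of_nat b'" for \<alpha> \<alpha>' b b'
    using less_le_trans[OF limit_add_nat[OF that(1,2), of b] le_add1o[of \<alpha>' "ord_of_nat b'"]] that(3) by simp
  show "\<alpha> = \<alpha>'" using *[of \<alpha>' \<alpha> b b'] *[of \<alpha> \<alpha>' b' b] assms by (metis linorder_neqE)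
  then show "b = b'" using assms(3) by simp
qed

lemma limit_decomp_ex: "omega \<le> \<xi> \<Longrightarrow> \<exists>\<alpha> b. is_limit \<alpha> \<and> \<xi> = \<alpha> + ord_of_nat b"
proof (induction \<xi> rule: less_induct)
  case (less \<xi>)
  show ?case
  proof (cases "is_limit \<xi>")
    case True then show ?thesis by (intro exI[of _ \<xi>] exI[of _ 0]) simp
  next
    case False
    have "\<xi> \<noteq> 0" using less_le_trans[OF zero_less_omega less.prems] by auto
    then obtain d where d: "\<xi> = d + 1" using False by (auto simp: is_limit_def)
    have "omega \<le> d"
    proof (rule ccontr)
      assume "\<not> omega \<le> d"
      then obtain n where "d = ord_of_nat n" using less_omega_iff[of d] by auto
      then have "\<xi> = ord_of_nat (Suc n)" using d by simp
      then show False using less.prems ord_of_nat_less_omega[of "Suc n"] by simp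
    qed
    then obtain \<alpha> b where "is_limit \<alpha>" "d = \<alpha> + ord_of_nat b"
      using less.IH[of d] d by auto
    then show ?thesis using d 
      by (intro exI[of _ \<alpha>] exI[of _ "Suc b"]) (simp add: add_assoc_ord)
  qed
qed

lemma limit_decomp_eq:
  assumes "is_limit \<alpha>"
  shows "limit_part (\<alpha> + ord_of_nat b) = \<alpha>" "finite_part (\<alpha> + ord_of_nat b) = b"
  unfolding limit_part_def finite_part_def
  by (rule the_equality; use assms limit_decomp_unique[OF assms] in blast)+

lemma limit_decomp:
  assumes "omega \<le> \<xi>"
  shows "is_limit (limit_part \<xi>)" "\<xi> = limit_part \<xi> + ord_of_nat (finite_part \<xi>)" "limit_part \<xi> \<le> \<xi>"
proof -
  obtain \<alpha> b where *: "is_limit \<alpha>" "\<xi> = \<alpha> + ord_of_nat b" using limit_decomp_ex[OF assms] by blast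
  then show "is_limit (limit_part \<xi>)" "\<xi> = limit_part \<xi> + ord_of_nat (finite_part \<xi>)" "limit_part \<xi> \<le> \<xi>"
    by (simp_all add: limit_decomp_eq)
qed

text \<open>
  \<open>AA k \<xi>\<close> is \<open>\<AA>\<^sub>k(\<xi>)\<close>; the value at \<open>\<xi> \<ge> \<epsilon>\<^sub>0\<close> is irrelevant. For \<open>\<xi> \<ge> \<omega>\<close> the \<open>i\<close>-fold iterate below is
  \<open>\<AA>\<^sub>k\<^sup>(\<^sup>i\<^sup>)(\<xi>)\<close>.
\<close>

function AA :: "nat \<Rightarrow> ordinal \<Rightarrow> nat" where
  "AA k \<xi> =
     (if eps0 \<le> \<xi> then 0
      else if \<xi> < omega then nat_of_ord \<xi> + 1
      else let \<alpha> = limit_part \<xi>; b = finite_part \<xi> in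
        ((\<lambda>x. AA k (fundseq \<alpha> x)) ^^ k)
          (if 0 < b then AA k (\<alpha> + ord_of_nat (b - 1)) else nat_of_ord (mc omega \<xi>)))"
  by auto
termination
proof (relation "inv_image {(x,y). x < y} snd", goal_cases)
  case 1 show ?case by (simp add: wf_ord)
next
  case (2 k \<xi> \<alpha> b x)
  then have l: "is_limit \<alpha>" "\<alpha> \<le> \<xi>" using limit_decomp[of \<xi>] by simp_all
  have "fundseq \<alpha> x < \<alpha>" using 2 l by (intro fundseq_less) (auto simp: is_limit_def pos_iff)
  then show ?case using l by simp
next
  case (3 k \<xi> \<alpha> b)
  then have x: "\<xi> = \<alpha> + ord_of_nat b" using limit_decomp[of \<xi>] by simp
  have "\<alpha> + ord_of_nat (b - 1) < \<alpha> + ord_of_nat b" using 3 by simp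
  then show ?case unfolding x[symmetric] by simp
qed

declare AA.simps [simp del]

function AA_omega :: "ordinal \<Rightarrow> ordinal" where
  "AA_omega \<xi> = (LEAST \<theta>. mc Omega \<xi> < \<theta> \<and> (\<forall>\<zeta><\<xi>. mc Omega \<zeta> < \<theta> \<longrightarrow> AA_omega \<zeta> < \<theta>))"
  by auto
termination by (relation "{(x,y). x < y}") (auto simp: wf_ord)

declare AA_omega.simps [simp del]

definition AA_at :: "ordinal \<Rightarrow> ordinal \<Rightarrow> ordinal" where
  "AA_at l \<xi> = (if l < omega then ord_of_nat (AA (nat_of_ord l) \<xi>) else AA_omega \<xi>)"

lemma AA_omega_props:
  "mc Omega \<xi> < AA_omega \<xi>" "\<zeta> < \<xi> \<Longrightarrow> mc Omega \<zeta> < AA_omega \<xi> \<Longrightarrow> AA_omega \<zeta> < AA_omega \<xi>"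
proof -
  obtain u where u: "\<forall>d<\<xi>. AA_omega d < u" using ord_bounded[of \<xi> AA_omega] by auto
  obtain v where v: "mc Omega \<xi> < v" using ord_no_top by auto
  have "\<exists>\<theta>. mc Omega \<xi> < \<theta> \<and> (\<forall>\<zeta><\<xi>. mc Omega \<zeta> < \<theta> \<longrightarrow> AA_omega \<zeta> < \<theta>)"
    by (rule exI[of _ "max u v"]) (use u v in \<open>auto simp: less_max_iff_disj\<close>)
  then have "mc Omega \<xi> < AA_omega \<xi> \<and> (\<forall>\<zeta><\<xi>. mc Omega \<zeta> < AA_omega \<xi> \<longrightarrow> AA_omega \<zeta> < AA_omega \<xi>)"
    unfolding AA_omega.simps[of \<xi>] by (rule LeastI_ex)
  then show "mc Omega \<xi> < AA_omega \<xi>" "\<zeta> < \<xi> \<Longrightarrow> mc Omega \<zeta> < AA_omega \<xi> \<Longrightarrow> AA_omega \<zeta> < AA_omega \<xi>" by auto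
qed

section \<open>Growth of \<open>\<AA>\<^sub>k\<close>\<close>

text \<open>
  The facts \<open>mc_less_A\<close> and \<open>finite_AA_le\<close> proved here are what makes \<open>k\<close>-normal forms exist uniquely
  (\<open>ex1_k_nf\<close>) and the base change below terminate.
\<close>

lemma coeffs_ne: "coeffs \<kappa> \<xi> \<noteq> {}"
  by (subst coeffs.simps) auto

lemma mc_nf: assumes "is_nf \<kappa> \<xi> \<alpha> \<beta> \<gamma>" shows "mc \<kappa> \<xi> = max (max (mc \<kappa> \<alpha>) (mc \<kappa> \<gamma>)) \<beta>"
  unfolding mc_def coeffs_nf[OF assms]
  by (simp add: Max_Un finite_coeffs coeffs_ne Max_insert max.commute)

lemma mc_0 [simp]: "mc \<kappa> 0 = 0"
  by (simp add: mc_def)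

lemma mc_less_omega [simp]: "mc omega \<xi> < omega"
proof -
  have "coeffs omega \<xi> \<subseteq> {..<omega}"
  proof (induction \<xi> rule: less_induct)
    case (less \<xi>)
    show ?case
    proof (cases "\<exists>\<alpha> \<beta> \<gamma>. is_nf omega \<xi> \<alpha> \<beta> \<gamma>")
      case True
      then obtain \<alpha> \<beta> \<gamma> where nf: "is_nf omega \<xi> \<alpha> \<beta> \<gamma>" by auto
      have "\<beta> < omega" using nf by (simp add: is_nf_def)
      then show ?thesis unfolding coeffs_nf[OF nf]
        using less[OF is_nf_bounds(4)[OF nf]] less[OF is_nf_bounds(5)[OF nf]] by simp
    next
      case False then show ?thesis by (subst coeffs.simps) auto
    qed
  qed
  then show ?thesis unfolding mc_def using Max_in[OF finite_coeffs coeffs_ne] by blast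
qed

lemma is_nf_finite: "0 < \<xi> \<Longrightarrow> \<xi> < omega \<Longrightarrow> is_nf omega \<xi> 0 \<xi> 0"
  by (simp add: is_nf_def)

lemma mc_finite: "\<xi> < omega \<Longrightarrow> mc omega \<xi> = \<xi>"
  by (cases "\<xi> = 0") (simp_all add: mc_nf[OF is_nf_finite] pos_iff max_def)

lemma opow_omega_not_succ: assumes "\<alpha> \<noteq> 0" shows "omega \<up> \<alpha> \<noteq> \<gamma> + 1"
proof
  assume e: "omega \<up> \<alpha> = \<gamma> + 1"
  have "omega \<up> 0 < omega \<up> \<alpha>" using assms by (subst opow_less) (auto simp: pos_iff)
  then have "\<gamma> \<noteq> 0" using e by auto
  then obtain a b c where *: "\<gamma> = omega \<up> a * b + c" "omega \<up> a \<le> \<gamma>" "0 < b" "b < omega" "c < omega \<up> a"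
    using nf_ex[OF one_less_omega, of \<gamma>] by (auto simp: pos_iff)
  have "\<gamma> < omega \<up> \<alpha>" unfolding e by simp
  with *(2) have "omega \<up> a < omega \<up> \<alpha>" by (rule le_less_trans)
  then have "a + 1 \<le> \<alpha>" by (simp add: add1_le_iff)
  then have "omega \<up> (a + 1) \<le> omega \<up> \<alpha>" by (rule opow_mono)
  then have 1: "omega \<up> a * omega \<le> \<gamma> + 1" using e by (simp add: opow_add1 less_imp_le)
  have "c + 1 \<le> omega \<up> a" using *(5) by (simp add: add1_le_iff)
  then have "\<gamma> + 1 \<le> omega \<up> a * b + omega \<up> a" unfolding *(1) by (simp add: add_assoc_ord)
  also have "\<dots> = omega \<up> a * (b + 1)" by (simp add: mult_add1)
  also have "\<dots> < omega \<up> a * omega"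
  proof -
    obtain n where "b = ord_of_nat n" using *(4) less_omega_iff by auto
    then have "b + 1 < omega" using ord_of_nat_less_omega[of "Suc n"] by simp
    then show ?thesis by (subst mult_less_ord) auto
  qed
  finally show False using 1 by simp
qed

lemma opow_omega_limit: "\<alpha> \<noteq> 0 \<Longrightarrow> is_limit (omega \<up> \<alpha>)"
  unfolding is_limit_def using opow_omega_not_succ opow_pos[of omega \<alpha>] by (auto simp: pos_iff)

lemma fundseq_cases [consumes 2, case_names rest coeff limit succ]:
  assumes "is_limit \<xi>" "\<xi> < eps0"
  obtains \<alpha> \<beta> \<gamma> where "is_nf omega \<xi> \<alpha> \<beta> \<gamma>" "is_limit \<gamma>"
      "\<And>n. fundseq \<xi> n = omega \<up> \<alpha> * \<beta> + fundseq \<gamma> n"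
      "\<And>n. is_nf omega (fundseq \<xi> n) \<alpha> \<beta> (fundseq \<gamma> n)"
    | \<alpha> \<beta> where "is_nf omega \<xi> \<alpha> (\<beta> + 1) 0" "is_limit (omega \<up> \<alpha>)" "omega \<up> \<alpha> < \<xi>"
      "\<And>n. fundseq \<xi> n = omega \<up> \<alpha> * \<beta> + fundseq (omega \<up> \<alpha>) n"
      "\<And>n. is_nf omega (fundseq \<xi> n) \<alpha> \<beta> (fundseq (omega \<up> \<alpha>) n)"
    | \<alpha> where "is_nf omega \<xi> \<alpha> 1 0" "\<xi> = omega \<up> \<alpha>" "is_limit \<alpha>"
      "\<And>n. fundseq \<xi> n = omega \<up> fundseq \<alpha> n"
      "\<And>n. is_nf omega (fundseq \<xi> n) (fundseq \<alpha> n) 1 0"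
    | \<delta> where "is_nf omega \<xi> (\<delta> + 1) 1 0" "\<xi> = omega \<up> (\<delta> + 1)"
      "\<And>n. fundseq \<xi> n = omega \<up> \<delta> * ord_of_nat n"
      "\<And>n. 0 < n \<Longrightarrow> is_nf omega (fundseq \<xi> n) \<delta> (ord_of_nat n) 0"
proof -
  have x: "\<xi> \<noteq> 0" "\<xi> \<noteq> 1" using assms(1) unfolding is_limit_def by (auto simp: add_0_left dest: spec[of _ 0])
  then obtain \<alpha> \<beta> \<gamma> where nf: "is_nf omega \<xi> \<alpha> \<beta> \<gamma>" using ex_nf_omega[OF _ assms(2)] by (auto simp: pos_iff)
  then have e: "\<xi> = omega \<up> \<alpha> * \<beta> + \<gamma>" "\<alpha> < \<xi>" "0 < \<beta>" "\<beta> < omega" "\<gamma> < omega \<up> \<alpha>"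
    by (auto simp: is_nf_def)
  note b = is_nf_bounds[OF nf]
  have small: "\<alpha> < eps0" "\<gamma> < eps0" "omega \<up> \<alpha> < eps0" using b assms(2) by auto
  have eq: "fundseq \<xi> n = (if 0 < \<gamma> then omega \<up> \<alpha> * \<beta> + fundseq \<gamma> n
        else if 1 < \<beta> then omega \<up> \<alpha> * opred \<beta> + fundseq (omega \<up> \<alpha>) n
        else if is_limit \<alpha> then omega \<up> fundseq \<alpha> n
        else omega \<up> opred \<alpha> * ord_of_nat n)" for n
    unfolding fundseq.simps[of \<xi> n] Let_def is_nf_nf[OF nf] using x assms(2) by (auto simp: pos_iff)
  have bp: "\<beta> = opred \<beta> + 1" by (rule nf_omega_coeff_pred[OF e(3,4)])
  have aw: "\<alpha> < omega \<up> \<alpha>" using small(1) by (rule less_opow_below_eps0)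
  have lep: "omega \<up> \<alpha> \<le> omega \<up> \<alpha> * b" if "0 < b" for b
    using mult_mono_ord[of 1 b "omega \<up> \<alpha>"] that by (simp add: one_le_iff)
  consider "0 < \<gamma>" | "\<gamma> = 0" "1 < \<beta>" | "\<gamma> = 0" "\<beta> = 1" "is_limit \<alpha>" | "\<gamma> = 0" "\<beta> = 1" "\<not> is_limit \<alpha>"
    using e(3) by (metis less_one_iff not_less_iff_gr_or_eq pos_iff)
  then show thesis
  proof cases
    case 1
    have "is_limit \<gamma>"
      using assms(1) 1 unfolding is_limit_def e(1) by (auto simp: pos_iff simp flip: add_assoc_ord)
    moreover have "is_nf omega (fundseq \<xi> n) \<alpha> \<beta> (fundseq \<gamma> n)" for n
    proof -
      have "fundseq \<gamma> n < omega \<up> \<alpha>" using fundseq_less[OF 1 small(2)] e(5) by (rule less_trans)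
      moreover have "\<alpha> < omega \<up> \<alpha> * \<beta> + fundseq \<gamma> n"
        using aw lep[OF e(3)] by (meson le_add1o less_le_trans)
      ultimately show ?thesis using 1 e(3,4) unfolding is_nf_def eq by simp
    qed
    ultimately show ?thesis using that(1)[OF nf] 1 eq by simp
  next
    case 2
    have \<alpha>0: "\<alpha> \<noteq> 0"
    proof
      assume "\<alpha> = 0"
      then have "\<xi> = opred \<beta> + 1" using e(1) 2 bp by simp
      then show False using assms(1) by (auto simp: is_limit_def)
    qed
    have p: "0 < opred \<beta>" "opred \<beta> < omega" 
      using 2(2) bp less_add1[of "opred \<beta>"] e(4)
      by (metis add_0_left less_irrefl pos_iff, metis less_trans)
    have lt: "omega \<up> \<alpha> < \<xi>"
    proof -
      have "omega \<up> \<alpha> * 1 < omega \<up> \<alpha> * \<beta>" using 2 by (subst mult_less_ord) auto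
      then show ?thesis using e(1) 2 by simp
    qed
    have "is_nf omega (fundseq \<xi> n) \<alpha> (opred \<beta>) (fundseq (omega \<up> \<alpha>) n)" for n
    proof -
      have "\<alpha> < omega \<up> \<alpha> * opred \<beta> + fundseq (omega \<up> \<alpha>) n"
        using aw lep[OF p(1)] by (meson le_add1o less_le_trans)
      then show ?thesis using 2 p fundseq_less[OF opow_pos small(3)] unfolding is_nf_def eq by simp
    qed
    then show ?thesis using that(2)[of \<alpha> "opred \<beta>"] nf 2 bp eq lt opow_omega_limit[OF \<alpha>0] by simp
  next
    case 3
    have "is_nf omega (fundseq \<xi> n) (fundseq \<alpha> n) 1 0" for n
    proof -
      have "fundseq \<alpha> n < \<alpha>" using 3 small by (intro fundseq_less) (auto simp: is_limit_def pos_iff)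
      then have "fundseq \<alpha> n < eps0" using small by simp
      then have "fundseq \<alpha> n < omega \<up> fundseq \<alpha> n" by (rule less_opow_below_eps0)
      then show ?thesis using 3 unfolding is_nf_def eq by simp
    qed
    then show ?thesis using that(3)[of \<alpha>] nf 3 eq e(1) by simp
  next
    case 4
    have "\<alpha> \<noteq> 0" using e(1) 4 x by auto
    then have ap: "\<alpha> = opred \<alpha> + 1" using 4 by (intro not_limit_opred)
    have "is_nf omega (fundseq \<xi> n) (opred \<alpha>) (ord_of_nat n) 0" if "0 < n" for n
    proof -
      have n: "0 < ord_of_nat n" using that ord_of_nat_less[of 0 n] by simp
      have "opred \<alpha> < \<alpha>" using ap less_add1 by metis
      then have "opred \<alpha> < omega \<up> opred \<alpha>" using small by (intro less_opow_below_eps0) simp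
      also have "\<dots> \<le> omega \<up> opred \<alpha> * ord_of_nat n"
        using mult_mono_ord[of 1 "ord_of_nat n" "omega \<up> opred \<alpha>"] n by (simp add: one_le_iff)
      finally show ?thesis using 4 n unfolding is_nf_def eq by simp
    qed
    then show ?thesis using that(4)[of "opred \<alpha>"] nf 4 eq e(1) ap by simp
  qed
qed

lemma mc_fundseq: "is_limit \<xi> \<Longrightarrow> \<xi> < eps0 \<Longrightarrow> ord_of_nat n \<le> mc omega (fundseq \<xi> n)"
proof (induction \<xi> rule: less_induct)
  case (less \<xi>)
  show ?case using less.prems
  proof (cases rule: fundseq_cases)
    case (rest \<alpha> \<beta> \<gamma>)
    then have "ord_of_nat n \<le> mc omega (fundseq \<gamma> n)"
      using less.IH[of \<gamma>] less.prems is_nf_bounds(4)[OF rest(1)] by simp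
    then show ?thesis by (simp add: mc_nf[OF rest(4)[of n]] le_max_iff_disj)
  next
    case (coeff \<alpha> \<beta>)
    then have "ord_of_nat n \<le> mc omega (fundseq (omega \<up> \<alpha>) n)"
      using less.IH[of "omega \<up> \<alpha>"] less.prems by simp
    then show ?thesis by (simp add: mc_nf[OF coeff(5)[of n]] le_max_iff_disj)
  next
    case (limit \<alpha>)
    then have "ord_of_nat n \<le> mc omega (fundseq \<alpha> n)"
      using less.IH[of \<alpha>] less.prems is_nf_bounds(5)[OF limit(1)] by simp
    then show ?thesis by (simp add: mc_nf[OF limit(5)[of n]] le_max_iff_disj)
  next
    case (succ \<delta>)
    show ?thesis
    proof (cases "n = 0")
      case False
      then have "is_nf omega (fundseq \<xi> n) \<delta> (ord_of_nat n) 0" by (intro succ(4)) simp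
      from mc_nf[OF this] show ?thesis by (simp add: le_max_iff_disj)
    qed simp
  qed
qed

lemma add1_le_cancel [simp]: "a + 1 \<le> b + 1 \<longleftrightarrow> a \<le> (b::ordinal)"
  by (simp add: add1_le_iff less_add1_iff)

lemma mc_add1: "\<xi> < eps0 \<Longrightarrow> mc omega (\<xi> + 1) \<le> mc omega \<xi> + 1"
proof (induction \<xi> rule: less_induct)
  case (less \<xi>)
  show ?case
  proof (cases "\<xi> < omega")
    case True
    then obtain n where "\<xi> = ord_of_nat n" using less_omega_iff by auto
    then have "\<xi> + 1 < omega" using ord_of_nat_less_omega[of "Suc n"] by simp
    with True show ?thesis by (simp add: mc_finite)
  next
    case False
    then have "0 < \<xi>" using zero_less_omega by (metis not_less order_less_le_trans)
    then obtain \<alpha> \<beta> \<gamma> where nf: "is_nf omega \<xi> \<alpha> \<beta> \<gamma>" using ex_nf_omega[OF _ less.prems] by auto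
    then have e: "\<xi> = omega \<up> \<alpha> * \<beta> + \<gamma>" "\<alpha> < \<xi>" "0 < \<beta>" "\<beta> < omega" "\<gamma> < omega \<up> \<alpha>"
      by (auto simp: is_nf_def)
    have "\<alpha> \<noteq> 0" using e False by auto
    then have "\<gamma> + 1 < omega \<up> \<alpha>" using opow_omega_limit is_limit_add1 e(5) by blast
    moreover have "\<alpha> < \<xi> + 1" using e(2) less_add1 by (rule less_trans)
    ultimately have nf': "is_nf omega (\<xi> + 1) \<alpha> \<beta> (\<gamma> + 1)" using e by (simp add: is_nf_def add_assoc_ord)
    have IH: "mc omega (\<gamma> + 1) \<le> mc omega \<gamma> + 1" using less.IH[of \<gamma>] is_nf_bounds(4)[OF nf] less.prems by simp
    show ?thesis unfolding mc_nf[OF nf] mc_nf[OF nf']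
    proof (intro max.boundedI)
      let ?M = "max (max (mc omega \<alpha>) (mc omega \<gamma>)) \<beta>"
      show "mc omega \<alpha> \<le> ?M + 1" "\<beta> \<le> ?M + 1"
        by (rule order_trans[OF _ le_add1o], simp add: le_max_iff_disj)+
      show "mc omega (\<gamma> + 1) \<le> ?M + 1" 
        by (rule order_trans[OF IH]) (simp add: le_max_iff_disj)
    qed
  qed
qed

abbreviation mcn :: "ordinal \<Rightarrow> nat" where "mcn \<xi> \<equiv> nat_of_ord (mc omega \<xi>)"

lemma ord_of_nat_mcn [simp]: "ord_of_nat (mcn \<xi>) = mc omega \<xi>"
  by simp

lemma mcn_fundseq: "is_limit \<xi> \<Longrightarrow> \<xi> < eps0 \<Longrightarrow> n \<le> mcn (fundseq \<xi> n)"
  using mc_fundseq[of \<xi> n] ord_of_nat_le[of n "mcn (fundseq \<xi> n)"] by simp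

lemma mcn_add1: "\<xi> < eps0 \<Longrightarrow> mcn (\<xi> + 1) \<le> Suc (mcn \<xi>)"
  using mc_add1[of \<xi>] ord_of_nat_le[of "mcn (\<xi> + 1)" "Suc (mcn \<xi>)"] by simp

lemma AA_finite: "\<xi> < eps0 \<Longrightarrow> \<xi> < omega \<Longrightarrow> AA k \<xi> = nat_of_ord \<xi> + 1"
  by (simp add: AA.simps)

lemma AA_infinite:
  assumes "\<xi> < eps0" "omega \<le> \<xi>"
  shows "AA k \<xi> = ((\<lambda>x. AA k (fundseq (limit_part \<xi>) x)) ^^ k)
    (if 0 < finite_part \<xi> then AA k (limit_part \<xi> + ord_of_nat (finite_part \<xi> - 1)) else mcn \<xi>)"
  using assms unfolding AA.simps[of k \<xi>] Let_def by auto

lemma funpow_gt: "(\<And>x. x < f x) \<Longrightarrow> a + n \<le> (f ^^ n) (a::nat)"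
proof (induction n)
  case (Suc n)
  have "(f ^^ n) a < f ((f ^^ n) a)" by (rule Suc.prems)
  with Suc.IH[OF Suc.prems] show ?case by simp
qed simp

lemma AA_init:
  assumes "\<xi> < eps0" "omega \<le> \<xi>" and IH: "\<And>\<zeta>. \<zeta> < \<xi> \<Longrightarrow> mcn \<zeta> < AA k \<zeta>"
  shows "mcn \<xi> \<le> (if 0 < finite_part \<xi> then AA k (limit_part \<xi> + ord_of_nat (finite_part \<xi> - 1)) else mcn \<xi>)"
proof (cases "0 < finite_part \<xi>")
  case True
  then obtain b where b: "finite_part \<xi> = Suc b" using gr0_conv_Suc by auto
  let ?z = "limit_part \<xi> + ord_of_nat b"
  have x: "\<xi> = ?z + 1" using limit_decomp(2)[OF assms(2)] b by (simp add: add_assoc_ord)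
  then have lt: "?z < \<xi>" using less_add1 by metis
  then have "mcn \<xi> \<le> Suc (mcn ?z)" using mcn_add1[of ?z] assms(1) x by simp
  also have "\<dots> \<le> AA k ?z" using IH[OF lt] by simp
  finally show ?thesis using b by simp
qed simp

lemma mc_less_A: assumes k: "0 < k" shows "\<xi> < eps0 \<Longrightarrow> mcn \<xi> < AA k \<xi>"
proof (induction \<xi> rule: less_induct)
  case (less \<xi>)
  show ?case
  proof (cases "\<xi> < omega")
    case True then show ?thesis using less.prems by (simp add: AA_finite mc_finite)
  next
    case False
    then have w: "omega \<le> \<xi>" by simp
    let ?\<alpha> = "limit_part \<xi>"
    note d = limit_decomp[OF w]
    have "x < AA k (fundseq ?\<alpha> x)" for x
    proof -
      have "?\<alpha> < eps0" using d less.prems by simp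
      then have "fundseq ?\<alpha> x < ?\<alpha>" using d by (intro fundseq_less) (auto simp: is_limit_def pos_iff)
      then have "fundseq ?\<alpha> x < \<xi>" using d(3) by simp
      then have "mcn (fundseq ?\<alpha> x) < AA k (fundseq ?\<alpha> x)" using less by simp
      moreover have "x \<le> mcn (fundseq ?\<alpha> x)" using d(1) \<open>?\<alpha> < eps0\<close> by (rule mcn_fundseq)
      ultimately show ?thesis by simp
    qed
    from funpow_gt[of "\<lambda>x. AA k (fundseq ?\<alpha> x)", OF this, of _ k]
    have *: "a < ((\<lambda>x. AA k (fundseq ?\<alpha> x)) ^^ k) a" for a
      using k by (metis add.commute less_add_same_cancel2 less_le_trans)
    show ?thesis unfolding AA_infinite[OF less.prems w]
      by (rule le_less_trans[OF AA_init[OF less.prems w] *]) (use less in auto)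
  qed
qed

text \<open>There are only finitely many \<open>\<zeta> < \<epsilon>\<^sub>0\<close> with \<open>\<AA>\<^sub>k(\<zeta>) \<le> m\<close>.\<close>

lemma finite_mc_bounded: "a < eps0 \<Longrightarrow> finite {\<zeta>. \<zeta> < a \<and> mc omega \<zeta> \<le> ord_of_nat m}"
proof (induction a rule: less_induct)
  case (less a)
  let ?F = "\<lambda>x. {\<zeta>. \<zeta> < x \<and> mc omega \<zeta> \<le> ord_of_nat m}"
  show ?case
  proof (cases "a = 0")
    case False
    then obtain \<delta> \<beta> \<gamma> where nfa: "is_nf omega a \<delta> \<beta> \<gamma>"
      using ex_nf_omega[OF _ less.prems] by (auto simp: pos_iff)
    let ?E = "{e \<in> insert \<delta> (?F \<delta>). omega \<up> e < a}"
    let ?T = "{0} \<union> (\<lambda>(e,b,g). omega \<up> e * b + g) ` (SIGMA e:?E. ord_of_nat ` {..m} \<times> ?F (omega \<up> e))"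
    have \<delta>: "\<delta> < a" using is_nf_bounds(5)[OF nfa] .
    have "finite ?E" using less.IH[OF \<delta>] less.prems \<delta> by simp
    moreover have "finite (?F (omega \<up> e))" if "e \<in> ?E" for e
    proof -
      have e: "omega \<up> e < a" using that by simp
      show ?thesis using less.IH[OF e less_trans[OF e less.prems]] .
    qed
    ultimately have "finite ?T" by (intro finite_UnI finite_imageI finite_SigmaI) auto
    moreover have "?F a \<subseteq> ?T"
    proof
      fix \<zeta> assume "\<zeta> \<in> ?F a"
      then have z: "\<zeta> < a" "mc omega \<zeta> \<le> ord_of_nat m" by auto
      show "\<zeta> \<in> ?T"
      proof (cases "\<zeta> = 0")
        case False
        have "\<zeta> < eps0" using z(1) less.prems by (rule less_trans)
        then obtain e b g where nf: "is_nf omega \<zeta> e b g"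
          using ex_nf_omega[of \<zeta>] False by (auto simp: pos_iff)
        note bd = is_nf_bounds[OF nf]
        have m: "mc omega e \<le> ord_of_nat m" "b \<le> ord_of_nat m" "mc omega g \<le> ord_of_nat m"
          using z(2) unfolding mc_nf[OF nf] by auto
        have e1: "omega \<up> e < a" using bd(1) z(1) by (rule le_less_trans)
        have "omega \<up> e < omega \<up> (\<delta> + 1)" using e1 is_nf_bounds(2)[OF nfa] by (rule less_trans)
        then have "e \<le> \<delta>" by (simp add: less_add1_iff)
        then have "e \<in> ?E" using m e1 by auto
        moreover obtain n where "b = ord_of_nat n" using nf less_omega_iff[of b] by (auto simp: is_nf_def)
        then have "b \<in> ord_of_nat ` {..m}" using m by auto
        moreover have "g \<in> ?F (omega \<up> e)" "\<zeta> = omega \<up> e * b + g" using nf m by (auto simp: is_nf_def)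
        ultimately show ?thesis by (intro UnI2 image_eqI[of _ _ "(e,b,g)"]) auto
      qed simp
    qed
    ultimately show ?thesis by (rule finite_subset[rotated])
  qed simp
qed

primrec tower :: "nat \<Rightarrow> ordinal" where
  "tower 0 = 1"
| "tower (Suc h) = omega \<up> tower h"

lemma tower_pos: "0 < tower h"
  by (cases h) auto

lemma tower_Suc_limit: "is_limit (tower (Suc h))"
  using opow_omega_limit[of "tower h"] tower_pos[of h] by (auto simp: pos_iff)

lemma opow_less_eps0: "a < eps0 \<Longrightarrow> omega \<up> a < eps0"
  by (subst eps0_fixed[symmetric]) simp

lemma one_less_eps0: "1 < eps0"
  using opow_less_eps0[OF eps0_pos] by simp

lemma tower_less_eps0: "tower h < eps0"
  by (induction h) (auto simp: one_less_eps0 opow_less_eps0)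

lemma omega_less_eps0: "omega < eps0"
  using tower_less_eps0[of 1] by (simp add: less_imp_le)

lemma is_nf_tower: assumes "is_nf omega \<xi> \<alpha> \<beta> \<gamma>"
  shows "tower (Suc h) \<le> \<xi> \<longleftrightarrow> tower h \<le> \<alpha>"
proof
  assume "tower (Suc h) \<le> \<xi>"
  then have "omega \<up> tower h < omega \<up> (\<alpha> + 1)"
    using is_nf_bounds(2)[OF assms] unfolding tower.simps by (rule le_less_trans)
  then show "tower h \<le> \<alpha>" by (simp add: less_add1_iff)
next
  assume "tower h \<le> \<alpha>"
  then have "omega \<up> tower h \<le> omega \<up> \<alpha>" by (rule opow_mono)
  then show "tower (Suc h) \<le> \<xi>" using is_nf_bounds(1)[OF assms]
    unfolding tower.simps by (rule order_trans)
qed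

lemma fundseq_tower:
  "is_limit \<xi> \<Longrightarrow> \<xi> < eps0 \<Longrightarrow> 0 < n \<Longrightarrow> tower (Suc h) \<le> \<xi> \<Longrightarrow> tower h \<le> fundseq \<xi> n"
proof (induction \<xi> arbitrary: h rule: less_induct)
  case (less \<xi>)
  show ?case
  proof (cases h)
    case 0
    have "ord_of_nat n \<le> mc omega (fundseq \<xi> n)" using less.prems by (intro mc_fundseq)
    then have "fundseq \<xi> n \<noteq> 0" using less.prems(3) ord_of_nat_less[of 0 n] by (metis mc_0 not_le ord_of_nat.simps(1))
    then show ?thesis using 0 by (simp add: one_le_iff pos_iff)
  next
    case (Suc h')
    have le: "tower h \<le> \<xi>'" if "is_nf omega \<xi> \<alpha> b c" "is_nf omega \<xi>' \<alpha> b' c'" for \<xi>' \<alpha> b c b' c'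
    proof -
      have "tower h \<le> \<alpha>" using less.prems(4) is_nf_tower[OF that(1)] by simp
      then have "tower (Suc h) \<le> \<xi>'" using is_nf_tower[OF that(2)] by simp
      moreover have "tower h \<le> tower (Suc h)" using le_opow[OF one_less_omega] by simp
      ultimately show ?thesis by simp
    qed
    show ?thesis using less.prems(1,2)
    proof (cases rule: fundseq_cases)
      case (rest \<alpha> \<beta> \<gamma>)
      from le[OF rest(1) rest(4)] show ?thesis .
    next
      case (coeff \<alpha> \<beta>)
      from le[OF coeff(1) coeff(5)] show ?thesis .
    next
      case (limit \<alpha>)
      have "tower (Suc h') \<le> \<alpha>" using less.prems(4) is_nf_tower[OF limit(1), of h] Suc by simp
      then have "tower h' \<le> fundseq \<alpha> n"
        using less.IH[of \<alpha> h'] limit is_nf_bounds(5)[OF limit(1)] less.prems by simp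
      then show ?thesis using is_nf_tower[OF limit(5), of h' n] Suc by simp
    next
      case (succ \<delta>)
      have "tower (Suc h') \<le> \<delta> + 1" using less.prems(4) is_nf_tower[OF succ(1), of h] Suc by simp
      moreover have "tower (Suc h') \<noteq> \<delta> + 1" using tower_Suc_limit by (auto simp: is_limit_def)
      ultimately have "tower h \<le> \<delta>" using Suc by (metis le_less less_add1_iff)
      then have "tower (Suc h) \<le> fundseq \<xi> n" using is_nf_tower[OF succ(4)[OF less.prems(3)], of h] by simp
      moreover have "tower h \<le> tower (Suc h)" using le_opow[OF one_less_omega] by simp
      ultimately show ?thesis by simp
    qed
  qed
qed

lemma AA_pos: "0 < k \<Longrightarrow> \<xi> < eps0 \<Longrightarrow> 0 < AA k \<xi>"
  using mc_less_A[of k \<xi>] by simp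

lemma fundseq_less_eps0: "is_limit \<xi> \<Longrightarrow> \<xi> < eps0 \<Longrightarrow> fundseq \<xi> n < eps0"
  using fundseq_less[of \<xi> n] by (auto simp: is_limit_def pos_iff)

lemma le_AA_fundseq:
  assumes "0 < k" "is_limit \<alpha>" "\<alpha> < eps0"
  shows "x < AA k (fundseq \<alpha> x)"
  using mcn_fundseq[OF assms(2,3), of x] mc_less_A[OF assms(1) fundseq_less_eps0[OF assms(2,3), of x]]
  by simp

lemma AA_tower: assumes k: "2 \<le> k" shows "\<xi> < eps0 \<Longrightarrow> tower h \<le> \<xi> \<Longrightarrow> h \<le> AA k \<xi>"
proof (induction h arbitrary: \<xi>)
  case (Suc h)
  have w: "omega \<le> \<xi>"
  proof -
    have "1 \<le> tower h" using tower_pos by (simp add: one_le_iff)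
    then have "omega \<up> 1 \<le> tower (Suc h)" unfolding tower.simps by (rule opow_mono)
    then show ?thesis using Suc.prems by (simp add: less_imp_le)
  qed
  let ?\<alpha> = "limit_part \<xi>"
  note d = limit_decomp[OF w]
  have ae: "?\<alpha> < eps0" using d Suc.prems by simp
  have ta: "tower (Suc h) \<le> ?\<alpha>"
  proof (rule ccontr)
    assume "\<not> ?thesis"
    then have "?\<alpha> + ord_of_nat (finite_part \<xi>) < tower (Suc h)"
      by (intro limit_add_nat tower_Suc_limit) simp
    with d(2) Suc.prems show False by simp
  qed
  let ?f = "\<lambda>x. AA k (fundseq ?\<alpha> x)"
  let ?a = "if 0 < finite_part \<xi> then AA k (?\<alpha> + ord_of_nat (finite_part \<xi> - 1)) else mcn \<xi>"
  have f: "x < ?f x" for x using k d(1) ae by (intro le_AA_fundseq) auto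
  have "0 < ?a"
  proof (cases "0 < finite_part \<xi>")
    case True
    have "?\<alpha> + ord_of_nat (finite_part \<xi> - 1) \<le> \<xi>" by (subst (3) d(2)) simp
    then show ?thesis using True k AA_pos[of k "?\<alpha> + ord_of_nat (finite_part \<xi> - 1)"] Suc.prems by simp
  next
    case False
    have "0 < \<xi>" using zero_less_omega w by (rule less_le_trans)
    then obtain a b c where nf: "is_nf omega \<xi> a b c" using ex_nf_omega Suc.prems by blast
    then have "0 < mc omega \<xi>" unfolding mc_nf[OF nf] by (auto simp: is_nf_def less_max_iff_disj)
    then have "0 < mcn \<xi>" using ord_of_nat_less[of 0 "mcn \<xi>"] by simp
    then show ?thesis using False by simp
  qed
  obtain k' where k': "k = Suc (Suc k')" using k by (metis add_2_eq_Suc le_Suc_ex)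
  let ?y = "(?f ^^ k') ?a"
  have "?a + k' \<le> ?y" by (rule funpow_gt) (rule f)
  then have y: "0 < ?y" using \<open>0 < ?a\<close> by simp
  have "tower h \<le> fundseq ?\<alpha> ?y" using fundseq_tower[OF d(1) ae y ta] .
  then have "h \<le> ?f ?y" by (intro Suc.IH fundseq_less_eps0 d(1) ae)
  also have "?f ?y < ?f (?f ?y)" by (rule f)
  finally show ?case unfolding AA_infinite[OF Suc.prems(1) w] k' by simp
qed simp

lemma finite_AA_le: assumes k: "2 \<le> k" shows "finite {\<zeta>. \<zeta> < eps0 \<and> AA k \<zeta> \<le> m}"
proof (rule finite_subset)
  show "finite {\<zeta>. \<zeta> < tower (Suc m) \<and> mc omega \<zeta> \<le> ord_of_nat m}"
    by (rule finite_mc_bounded[OF tower_less_eps0])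
  show "{\<zeta>. \<zeta> < eps0 \<and> AA k \<zeta> \<le> m} \<subseteq> {\<zeta>. \<zeta> < tower (Suc m) \<and> mc omega \<zeta> \<le> ord_of_nat m}"
  proof safe
    fix \<zeta> assume z: "\<zeta> < eps0" "AA k \<zeta> \<le> m"
    show "\<zeta> < tower (Suc m)"
      by (rule ccontr) (use AA_tower[OF k z(1), of "Suc m"] z in \<open>simp add: not_less del: tower.simps\<close>)
    have "mcn \<zeta> \<le> m" using mc_less_A[of k \<zeta>] z k by simp
    then have "ord_of_nat (mcn \<zeta>) \<le> ord_of_nat m" by (subst ord_of_nat_le)
    then show "mc omega \<zeta> \<le> ord_of_nat m" by simp
  qed
qed

section \<open>\<open>k\<close>-normal forms\<close>

definition nf_candidates :: "nat \<Rightarrow> nat \<Rightarrow> ordinal \<Rightarrow> ordinal set" where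
  "nf_candidates k m \<xi> = {\<zeta>. \<zeta> < eps0 \<and> AA k \<zeta> \<le> m \<and> ord_of_nat (AA k \<xi>) \<le> mc omega \<zeta>}"

definition nf_next :: "nat \<Rightarrow> nat \<Rightarrow> ordinal \<Rightarrow> ordinal" where
  "nf_next k m \<xi> =
     (if \<exists>\<mu>\<in>nf_candidates k m \<xi>. \<forall>\<zeta>\<in>nf_candidates k m \<xi>. \<zeta> \<le> \<mu>
      then THE \<mu>. \<mu> \<in> nf_candidates k m \<xi> \<and> (\<forall>\<zeta>\<in>nf_candidates k m \<xi>. \<zeta> \<le> \<mu>)
      else 0)"

text \<open>\<open>is_k_nf k m \<xi>\<close>: the expression \<open>\<AA>\<^sub>k(\<xi>)\<close> is the \<open>k\<close>-normal form of \<open>m\<close>.\<close>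

definition is_k_nf :: "nat \<Rightarrow> nat \<Rightarrow> ordinal \<Rightarrow> bool" where
  "is_k_nf k m \<xi> \<longleftrightarrow> 0 < m \<and> \<xi> < eps0 \<and> m = AA k \<xi> \<and>
     (\<exists>(x :: nat \<Rightarrow> ordinal) n. (\<forall>i\<le>n. x i < eps0) \<and> x 0 = 0 \<and> x n = \<xi> \<and>
        (\<forall>i<n. x (Suc i) = nf_next k m (x i)))"

lemma nf_next_Max:
  assumes "2 \<le> k" "nf_candidates k m \<xi> \<noteq> {}"
  shows "nf_next k m \<xi> \<in> nf_candidates k m \<xi>"
proof -
  let ?C = "nf_candidates k m \<xi>"
  have fin: "finite ?C" by (rule finite_subset[OF _ finite_AA_le[OF assms(1), of m]]) (auto simp: nf_candidates_def)
  have M: "Max ?C \<in> ?C \<and> (\<forall>\<zeta>\<in>?C. \<zeta> \<le> Max ?C)" using fin assms(2) by auto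
  then have ex: "\<exists>\<mu>\<in>?C. \<forall>\<zeta>\<in>?C. \<zeta> \<le> \<mu>" by blast
  have "(THE \<mu>. \<mu> \<in> ?C \<and> (\<forall>\<zeta>\<in>?C. \<zeta> \<le> \<mu>)) = Max ?C"
    using M by (intro the_equality) (auto intro: antisym)
  then show ?thesis using M ex unfolding nf_next_def by simp
qed

lemma nf_next_empty: "nf_candidates k m \<xi> = {} \<Longrightarrow> nf_next k m \<xi> = 0"
  by (simp add: nf_next_def)

lemma nf_candidates_empty: assumes "0 < k" "AA k \<xi> = m" shows "nf_candidates k m \<xi> = {}"
proof -
  have False if "\<zeta> \<in> nf_candidates k m \<xi>" for \<zeta>
  proof -
    have z: "\<zeta> < eps0" "AA k \<zeta> \<le> m" "ord_of_nat m \<le> ord_of_nat (mcn \<zeta>)"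
      using that assms by (auto simp: nf_candidates_def)
    then have "m \<le> mcn \<zeta>" by (subst (asm) ord_of_nat_le)
    then show False using mc_less_A[OF assms(1) z(1)] z(2) by simp
  qed
  then show ?thesis by blast
qed

theorem ex1_k_nf: assumes k: "2 \<le> k" and m: "0 < m" shows "\<exists>!\<xi>. is_k_nf k m \<xi>"
proof -
  define s where "s i = (nf_next k m ^^ i) 0" for i
  have s0: "s 0 = 0" and sS: "s (Suc i) = nf_next k m (s i)" for i by (simp_all add: s_def)
  have A0: "AA k 0 = 1"
    using AA_finite[OF eps0_pos zero_less_omega, of k] nat_of_ord_of_nat[of 0] by simp
  have bnd: "s i < eps0 \<and> AA k (s i) \<le> m" for i
  proof (induction i)
    case 0 then show ?case using m by (simp add: s0 eps0_pos A0)
  next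
    case (Suc i)
    show ?case
    proof (cases "nf_candidates k m (s i) = {}")
      case True then show ?thesis using m by (simp add: sS nf_next_empty eps0_pos A0)
    next
      case False
      then show ?thesis using nf_next_Max[OF k False] by (auto simp: sS nf_candidates_def)
    qed
  qed
  have step: "AA k (s i) < AA k (s (Suc i))" if "AA k (s i) \<noteq> m" for i
  proof -
    have l: "AA k (s i) \<le> m - 1" using that bnd[of i] m by linarith
    let ?z = "ord_of_nat (m - 1)"
    have z: "?z < eps0" using less_trans[OF ord_of_nat_less_omega omega_less_eps0] .
    have "AA k ?z = m" "mc omega ?z = ?z" using AA_finite[OF z, of k] m by (simp_all add: mc_finite)
    then have "?z \<in> nf_candidates k m (s i)" using z l by (simp add: nf_candidates_def)
    then have "s (Suc i) \<in> nf_candidates k m (s i)" using nf_next_Max[OF k] sS by auto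
    then have c: "s (Suc i) < eps0" "ord_of_nat (AA k (s i)) \<le> ord_of_nat (mcn (s (Suc i)))"
      by (auto simp: nf_candidates_def)
    then have "AA k (s i) \<le> mcn (s (Suc i))" by (subst (asm) ord_of_nat_le)
    also have "\<dots> < AA k (s (Suc i))" using k c by (intro mc_less_A) auto
    finally show ?thesis .
  qed
  have "\<exists>n. AA k (s n) = m"
  proof (rule ccontr)
    assume "\<not> ?thesis"
    then have "i \<le> AA k (s i)" for i
      by (induction i) (use step in \<open>auto simp: Suc_le_eq intro: le_less_trans\<close>)
    from this[of "Suc m"] bnd[of "Suc m"] show False by simp
  qed
  define n where "n = (LEAST n. AA k (s n) = m)"
  have n: "AA k (s n) = m" unfolding n_def by (rule LeastI_ex) fact
  have per: "s (i + Suc n) = s i" for i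
  proof (induction i)
    case 0
    show ?case using nf_next_empty[OF nf_candidates_empty[OF _ n]] k by (simp add: sS s0)
  qed (simp add: sS)
  have uniq: "s i = s n" if "AA k (s i) = m" for i using that
  proof (induction i rule: less_induct)
    case (less i)
    show ?case
    proof (cases "i \<le> n")
      case True
      have "n \<le> i" unfolding n_def using less.prems by (rule Least_le)
      with True show ?thesis by simp
    next
      case False
      then have "s i = s (i - Suc n)" using per[of "i - Suc n"] by simp
      then show ?thesis using less.IH[of "i - Suc n"] less.prems False by simp
    qed
  qed
  have "is_k_nf k m (s n)"
    unfolding is_k_nf_def using m bnd n s0 sS by (intro conjI exI[of _ s] exI[of _ n]) auto
  moreover have "\<xi> = s n" if "is_k_nf k m \<xi>" for \<xi>
  proof -
    from that obtain x n' where x: "m = AA k \<xi>" "x 0 = 0" "x n' = \<xi>" 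
      "\<forall>i<n'. x (Suc i) = nf_next k m (x i)" unfolding is_k_nf_def by blast
    have "i \<le> n' \<Longrightarrow> x i = s i" for i
      by (induction i) (use x in \<open>auto simp: s0 sS\<close>)
    then have "\<xi> = s n'" using x by auto
    then show ?thesis using uniq[of n'] x by simp
  qed
  ultimately show ?thesis by blast
qed

definition k_nf :: "nat \<Rightarrow> nat \<Rightarrow> ordinal" where
  "k_nf k m = (THE \<xi>. is_k_nf k m \<xi>)"

lemma k_nf: "2 \<le> k \<Longrightarrow> 0 < m \<Longrightarrow> is_k_nf k m (k_nf k m)"
  unfolding k_nf_def by (rule theI') (rule ex1_k_nf)

section \<open>Base change\<close>

text \<open>
  \<open>bc_nat k l m\<close> and \<open>bc_ord k l \<xi>\<close> are the base changes from \<open>k\<close> to \<open>l\<close> (where \<open>2 \<le> k < l \<le> \<omega>\<close>) of a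
  natural number \<open>m\<close> and an ordinal \<open>\<xi> < \<epsilon>\<^sub>0\<close>, respectively. The values for \<open>k < 2\<close> or \<open>\<xi> \<ge> \<epsilon>\<^sub>0\<close> are
  irrelevant.
\<close>

definition bc_base :: "ordinal \<Rightarrow> ordinal" where
  "bc_base l = (if l < omega then omega else Omega)"

function bc_nat :: "nat \<Rightarrow> ordinal \<Rightarrow> nat \<Rightarrow> ordinal"
  and bc_ord :: "nat \<Rightarrow> ordinal \<Rightarrow> ordinal \<Rightarrow> ordinal" where
  "bc_nat k l m = (if m = 0 \<or> k < 2 then 0 else AA_at l (bc_ord k l (k_nf k m)))"
| "bc_ord k l \<xi> =
     (if \<xi> = 0 \<or> eps0 \<le> \<xi> then 0
      else bc_base l \<up> bc_ord k l (nf_exp omega \<xi>) * bc_nat k l (nat_of_ord (nf_coeff omega \<xi>))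
             + bc_ord k l (nf_rest omega \<xi>))"
  by pat_completeness auto
termination
proof -
  let ?R = "{(x,y). x < y} <*lex*> less_than <*lex*> {(x,y). x < (y::ordinal)}"
  let ?f = "\<lambda>s. case s of Inl (k, l, m) \<Rightarrow> (ord_of_nat m, 0, 0) | Inr (k, l, \<xi>) \<Rightarrow> (mc omega \<xi>, 1, \<xi>)"
  have nf: "is_nf omega \<xi> (nf_exp omega \<xi>) (nf_coeff omega \<xi>) (nf_rest omega \<xi>)"
    if "\<not> (\<xi> = 0 \<or> eps0 \<le> \<xi>)" for \<xi>
    using that by (intro ex_nf_is_nf ex_nf_omega) (auto simp: pos_iff)
  show ?thesis
  proof (relation "inv_image ?R ?f", goal_cases)
    case 1 show ?case by (auto intro!: wf_lex_prod simp: wf_ord)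
  next
    case (2 k l m)
    then have "m = AA k (k_nf k m)" "k_nf k m < eps0" using k_nf[of k m] by (auto simp: is_k_nf_def)
    then have "mcn (k_nf k m) < m" using mc_less_A[of k "k_nf k m"] 2 by simp
    then have "ord_of_nat (mcn (k_nf k m)) < ord_of_nat m" by (subst ord_of_nat_less)
    then show ?case by simp
  next
    case (3 k l \<xi>)
    from mc_nf[OF nf[OF 3]] is_nf_bounds[OF nf[OF 3]]
    show ?case by (auto simp: order.order_iff_strict[symmetric] less_max_iff_disj max_def split: if_splits)
  next
    case (4 k l \<xi>)
    from mc_nf[OF nf[OF 4]] nf[OF 4]
    show ?case by (auto simp: is_nf_def max_def split: if_splits)
  next
    case (5 k l \<xi>)
    from mc_nf[OF nf[OF 5]] is_nf_bounds[OF nf[OF 5]]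
    show ?case by (auto simp: max_def split: if_splits)
  qed
qed

declare bc_nat.simps [simp del] bc_ord.simps [simp del]

end

theory Submission
  imports Defs
begin

text \<open>
  Write \<open>up\<close> for the base change. The greedy sequence \<open>\<xi>\<^sub>0, \<dots>, \<xi>\<^sub>n = \<xi>\<close> of a normal form \<open>m = \<AA>\<^sub>k(\<xi>)\<close> satisfies
  \<open>\<AA>\<^sub>k(\<xi>\<^sub>i) \<le> mc(\<xi>\<^bsub>i+1\<^esub>)\<close>. By induction on \<open>m\<close>, every \<open>\<zeta> \<noteq> \<xi>\<close> with \<open>\<AA>\<^sub>k(\<zeta>) \<le> m\<close> has
  \<open>\<AA>\<^sub>\<lambda>(up \<zeta>) < \<AA>\<^sub>\<lambda>(up \<xi>)\<close>: choosing \<open>i\<close> with \<open>\<AA>\<^sub>k(\<xi>\<^sub>i) \<le> mc(\<zeta>) < \<AA>\<^sub>k(\<xi>\<^bsub>i+1\<^esub>)\<close>, maximality of \<open>\<xi>\<^bsub>i+1\<^esub>\<close>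
  gives \<open>\<zeta> \<le> \<xi>\<^bsub>i+1\<^esub>\<close>, and it remains to see that \<open>\<nu> < \<eta> := \<xi>\<^bsub>i+1\<^esub>\<close> and \<open>mc(\<nu>) < \<AA>\<^sub>k(\<eta>)\<close> imply
  \<open>\<AA>\<^sub>\<lambda>(up \<nu>) < \<AA>\<^sub>\<lambda>(up \<eta>)\<close>. The property of \<open>\<eta>\<close> used for this is that the normal forms of all numbers strictly between
  \<open>mc(\<eta>)\<close> and \<open>\<AA>\<^sub>k(\<eta>)\<close> lie below \<open>\<eta>\<close>. For \<open>\<lambda> = \<omega>\<close> the implication then follows from the closure property
  defining \<open>\<AA>\<^sub>\<omega>\<close>, by induction on \<open>mc(\<nu>)\<close>. For finite \<open>\<lambda>\<close> it suffices to bound the base change of \<open>mc(\<nu>)\<close> by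
  \<open>\<AA>\<^sub>\<lambda>\<^sup>(\<^sup>k\<^sup>)(up \<eta>)\<close>, because \<open>k \<le> \<lambda> - 1\<close>; this compares the \<open>k\<close> iterations computing \<open>\<AA>\<^sub>k(\<eta>)\<close> with the first \<open>k\<close> of the
  \<open>\<lambda>\<close> iterations computing \<open>\<AA>\<^sub>\<lambda>(up \<eta>)\<close>, by induction on \<open>\<eta>\<close>, since the terms of the fundamental sequence that
  occur inherit the property of \<open>\<eta>\<close>.
\<close>

section \<open>Monotonicity of \<open>\<AA>\<^sub>k\<close>\<close>

lemma is_limit_add: assumes "is_limit y" shows "is_limit (x + y)"
  unfolding is_limit_def
proof
  have y: "0 < y" using assms by (simp add: is_limit_def pos_iff)
  then have x: "x < x + y" using add_less[of x 0 y] by simp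
  then show "x + y \<noteq> 0" by auto
  show "\<nexists>d. x + y = d + 1"
  proof
    assume "\<exists>d. x + y = d + 1"
    then obtain d where d: "x + y = d + 1" by blast
    then have "x \<le> d" using x by (simp add: less_add1_iff)
    then obtain e where "d = x + e" using le_imp_diff by blast
    then have "x + y = x + (e + 1)" using d by (simp add: add_assoc_ord)
    then have "y = e + 1" by (simp only: add_eq)
    then show False using assms by (auto simp: is_limit_def)
  qed
qed

lemma is_limit_opow_mult: "a \<noteq> 0 \<Longrightarrow> 0 < b \<Longrightarrow> b < omega \<Longrightarrow> is_limit (omega \<up> a * b)"
  by (subst nf_omega_coeff_pred, assumption+) (simp add: mult_add1 is_limit_add opow_omega_limit)

lemma limit_ge_omega: "is_limit a \<Longrightarrow> omega \<le> a"
  using nf_omega_coeff_pred[of a] by (auto simp: is_limit_def pos_iff not_less[symmetric])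

lemma not_limit_nat: "a < omega \<Longrightarrow> \<not> is_limit a"
  using limit_ge_omega[of a] by auto

lemma is_limit_nf:
  assumes "is_nf omega \<xi> \<alpha> \<beta> \<gamma>"
  shows "is_limit \<xi> \<longleftrightarrow> \<alpha> \<noteq> 0 \<and> (\<gamma> = 0 \<or> is_limit \<gamma>)"
proof -
  have e: "\<xi> = omega \<up> \<alpha> * \<beta> + \<gamma>" "0 < \<beta>" "\<beta> < omega" "\<gamma> < omega \<up> \<alpha>"
    using assms by (auto simp: is_nf_def)
  show ?thesis
  proof (intro iffI conjI)
    assume l: "is_limit \<xi>"
    show "\<alpha> \<noteq> 0"
    proof
      assume "\<alpha> = 0"
      then have "\<xi> = \<beta>" using e by simp
      then show False using e l not_limit_nat by simp
    qed
    show "\<gamma> = 0 \<or> is_limit \<gamma>"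
    proof (rule ccontr)
      assume "\<not> ?thesis"
      then obtain d where "\<gamma> = d + 1" by (auto simp: is_limit_def)
      then have "\<xi> = (omega \<up> \<alpha> * \<beta> + d) + 1" using e by (simp add: add_assoc_ord)
      then show False using l by (auto simp: is_limit_def)
    qed
  next
    assume "\<alpha> \<noteq> 0 \<and> (\<gamma> = 0 \<or> is_limit \<gamma>)"
    then show "is_limit \<xi>" using e is_limit_opow_mult is_limit_add by auto
  qed
qed

lemma nf_less_iff:
  assumes nf: "is_nf \<kappa> \<xi> \<alpha> \<beta> \<gamma>" and nf': "is_nf \<kappa> \<xi>' \<alpha>' \<beta>' \<gamma>'"
  shows "\<xi> < \<xi>' \<longleftrightarrow> \<alpha> < \<alpha>' \<or> \<alpha> = \<alpha>' \<and> (\<beta> < \<beta>' \<or> \<beta> = \<beta>' \<and> \<gamma> < \<gamma>')"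
proof -
  let ?L = "\<lambda>\<alpha> \<beta> \<gamma> \<alpha>' \<beta>' \<gamma>'. \<alpha> < \<alpha>' \<or> \<alpha> = \<alpha>' \<and> (\<beta> < \<beta>' \<or> \<beta> = \<beta>' \<and> \<gamma> < \<gamma>')"
  \<comment> \<open>Only this direction is computed. The converse follows by trichotomy of the
    lexicographic order, using this fact with the two forms exchanged; hence the fresh
    variables.\<close>
  have *: "\<xi> < \<xi>'" if L: "?L \<alpha> \<beta> \<gamma> \<alpha>' \<beta>' \<gamma>'" and nf: "is_nf \<kappa> \<xi> \<alpha> \<beta> \<gamma>" and nf': "is_nf \<kappa> \<xi>' \<alpha>' \<beta>' \<gamma>'"
    for \<xi> \<alpha> \<beta> \<gamma> \<xi>' \<alpha>' \<beta>' \<gamma>' :: ordinal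
  proof -
    have e: "\<xi> = \<kappa> \<up> \<alpha> * \<beta> + \<gamma>" "\<gamma> < \<kappa> \<up> \<alpha>" and e': "\<xi>' = \<kappa> \<up> \<alpha>' * \<beta>' + \<gamma>'"
      using nf nf' by (auto simp: is_nf_def)
    consider "\<alpha> < \<alpha>'" | "\<alpha> = \<alpha>'" "\<beta> < \<beta>'" | "\<alpha> = \<alpha>'" "\<beta> = \<beta>'" "\<gamma> < \<gamma>'" using L by blast
    then show ?thesis
    proof cases
      case 1
      then have "\<kappa> \<up> (\<alpha> + 1) \<le> \<kappa> \<up> \<alpha>'" by (intro opow_mono) (simp add: add1_le_iff)
      then show ?thesis using is_nf_bounds[OF nf] is_nf_bounds[OF nf'] by (meson less_le_trans)
    next
      case 2
      have "\<xi> < \<kappa> \<up> \<alpha> * \<beta>'" unfolding e(1) using 2 e(2) by (intro mult_add_less)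
      also have "\<dots> \<le> \<xi>'" using 2 e' by simp
      finally show ?thesis .
    next
      case 3 then show ?thesis using e e' by simp
    qed
  qed
  show ?thesis
  proof
    show "\<xi> < \<xi>'" if "?L \<alpha> \<beta> \<gamma> \<alpha>' \<beta>' \<gamma>'" using *[OF that nf nf'] .
    assume lt: "\<xi> < \<xi>'"
    show "?L \<alpha> \<beta> \<gamma> \<alpha>' \<beta>' \<gamma>'"
    proof (rule ccontr)
      assume "\<not> ?thesis"
      then consider "?L \<alpha>' \<beta>' \<gamma>' \<alpha> \<beta> \<gamma>" | "\<alpha> = \<alpha>'" "\<beta> = \<beta>'" "\<gamma> = \<gamma>'" by fastforce
      then show False
      proof cases
        case 1 from *[OF 1 nf' nf] lt show False by simp
      next
        case 2 then show False using lt nf nf' by (simp add: is_nf_def)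
      qed
    qed
  qed
qed

lemma ex_nf_omega': "\<xi> < eps0 \<Longrightarrow> \<xi> \<noteq> 0 \<Longrightarrow> \<exists>\<alpha> \<beta> \<gamma>. is_nf omega \<xi> \<alpha> \<beta> \<gamma>"
  by (rule ex_nf_omega) (simp_all add: pos_iff)

lemma is_nf_omega_opow: "\<alpha> < eps0 \<Longrightarrow> is_nf omega (omega \<up> \<alpha>) \<alpha> 1 0"
  using less_opow_below_eps0 by (simp add: is_nf_def)

lemma mc_omega_opow: "\<alpha> < eps0 \<Longrightarrow> mc omega (omega \<up> \<alpha>) = max (mc omega \<alpha>) 1"
  using mc_nf[OF is_nf_omega_opow, of \<alpha>] by (simp add: max_absorb1)

lemma is_limit_eps0: "is_limit eps0"
  using opow_omega_limit[of eps0] eps0_pos by (simp add: eps0_fixed pos_iff)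

lemma add_nat_less_eps0 [simp]: "\<alpha> + ord_of_nat b < eps0 \<longleftrightarrow> \<alpha> < eps0"
  using limit_add_nat[OF is_limit_eps0, of \<alpha> b] le_add1o[of \<alpha> "ord_of_nat b"] le_less_trans by blast

lemma ord_of_nat_less_eps0 [simp]: "ord_of_nat n < eps0"
  using add_nat_less_eps0[of 0 n] eps0_pos by simp

section \<open>Maximal coefficients and domination along fundamental sequences\<close>

lemma is_nf_add_nat:
  assumes nf: "is_nf omega \<xi> \<alpha> \<beta> \<gamma>" and l: "\<alpha> \<noteq> 0"
  shows "is_nf omega (\<xi> + ord_of_nat b) \<alpha> \<beta> (\<gamma> + ord_of_nat b)"
proof -
  have e: "\<xi> = omega \<up> \<alpha> * \<beta> + \<gamma>" "0 < \<beta>" "\<beta> < omega" "\<gamma> < omega \<up> \<alpha>" "\<alpha> < \<xi>"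
    using nf by (auto simp: is_nf_def)
  have "\<alpha> < \<xi> + ord_of_nat b" using e(5) le_add1o by (rule less_le_trans)
  then show ?thesis
    using e limit_add_nat[OF opow_omega_limit[OF l] e(4)] by (simp add: is_nf_def add_assoc_ord)
qed

text \<open>The leading exponents along a limit are nonzero, so a finite summand only extends the
  innermost remainder, where it is the coefficient of exponent 0.\<close>

lemma mc_limit_add:
  "is_limit \<alpha> \<Longrightarrow> \<alpha> < eps0 \<Longrightarrow> mc omega (\<alpha> + ord_of_nat b) = max (mc omega \<alpha>) (ord_of_nat b)"
proof (induction \<alpha> rule: less_induct)
  case (less \<alpha>)
  then obtain a \<beta> \<gamma> where nf: "is_nf omega \<alpha> a \<beta> \<gamma>" using ex_nf_omega'[OF less.prems(2)] by (auto simp: is_limit_def)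
  then have a: "a \<noteq> 0" "\<gamma> = 0 \<or> is_limit \<gamma>" using less.prems is_limit_nf by auto
  have "mc omega (\<gamma> + ord_of_nat b) = max (mc omega \<gamma>) (ord_of_nat b)"
    using a(2) less.IH[of \<gamma>] is_nf_bounds(4)[OF nf] less.prems(2) by (auto simp: mc_finite max_def)
  then show ?case unfolding mc_nf[OF nf] mc_nf[OF is_nf_add_nat[OF nf a(1), of b]]
    by (simp add: max.assoc max.commute max.left_commute)
qed

lemma limit_or_nat: "\<xi> < omega \<or> (\<exists>\<alpha> b. is_limit \<alpha> \<and> \<xi> = \<alpha> + ord_of_nat b)"
  using limit_decomp_ex[of \<xi>] by force

text \<open>Needed for the clause \<omega>^(\<delta>+1)[n] = \<omega>^\<delta> n, which replaces an
  exponent by its predecessor.\<close>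

lemma mc_le_add1: "\<xi> < eps0 \<Longrightarrow> mc omega \<xi> \<le> mc omega (\<xi> + 1)"
  using limit_or_nat[of \<xi>]
proof
  assume "\<xi> < omega"
  then obtain n where "\<xi> = ord_of_nat n" using less_omega_iff by auto
  then show ?thesis using mc_finite[of "ord_of_nat n"] mc_finite[of "ord_of_nat (Suc n)"] ord_of_nat_less_omega[of "Suc n"]
    by simp
next
  assume "\<xi> < eps0" "\<exists>\<alpha> b. is_limit \<alpha> \<and> \<xi> = \<alpha> + ord_of_nat b"
  then obtain \<alpha> b where a: "is_limit \<alpha>" "\<xi> = \<alpha> + ord_of_nat b" "\<alpha> < eps0" by auto
  show ?thesis using mc_limit_add[OF a(1,3), of b] mc_limit_add[OF a(1,3), of "Suc b"] a(2)
    by (simp add: add_assoc_ord[symmetric] max.coboundedI1 max.coboundedI2)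
qed

text \<open>Each clause keeps parts of the normal form, lowers a coefficient or an exponent, and
  inserts no large coefficient except n. With \<open>mcn_fundseq\<close> this gives the exact value
  in \<open>mcn_fundseq_eq\<close>.\<close>

lemma mc_fundseq_le:
  "is_limit \<xi> \<Longrightarrow> \<xi> < eps0 \<Longrightarrow> mc omega (fundseq \<xi> n) \<le> max (mc omega \<xi>) (ord_of_nat n)"
proof (induction \<xi> rule: less_induct)
  case (less \<xi>)
  show ?case using less.prems
  proof (cases rule: fundseq_cases)
    case (rest \<alpha> \<beta> \<gamma>)
    then have "mc omega (fundseq \<gamma> n) \<le> max (mc omega \<gamma>) (ord_of_nat n)"
      using less.IH[of \<gamma>] less.prems is_nf_bounds(4)[OF rest(1)] by simp
    then show ?thesis unfolding mc_nf[OF rest(4)[of n]] mc_nf[OF rest(1)]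
      by (auto simp: le_max_iff_disj)
  next
    case (coeff \<alpha> \<beta>)
    have "mc omega (fundseq (omega \<up> \<alpha>) n) \<le> max (mc omega (omega \<up> \<alpha>)) (ord_of_nat n)"
      using coeff less.IH[of "omega \<up> \<alpha>"] less.prems by simp
    moreover have "\<alpha> < eps0" using is_nf_bounds(5)[OF coeff(1)] less.prems(2) by simp
    ultimately have IH: "mc omega (fundseq (omega \<up> \<alpha>) n) \<le> max (max (mc omega \<alpha>) 1) (ord_of_nat n)"
      by (simp add: mc_omega_opow)
    let ?R = "max (mc omega \<xi>) (ord_of_nat n)"
    have R: "mc omega \<alpha> \<le> ?R" "\<beta> + 1 \<le> ?R" "ord_of_nat n \<le> ?R"
      unfolding mc_nf[OF coeff(1)] by (auto simp: le_max_iff_disj)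
    \<comment> \<open>Splitting off the last copy of \<omega>^\<alpha> brings in the coefficient 1,
      which the old coefficient \<open>\<beta> + 1\<close> absorbs.\<close>
    have "1 \<le> \<beta> + 1" "\<beta> \<le> \<beta> + 1" by (simp_all add: one_le_iff less_add1_iff)
    then have "1 \<le> ?R" "\<beta> \<le> ?R" using R(2) order_trans by blast+
    then show ?thesis using R order_trans[OF IH, of ?R] unfolding mc_nf[OF coeff(5)[of n]] by simp
  next
    case (limit \<alpha>)
    then have "mc omega (fundseq \<alpha> n) \<le> max (mc omega \<alpha>) (ord_of_nat n)"
      using less.IH[of \<alpha>] less.prems is_nf_bounds(5)[OF limit(1)] by simp
    then show ?thesis unfolding mc_nf[OF limit(5)[of n]] mc_nf[OF limit(1)]
      by (auto simp: le_max_iff_disj)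
  next
    case (succ \<delta>)
    show ?thesis
    proof (cases "n = 0")
      case True then show ?thesis using succ(3) by simp
    next
      case False
      have "\<delta> + 1 < eps0" using is_nf_bounds(5)[OF succ(1)] less.prems(2) by simp
      then have "\<delta> < eps0" using less_add1 less_trans by blast
      then have "mc omega \<delta> \<le> mc omega (\<delta> + 1)" by (rule mc_le_add1)
      then show ?thesis using False unfolding mc_nf[OF succ(1)] by (subst mc_nf[OF succ(4)[of n]]) (auto simp: le_max_iff_disj)
    qed
  qed
qed

text \<open>The domination property behind all comparisons of values of A_k. In the decisive clause
  \<omega>^(\<delta>+1)[n] = \<omega>^\<delta> n, the leading exponent of \<zeta> is at most
  \<delta> and its leading coefficient is below n.\<close>

lemma less_fundseq:
  "is_limit \<xi> \<Longrightarrow> \<xi> < eps0 \<Longrightarrow> \<zeta> < \<xi> \<Longrightarrow> mc omega \<zeta> < ord_of_nat n \<Longrightarrow> \<zeta> < fundseq \<xi> n"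
proof (induction \<xi> arbitrary: \<zeta> rule: less_induct)
  case (less \<xi>)
  \<comment> \<open>For n = 0 the successor clause would yield 0, which has no normal form.\<close>
  have n: "0 < n"
  proof -
    have "0 < ord_of_nat n" using zero_le_ord less.prems(4) by (rule le_less_trans)
    then show ?thesis using ord_of_nat_less[of 0 n] by simp
  qed
  show ?case
  proof (cases "\<zeta> = 0")
    case True
    have "ord_of_nat n \<le> mc omega (fundseq \<xi> n)" using less.prems by (intro mc_fundseq)
    then have "fundseq \<xi> n \<noteq> 0" using n ord_of_nat_less[of 0 n] by (metis mc_0 not_le ord_of_nat.simps(1))
    then show ?thesis using True by (simp add: pos_iff)
  next
    case False
    then obtain a b c where nf: "is_nf omega \<zeta> a b c" using ex_nf_omega'[of \<zeta>] less_trans[OF less.prems(3,2)] by auto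
    have m: "mc omega a < ord_of_nat n" "mc omega c < ord_of_nat n" "b < ord_of_nat n"
      using less.prems(4) unfolding mc_nf[OF nf] by auto
    have b0: "0 < b" using nf by (simp add: is_nf_def)
    note lt = nf_less_iff[OF nf, THEN iffD1, OF _ less.prems(3)]
    show ?thesis using less.prems(1,2)
    proof (cases rule: fundseq_cases)
      case (rest \<alpha> \<beta> \<gamma>)
      then have "c < \<gamma> \<Longrightarrow> c < fundseq \<gamma> n"
        using less.IH[of \<gamma> c] less.prems is_nf_bounds(4)[OF rest(1)] m by simp
      then show ?thesis unfolding nf_less_iff[OF nf rest(4)] using lt[OF rest(1)] by auto
    next
      case (coeff \<alpha> \<beta>)
      have "a = \<alpha> \<Longrightarrow> c < fundseq (omega \<up> \<alpha>) n"
        using coeff less.IH[of "omega \<up> \<alpha>" c] less.prems m nf by (simp add: is_nf_def)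
      then show ?thesis unfolding nf_less_iff[OF nf coeff(5)] using lt[OF coeff(1)] 
        by (auto simp: less_add1_iff)
    next
      case (limit \<alpha>)
      have "a < \<alpha>" using lt[OF limit(1)] b0 by auto
      then have "a < fundseq \<alpha> n"
        using limit less.IH[of \<alpha> a] less.prems is_nf_bounds(5)[OF limit(1)] m by simp
      then show ?thesis unfolding nf_less_iff[OF nf limit(5)] by simp
    next
      case (succ \<delta>)
      have "a \<le> \<delta>" using lt[OF succ(1)] b0 by (auto simp: less_add1_iff)
      then show ?thesis unfolding nf_less_iff[OF nf succ(4)[OF n]] using m by auto
    qed
  qed
qed

section \<open>Coefficients as natural numbers; iteration of inflationary functions\<close>

lemma mcn_le_iff: "mcn \<zeta> \<le> n \<longleftrightarrow> mc omega \<zeta> \<le> ord_of_nat n"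
  using ord_of_nat_le[of "mcn \<zeta>" n] by simp

lemma mcn_less_iff: "mcn \<zeta> < n \<longleftrightarrow> mc omega \<zeta> < ord_of_nat n"
  using ord_of_nat_less[of "mcn \<zeta>" n] by simp

lemma mcn_limit_add: "is_limit \<alpha> \<Longrightarrow> \<alpha> < eps0 \<Longrightarrow> mcn (\<alpha> + ord_of_nat b) = max (mcn \<alpha>) b"
proof -
  assume "is_limit \<alpha>" "\<alpha> < eps0"
  then have "ord_of_nat (mcn (\<alpha> + ord_of_nat b)) = ord_of_nat (max (mcn \<alpha>) b)"
    using mc_limit_add[of \<alpha> b] mcn_le_iff[of \<alpha> b] by (simp add: max_def)
  then show ?thesis by (rule ord_of_nat_eq[THEN iffD1])
qed

lemma mcn_fundseq_eq: "is_limit \<xi> \<Longrightarrow> \<xi> < eps0 \<Longrightarrow> mcn \<xi> \<le> n \<Longrightarrow> mcn (fundseq \<xi> n) = n"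
  using mc_fundseq_le[of \<xi> n] mcn_fundseq[of \<xi> n] by (auto simp: mcn_le_iff intro: antisym)

text \<open>Being inflationary, \<open>f\<close> never leaves the region above \<open>a\<close> on
  which it is monotone. Meant for \<open>AA_step\<close>, shown monotone only from mc(\<alpha>)
  on.\<close>

lemma funpow_mono_on:
  assumes f: "\<And>x y. a \<le> x \<Longrightarrow> x \<le> y \<Longrightarrow> f x \<le> f y" and i: "\<And>x. x < f x" and "a \<le> x" "x \<le> (y::nat)"
  shows "(f ^^ n) x \<le> (f ^^ n) y"
proof (induction n)
  case (Suc n)
  have "a \<le> (f ^^ n) x" using funpow_gt[of f x n] i assms(3) by simp
  then show ?case using f Suc by simp
qed (use assms in simp)

lemma funpow_strict: assumes i: "\<And>x. x < f x" and "m < n" shows "(f ^^ m) x < (f ^^ n) (x::nat)"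
proof -
  obtain d where d: "n = d + m" "0 < d" using assms(2) less_imp_add_positive by (metis add.commute)
  show ?thesis using funpow_gt[of f "(f ^^ m) x" d] i d by (simp add: funpow_add)
qed

lemma funpow_le: assumes i: "\<And>x. x < f x" and "m \<le> n" shows "(f ^^ m) x \<le> (f ^^ n) (x::nat)"
  using funpow_strict[of f m n x] assms by (cases "m = n") auto

section \<open>The iteration that computes A_k\<close>

definition AA_step :: "nat \<Rightarrow> ordinal \<Rightarrow> nat \<Rightarrow> nat" where
  "AA_step k \<alpha> x = AA k (fundseq \<alpha> x)"

text \<open>The iteration for \<alpha> + b starts at the value for its predecessor and has the same
  step function. So the values at \<alpha>, \<alpha> + 1, ... all lie on one chain of iterates
  starting at mc(\<alpha>).\<close>

lemma AA_limit_add: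
  assumes "is_limit \<alpha>" "\<alpha> < eps0"
  shows "AA k (\<alpha> + ord_of_nat b) = (AA_step k \<alpha> ^^ (k * Suc b)) (mcn \<alpha>)"
proof (induction b)
  case 0
  show ?case using AA_infinite[of \<alpha> k] assms limit_ge_omega[OF assms(1)] limit_decomp_eq[OF assms(1), of 0]
    by (simp add: AA_step_def[abs_def])
next
  case (Suc b)
  have "omega \<le> \<alpha> + ord_of_nat (Suc b)" using limit_ge_omega[OF assms(1)] le_add1o by (rule order_trans)
  then have "AA k (\<alpha> + ord_of_nat (Suc b)) = (AA_step k \<alpha> ^^ k) (AA k (\<alpha> + ord_of_nat b))"
    using AA_infinite[of "\<alpha> + ord_of_nat (Suc b)" k] assms limit_decomp_eq[OF assms(1), of "Suc b"] 
      add_nat_less_eps0[of \<alpha> "Suc b"]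
    by (simp add: AA_step_def[abs_def] del: ord_of_nat.simps)
  then show ?case by (simp add: Suc.IH funpow_add)
qed

lemma AA_step_gt: "0 < k \<Longrightarrow> is_limit \<alpha> \<Longrightarrow> \<alpha> < eps0 \<Longrightarrow> x < AA_step k \<alpha> x"
  unfolding AA_step_def by (rule le_AA_fundseq)

text \<open>
  The iterate in the last assumption is \<open>\<AA>\<^sub>k\<^sup>(\<^sup>k\<^sup>-\<^sup>1\<^sup>)(\<alpha> + b)\<close>, started at \<open>mc(\<alpha>)\<close> instead of \<open>\<AA>\<^sub>k\<^sup>(\<^sup>0\<^sup>)(\<alpha> + b)\<close>.
\<close>

lemma AA_less_limit_add_aux:
  assumes k: "2 \<le> k" and a: "is_limit \<alpha>" "\<alpha> < eps0"
    and IH: "\<And>\<nu> n. \<nu> < fundseq \<alpha> n \<Longrightarrow> mcn \<nu> \<le> mcn (fundseq \<alpha> n) \<Longrightarrow> AA k \<nu> < AA k (fundseq \<alpha> n)"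
    and n: "\<nu> < \<alpha> + ord_of_nat b" "mcn \<nu> < (AA_step k \<alpha> ^^ (k * b + (k - 1))) (mcn \<alpha>)"
  shows "AA k \<nu> < AA k (\<alpha> + ord_of_nat b)"
proof (cases "\<nu> < \<alpha>")
  case True
  \<comment> \<open>By domination \<nu> lies below \<alpha>[?X], and one more step from
    \<open>?X\<close> gives A_k(\<alpha> + b).\<close>
  let ?X = "(AA_step k \<alpha> ^^ (k * b + (k - 1))) (mcn \<alpha>)"
  have "\<nu> < fundseq \<alpha> ?X" using less_fundseq[OF a True] n(2) by (simp add: mcn_less_iff)
  moreover have "mcn \<nu> \<le> mcn (fundseq \<alpha> ?X)" using n(2) mcn_fundseq[OF a, of ?X] by simp
  ultimately have "AA k \<nu> < AA_step k \<alpha> ?X" unfolding AA_step_def by (rule IH)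
  also have "\<dots> = AA k (\<alpha> + ord_of_nat b)"
  proof -
    have "k * Suc b = Suc (k * b + (k - 1))" using k by simp
    then show ?thesis unfolding AA_limit_add[OF a] by (simp only: funpow.simps comp_apply)
  qed
  finally show ?thesis .
next
  case False
  \<comment> \<open>Here \<nu> = \<alpha> + c with c < b, whose value is an earlier point on the
    same chain of iterates.\<close>
  then obtain e where e: "\<nu> = \<alpha> + e" using le_imp_diff by (meson not_less)
  then have "e < ord_of_nat b" using n(1) by simp
  then have "e < omega" using ord_of_nat_less_omega less_trans by blast
  then obtain c where c: "e = ord_of_nat c" using less_omega_iff by auto
  then have "c < b" using \<open>e < ord_of_nat b\<close> by simp
  then have "k * Suc c < k * Suc b" using k by simp
  then show ?thesis unfolding e c AA_limit_add[OF a]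
    using funpow_strict[of "AA_step k \<alpha>"] AA_step_gt[OF _ a] k by simp
qed

text \<open>For \<xi> = \<alpha> + b, mc(\<nu>) is at most max(mc(\<alpha>), b). Each step gains at
  least one, so the iteration passes this bound before its last step; k \<ge> 2 ensures this even
  for b = 0.\<close>

lemma AA_mono:
  assumes k: "2 \<le> k" shows "\<xi> < eps0 \<Longrightarrow> \<nu> < \<xi> \<Longrightarrow> mcn \<nu> \<le> mcn \<xi> \<Longrightarrow> AA k \<nu> < AA k \<xi>"
proof (induction \<xi> arbitrary: \<nu> rule: less_induct)
  case (less \<xi>)
  from limit_or_nat[of \<xi>] show ?case
  proof (elim disjE exE conjE)
    assume x: "\<xi> < omega"
    then obtain m n where "\<xi> = ord_of_nat m" "\<nu> = ord_of_nat n"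
      using less.prems(2) less_omega_iff by (metis less_trans)
    then show ?thesis using less.prems(2) by (simp add: AA_finite)
  next
    fix \<alpha> b assume a: "is_limit \<alpha>" and x: "\<xi> = \<alpha> + ord_of_nat b"
    then have ae: "\<alpha> < eps0" using less.prems(1) by simp
    have "max (mcn \<alpha>) b < mcn \<alpha> + (k * b + (k - 1))"
    proof -
      have "2 * b \<le> k * b" using k by (rule mult_right_mono) simp
      then have "b \<le> k * b" "0 < k - 1" using k by simp_all
      then show ?thesis unfolding max_less_iff_conj by (intro conjI; linarith)
    qed
    also have "\<dots> \<le> (AA_step k \<alpha> ^^ (k * b + (k - 1))) (mcn \<alpha>)"
      using AA_step_gt[OF _ a ae] k by (intro funpow_gt) simp
    finally have "max (mcn \<alpha>) b < (AA_step k \<alpha> ^^ (k * b + (k - 1))) (mcn \<alpha>)" .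
    moreover have "mcn \<nu> \<le> max (mcn \<alpha>) b"
      using less.prems(3) x mcn_limit_add[OF a ae, of b] by simp
    ultimately have "mcn \<nu> < (AA_step k \<alpha> ^^ (k * b + (k - 1))) (mcn \<alpha>)" by (rule le_less_trans[rotated])
    then show ?thesis unfolding x
    proof (intro AA_less_limit_add_aux[OF k a ae])
      fix \<nu> n assume n: "\<nu> < fundseq \<alpha> n" "mcn \<nu> \<le> mcn (fundseq \<alpha> n)"
      have "fundseq \<alpha> n < \<alpha>" using fundseq_less[of \<alpha> n] a ae by (simp add: is_limit_def pos_iff)
      also have "\<alpha> \<le> \<xi>" unfolding x by simp
      finally show "AA k \<nu> < AA k (fundseq \<alpha> n)" using less.IH n fundseq_less_eps0[OF a ae] by simp
    qed (use less.prems x in auto)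
  qed
qed

text \<open>The auxiliary lemma with its induction hypothesis supplied by \<open>AA_mono\<close>,
  which is itself derived from it.\<close>

lemma AA_less_limit_add:
  assumes "2 \<le> k" "is_limit \<alpha>" "\<alpha> < eps0" "\<nu> < \<alpha> + ord_of_nat b"
    "mcn \<nu> < (AA_step k \<alpha> ^^ (k * b + (k - 1))) (mcn \<alpha>)"
  shows "AA k \<nu> < AA k (\<alpha> + ord_of_nat b)"
  using assms AA_mono[OF assms(1)] fundseq_less_eps0[OF assms(2,3)]
  by (intro AA_less_limit_add_aux) auto

text \<open>From mc(\<alpha>) on, mc(\<alpha>[x]) = x. Domination then gives \<alpha>[x] <
  \<alpha>[y] for x < y, and \<open>AA_mono\<close> applies.\<close>

lemma AA_step_mono:
  assumes k: "2 \<le> k" and a: "is_limit \<alpha>" "\<alpha> < eps0" and x: "mcn \<alpha> \<le> x" "x \<le> y"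
  shows "AA_step k \<alpha> x \<le> AA_step k \<alpha> y"
proof (cases "x = y")
  case False
  then have "x < y" using x by simp
  moreover have "mcn (fundseq \<alpha> x) = x" "mcn (fundseq \<alpha> y) = y" using mcn_fundseq_eq[OF a] x by auto
  moreover have "fundseq \<alpha> x < \<alpha>" using fundseq_less[of \<alpha> x] a by (simp add: is_limit_def pos_iff)
  ultimately have "fundseq \<alpha> x < fundseq \<alpha> y" using less_fundseq[OF a, of "fundseq \<alpha> x" y] 
    by (simp flip: mcn_less_iff)
  then show ?thesis unfolding AA_step_def
    using AA_mono[OF k fundseq_less_eps0[OF a, of y], of "fundseq \<alpha> x"] x
      \<open>mcn (fundseq \<alpha> x) = x\<close> \<open>mcn (fundseq \<alpha> y) = y\<close> by simp
qed simp

section \<open>Base change of ordinals\<close>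

lemma nat_of_ord_less_iff: "x < omega \<Longrightarrow> y < omega \<Longrightarrow> nat_of_ord x < nat_of_ord y \<longleftrightarrow> x < y"
  using ord_of_nat_less[of "nat_of_ord x" "nat_of_ord y"] by simp

lemma nat_of_ord_max:
  assumes "x < omega" "y < omega" shows "nat_of_ord (max x y) = max (nat_of_ord x) (nat_of_ord y)"
  using nat_of_ord_less_iff[OF assms] nat_of_ord_less_iff[OF assms(2,1)]
  by (auto simp: max_def not_le not_less)

lemma mcn_nf: "is_nf omega \<xi> \<alpha> \<beta> \<gamma> \<Longrightarrow> mcn \<xi> = max (max (mcn \<alpha>) (mcn \<gamma>)) (nat_of_ord \<beta>)"
  using mc_nf[of omega \<xi> \<alpha> \<beta> \<gamma>] nat_of_ord_max by (auto simp: is_nf_def)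

lemma nat_of_ord_pos: "0 < x \<Longrightarrow> x < omega \<Longrightarrow> 0 < nat_of_ord x"
  using nat_of_ord_less_iff[of 0 x] nat_of_ord_of_nat[of 0] by simp

lemma nat_of_ord_0 [simp]: "nat_of_ord 0 = 0" and nat_of_ord_1 [simp]: "nat_of_ord 1 = 1"
  using nat_of_ord_of_nat[of 0] nat_of_ord_of_nat[of "Suc 0"] by simp_all

lemma mcn_pos: assumes "\<xi> < eps0" "\<xi> \<noteq> 0" shows "0 < mcn \<xi>"
proof -
  obtain \<alpha> \<beta> \<gamma> where nf: "is_nf omega \<xi> \<alpha> \<beta> \<gamma>" using ex_nf_omega'[OF assms] by blast
  then have "0 < nat_of_ord \<beta>" by (intro nat_of_ord_pos) (auto simp: is_nf_def)
  then show ?thesis unfolding mcn_nf[OF nf] by (simp add: less_max_iff_disj)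
qed

lemma mcn_opow: "\<alpha> < eps0 \<Longrightarrow> mcn (omega \<up> \<alpha>) = max (mcn \<alpha>) 1"
  using mcn_nf[OF is_nf_omega_opow, of \<alpha>] by simp

lemma add_mono_ord: "x \<le> x' \<Longrightarrow> y \<le> y' \<Longrightarrow> x + y \<le> x' + (y'::ordinal)"
  using add_right_mono_ord[of x x' y] by (meson add_le order_trans)

lemma mult_mono2_ord: "x \<le> x' \<Longrightarrow> y \<le> y' \<Longrightarrow> x * y \<le> x' * (y'::ordinal)"
  using mult_right_mono_ord[of x x' y] mult_mono_ord[of y y' x'] by (rule order_trans)

lemma fundseq_nf:
  assumes "is_nf omega \<xi> \<alpha> \<beta> \<gamma>" "is_limit \<xi>" "\<xi> < eps0"
  shows "fundseq \<xi> n =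
    (if 0 < \<gamma> then omega \<up> \<alpha> * \<beta> + fundseq \<gamma> n
     else if 1 < \<beta> then omega \<up> \<alpha> * opred \<beta> + fundseq (omega \<up> \<alpha>) n
     else if is_limit \<alpha> then omega \<up> fundseq \<alpha> n
     else omega \<up> opred \<alpha> * ord_of_nat n)"
proof -
  have "\<xi> \<noteq> 0" "\<xi> \<noteq> 1" using assms(2) not_limit_nat[of 1] by (auto simp: is_limit_def)
  then show ?thesis
    unfolding fundseq.simps[of \<xi> n] Let_def is_nf_nf[OF assms(1)] using assms(3) by auto
qed

text \<open>
  Closure of \<open>\<epsilon>\<^sub>0\<close> and \<open>\<epsilon>\<^bsub>\<Omega>+1\<^esub>\<close> under normal forms, in terms of the absence of fixed points of \<open>x \<mapsto> \<kappa>\<^sup>x\<close>: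
  this treats both bases uniformly and needs no arithmetic of \<open>\<epsilon>\<^bsub>\<Omega>+1\<^esub>\<close>.
\<close>

definition below_fixpoint :: "ordinal \<Rightarrow> ordinal \<Rightarrow> bool" where
  "below_fixpoint \<kappa> x \<longleftrightarrow> (\<forall>y\<le>x. y < \<kappa> \<up> y)"

lemma below_fixpoint_mono: "below_fixpoint \<kappa> x \<Longrightarrow> y \<le> x \<Longrightarrow> below_fixpoint \<kappa> y"
  by (auto simp: below_fixpoint_def)

lemma below_fixpoint_0 [simp]: "below_fixpoint \<kappa> 0"
  by (simp add: below_fixpoint_def) (metis opow_0 order.antisym zero_le_ord zero_less_one)

text \<open>A y below \<kappa>^(a+1) with \<kappa>^y \<le> y satisfies y \<le> a, where this is
  already excluded.\<close>

lemma below_fixpoint_nf: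
  assumes "1 < \<kappa>" "below_fixpoint \<kappa> a" "b < \<kappa>" "g < \<kappa> \<up> a"
  shows "below_fixpoint \<kappa> (\<kappa> \<up> a * b + g)"
  unfolding below_fixpoint_def
proof (intro allI impI)
  fix y assume "y \<le> \<kappa> \<up> a * b + g"
  also have "\<dots> < \<kappa> \<up> (a + 1)"
    using assms by (simp add: opow_add1 less_imp_le mult_add_less)
  finally have y: "y < \<kappa> \<up> (a + 1)" .
  show "y < \<kappa> \<up> y"
  proof (rule ccontr)
    assume n: "\<not> ?thesis"
    then have "\<kappa> \<up> y < \<kappa> \<up> (a + 1)" using y by (simp add: not_less)
    then have "y \<le> a" using assms(1) by (simp add: less_add1_iff)
    then show False using n assms(2) by (simp add: below_fixpoint_def)
  qed
qed

lemma below_fixpoint_omega: "below_fixpoint omega x \<Longrightarrow> x < eps0"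
  unfolding below_fixpoint_def using eps0_fixed by (metis less_irrefl not_less)

lemma below_fixpoint_ex_nf:
  assumes "1 < \<kappa>" "below_fixpoint \<kappa> x" "x \<noteq> 0" shows "\<exists>\<alpha> \<beta> \<gamma>. is_nf \<kappa> x \<alpha> \<beta> \<gamma>"
proof -
  obtain \<alpha> \<beta> \<gamma> where *: "x = \<kappa> \<up> \<alpha> * \<beta> + \<gamma>" "\<kappa> \<up> \<alpha> \<le> x" "0 < \<beta>" "\<beta> < \<kappa>" "\<gamma> < \<kappa> \<up> \<alpha>"
    using nf_ex[OF assms(1)] assms(3) pos_iff by blast
  have "\<alpha> \<le> x" using le_opow[OF assms(1)] *(2) by (rule order_trans)
  then have "\<alpha> < \<kappa> \<up> \<alpha>" using assms(2) by (simp add: below_fixpoint_def)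
  then have "\<alpha> < x" using *(2) by (rule less_le_trans)
  then show ?thesis using * unfolding is_nf_def by blast
qed

lemma k_nf_props:
  assumes "2 \<le> k" "0 < m" shows "k_nf k m < eps0" "AA k (k_nf k m) = m" "mcn (k_nf k m) < m"
proof -
  show *: "k_nf k m < eps0" "AA k (k_nf k m) = m" using k_nf[OF assms] by (auto simp: is_k_nf_def)
  show "mcn (k_nf k m) < m" using mc_less_A[OF _ *(1), of k] *(2) assms(1) by simp
qed

lemma AA_0 [simp]: "AA k 0 = 1"
  using AA_finite[OF eps0_pos zero_less_omega, of k] by simp

lemma AA_omega_0 [simp]: "AA_omega 0 = 1"
  by (subst AA_omega.simps) (simp add: one_ordinal_def)

lemma AA_at_0 [simp]: "AA_at l 0 = 1"
  by (simp add: AA_at_def)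

section \<open>Base change of ordinals with small coefficients\<close>

locale base_change =
  fixes k :: nat and l :: ordinal
  assumes k: "2 \<le> k" and kl: "ord_of_nat k < l" and l: "l \<le> omega"
begin

abbreviation \<kappa> :: ordinal where "\<kappa> \<equiv> bc_base l"
abbreviation up :: "ordinal \<Rightarrow> ordinal" where "up \<equiv> bc_ord k l"
abbreviation c :: "nat \<Rightarrow> ordinal" where "c \<equiv> bc_nat k l"

lemma one_less_base [simp]: "1 < \<kappa>"
  by (simp add: bc_base_def)

lemma up_0 [simp]: "up 0 = 0"
  by (simp add: bc_ord.simps)

lemma up_nf: 
  assumes "is_nf omega \<xi> \<alpha> \<beta> \<gamma>" "\<xi> < eps0"
  shows "up \<xi> = \<kappa> \<up> up \<alpha> * c (nat_of_ord \<beta>) + up \<gamma>"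
proof -
  have "\<xi> \<noteq> 0" using is_nf_bounds(5)[OF assms(1)] by auto
  then have "\<not> (\<xi> = 0 \<or> eps0 \<le> \<xi>)" using assms(2) by simp
  then show ?thesis unfolding bc_ord.simps[of k l \<xi>] is_nf_nf[OF assms(1)] by (rule if_not_P)
qed

lemma c_0 [simp]: "c 0 = 0"
  by (simp add: bc_nat.simps)

lemma c_pos_eq: "0 < m \<Longrightarrow> c m = AA_at l (up (k_nf k m))"
  using k by (subst bc_nat.simps) simp

lemma c_1 [simp]: "c (Suc 0) = 1"
proof -
  \<comment> \<open>The normal form of 1 has mc below 1, and nonzero ordinals have positive
    mc.\<close>
  have "k_nf k 1 = 0" using k_nf_props[OF k, of 1] mcn_pos by fastforce
  then show ?thesis by (simp add: c_pos_eq)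
qed

lemma up_nat [simp]: "up (ord_of_nat b) = c b"
proof (cases "b = 0")
  case False
  then have "0 < ord_of_nat b" using ord_of_nat_less[of 0 b] by simp
  then have "is_nf omega (ord_of_nat b) 0 (ord_of_nat b) 0" by (intro is_nf_finite) auto
  from up_nf[OF this] show ?thesis by simp
qed simp

lemma up_limit_add: "is_limit \<alpha> \<Longrightarrow> \<alpha> < eps0 \<Longrightarrow> up (\<alpha> + ord_of_nat b) = up \<alpha> + c b"
proof (induction \<alpha> rule: less_induct)
  case (less \<alpha>)
  then obtain a \<beta> \<gamma> where nf: "is_nf omega \<alpha> a \<beta> \<gamma>" using ex_nf_omega'[OF less.prems(2)] by (auto simp: is_limit_def)
  then have a: "a \<noteq> 0" "\<gamma> = 0 \<or> is_limit \<gamma>" using less.prems is_limit_nf by auto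
  have "up (\<gamma> + ord_of_nat b) = up \<gamma> + c b"
    using a(2) less.IH[of \<gamma>] is_nf_bounds(4)[OF nf] less.prems(2) by auto
  then show ?case using up_nf[OF nf] up_nf[OF is_nf_add_nat[OF nf a(1), of b]] less.prems(2)
    by (simp add: add_assoc_ord)
qed

text \<open>The induction hypothesis of the whole argument in the form ordinals use it:
  \<open>up \<xi>\<close> involves \<open>c\<close> only at coefficients of \<xi>, hence below B
  whenever mc(\<xi>) < B.\<close>

definition good :: "nat \<Rightarrow> bool" where
  "good B \<longleftrightarrow> (\<forall>n<B. c n < \<kappa>) \<and> (\<forall>n<B. \<forall>m<n. c m < c n)"

lemma good_less: "good B \<Longrightarrow> m < n \<Longrightarrow> n < B \<Longrightarrow> c m < c n"
  and good_bound: "good B \<Longrightarrow> n < B \<Longrightarrow> c n < \<kappa>"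
  by (auto simp: good_def)

lemma good_mono: "good B \<Longrightarrow> m \<le> n \<Longrightarrow> n < B \<Longrightarrow> c m \<le> c n"
  using good_less[of B m n] by (cases "m = n") (auto simp: less_imp_le)

lemma good_pos: "good B \<Longrightarrow> 0 < n \<Longrightarrow> n < B \<Longrightarrow> 0 < c n"
  using good_less[of B 0 n] by simp

lemma good_max: "good B \<Longrightarrow> m < B \<Longrightarrow> n < B \<Longrightarrow> c (max m n) = max (c m) (c n)"
  using good_mono[of B m n] good_mono[of B n m] by (auto simp: max_def antisym)

lemma up_opow: assumes "\<alpha> < eps0" shows "up (omega \<up> \<alpha>) = \<kappa> \<up> up \<alpha>"
  using up_nf[OF is_nf_omega_opow[OF assms]] opow_less_eps0[OF assms] by simp

text \<open>Normal forms compare lexicographically before and after base change: coefficients keep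
  their order by \<open>good\<close>, exponents and remainders by induction.\<close>

lemma up_less_aux:
  assumes g: "good B"
  shows "\<xi> < eps0 \<Longrightarrow> mcn \<xi> < B \<Longrightarrow> \<zeta> < \<xi> \<Longrightarrow> mcn \<zeta> < B \<Longrightarrow> up \<zeta> < up \<xi>"
proof (induction \<xi> arbitrary: \<zeta> rule: less_induct)
  case (less \<xi>)
  have "\<xi> \<noteq> 0" using less.prems(3) by auto
  then obtain a b e where nf: "is_nf omega \<xi> a b e" using ex_nf_omega' less.prems(1) by blast
  note bd = is_nf_bounds[OF nf]
  have b: "0 < b" "b < omega" "mcn a < B" "mcn e < B" "nat_of_ord b < B"
    using nf less.prems(2) unfolding mcn_nf[OF nf] by (auto simp: is_nf_def)
  have up: "up \<xi> = \<kappa> \<up> up a * c (nat_of_ord b) + up e" using up_nf[OF nf less.prems(1)] .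
  have cb: "0 < c (nat_of_ord b)" using good_pos[OF g nat_of_ord_pos[OF b(1,2)] b(5)] .
  then have le: "\<kappa> \<up> up a \<le> \<kappa> \<up> up a * c (nat_of_ord b)"
    using mult_mono_ord[of 1 "c (nat_of_ord b)" "\<kappa> \<up> up a"] by (simp add: one_le_iff)
  also have le': "\<dots> \<le> up \<xi>" unfolding up by simp
  finally have le2: "\<kappa> \<up> up a \<le> up \<xi>" .
  show ?case
  proof (cases "\<zeta> = 0")
    case True
    have "0 < \<kappa> \<up> up a" by simp
    then have "0 < up \<xi>" using le2 by (rule less_le_trans)
    then show ?thesis using True by simp
  next
    case False
    have ze: "\<zeta> < eps0" using less.prems by simp
    then obtain a' b' e' where nf': "is_nf omega \<zeta> a' b' e'" using ex_nf_omega' False by blast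
    note bd' = is_nf_bounds[OF nf']
    have b': "0 < b'" "b' < omega" "mcn a' < B" "mcn e' < B" "nat_of_ord b' < B"
      using nf' less.prems(4) unfolding mcn_nf[OF nf'] by (auto simp: is_nf_def)
    have B: "1 < B" using nat_of_ord_pos[OF b'(1,2)] b'(5) by simp
    have a'e: "a' < eps0" using bd'(5) ze by simp
    have w: "omega \<up> a' \<le> \<xi>" using bd'(1) less.prems(3) by simp
    \<comment> \<open>The remainder stays below its power by the induction hypothesis at \<omega>^a'
      \<le> \<zeta> < \<xi>; the coefficient 1 of \<omega>^a' is admissible as B > 1.\<close>
    have e': "up e' < \<kappa> \<up> up a'"
    proof -
      have "e' < omega \<up> a'" using nf' by (simp add: is_nf_def)
      moreover have "omega \<up> a' < \<xi>" using bd'(1) less.prems(3) by (rule le_less_trans)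
      ultimately have "up e' < up (omega \<up> a')"
        using less.IH[of "omega \<up> a'" e'] b' B opow_less_eps0[OF a'e] by (simp add: mcn_opow[OF a'e])
      then show ?thesis by (simp add: up_opow[OF a'e])
    qed
    have up': "up \<zeta> = \<kappa> \<up> up a' * c (nat_of_ord b') + up e'" using up_nf[OF nf' ze] .
    from nf_less_iff[OF nf' nf] less.prems(3)
    consider "a' < a" | "a' = a" "b' < b" | "a' = a" "b' = b" "e' < e" by blast
    then show ?thesis
    proof cases
      case 1
      then have "up a' < up a" using less.IH[of a a'] bd less.prems(1) b b' by simp
      have "up \<zeta> < \<kappa> \<up> up a' * \<kappa>" unfolding up' by (intro mult_add_less good_bound[OF g] b' e')
      also have "\<dots> = \<kappa> \<up> (up a' + 1)" by (simp add: opow_add1 less_imp_le)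
      also have "\<dots> \<le> \<kappa> \<up> up a" using \<open>up a' < up a\<close> by (intro opow_mono) (simp add: add1_le_iff)
      finally show ?thesis using le2 by simp
    next
      case 2
      have "nat_of_ord b' < nat_of_ord b" using 2 b b' by (simp add: nat_of_ord_less_iff)
      then have "c (nat_of_ord b') < c (nat_of_ord b)" using good_less[OF g] b by simp
      then have "up \<zeta> < \<kappa> \<up> up a' * c (nat_of_ord b)" unfolding up' using e' by (intro mult_add_less)
      then show ?thesis using le' 2 by simp
    next
      case 3
      then have "up e' < up e" using less.IH[of e e'] bd less.prems(1) b b' by simp
      then show ?thesis unfolding up up' using 3 by simp
    qed
  qed
qed

text \<open>Makes the components of \<open>up \<xi>\<close> readable, so that its mc, limit property
  and fundamental sequence can be computed by recursion on \<xi>.\<close>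

lemma is_nf_up:
  assumes g: "good B" and nf: "is_nf omega \<xi> a b e" and x: "\<xi> < eps0" "mcn \<xi> < B"
  shows "is_nf \<kappa> (up \<xi>) (up a) (c (nat_of_ord b)) (up e)"
proof -
  have b: "0 < b" "b < omega" "mcn a < B" "mcn e < B" "nat_of_ord b < B"
    using nf x(2) unfolding mcn_nf[OF nf] by (auto simp: is_nf_def)
  have a: "a < eps0" and e: "e < omega \<up> a" using is_nf_bounds(5)[OF nf] nf x(1) by (auto simp: is_nf_def)
  have "1 < B" using nat_of_ord_pos[OF b(1,2)] b(5) by simp
  then have "up e < up (omega \<up> a)" using b e
    by (intro up_less_aux[OF g]) (simp_all add: opow_less_eps0 mcn_opow a)
  moreover have "up a < up \<xi>" using up_less_aux[OF g x is_nf_bounds(5)[OF nf] b(3)] .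
  ultimately show ?thesis unfolding is_nf_def
    using up_nf[OF nf x(1)] good_pos[OF g nat_of_ord_pos[OF b(1,2)] b(5)] good_bound[OF g b(5)]
    by (simp add: up_opow[OF a])
qed

text \<open>\<open>c\<close> is monotone below B and so commutes with maxima.\<close>

lemma mc_up: assumes g: "good B" shows "\<xi> < eps0 \<Longrightarrow> mcn \<xi> < B \<Longrightarrow> mc \<kappa> (up \<xi>) = c (mcn \<xi>)"
proof (induction \<xi> rule: less_induct)
  case (less \<xi>)
  show ?case
  proof (cases "\<xi> = 0")
    case False
    then obtain a b e where nf: "is_nf omega \<xi> a b e" using ex_nf_omega' less.prems(1) by blast
    have b: "mcn a < B" "mcn e < B" "nat_of_ord b < B"
      using nf less.prems(2) unfolding mcn_nf[OF nf] by (auto simp: is_nf_def)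
    have "mc \<kappa> (up a) = c (mcn a)" "mc \<kappa> (up e) = c (mcn e)"
      using less.IH[of a] less.IH[of e] is_nf_bounds[OF nf] less.prems(1) b by simp_all
    then show ?thesis
      unfolding mc_nf[OF is_nf_up[OF g nf less.prems]] mcn_nf[OF nf]
      using b by (simp add: good_max[OF g])
  qed simp
qed

lemma below_fixpoint_up:
  assumes g: "good B" shows "\<xi> < eps0 \<Longrightarrow> mcn \<xi> < B \<Longrightarrow> below_fixpoint \<kappa> (up \<xi>)"
proof (induction \<xi> rule: less_induct)
  case (less \<xi>)
  show ?case
  proof (cases "\<xi> = 0")
    case False
    then obtain a b e where nf: "is_nf omega \<xi> a b e" using ex_nf_omega' less.prems(1) by blast
    have "mcn a < B" using less.prems(2) unfolding mcn_nf[OF nf] by simp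
    then have "below_fixpoint \<kappa> (up a)" using less.IH[of a] is_nf_bounds[OF nf] less.prems(1) by simp
    then show ?thesis using is_nf_up[OF g nf less.prems] below_fixpoint_nf[of \<kappa>]
      by (simp add: is_nf_def)
  qed simp
qed

end

section \<open>The case \<open>\<lambda> = \<omega>\<close>\<close>

lemma countable_lessThan: "x < Omega \<Longrightarrow> countable {..<x}"
  unfolding Omega_def using not_less_Least by blast

text \<open>Regularity of \<Omega>: a countable union of countable initial segments cannot exhaust
  it.\<close>

lemma countable_bounded_below_Omega:
  assumes "countable X" "\<And>x. x \<in> X \<Longrightarrow> x < Omega"
  shows "\<exists>u<Omega. \<forall>x\<in>X. x < u"
proof -
  let ?U = "\<Union>x\<in>X. insert x {..<x}"
  have "countable ?U" using assms by (intro countable_UN) (auto intro: countable_lessThan)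
  then have "\<not> {..<Omega} \<subseteq> ?U" using uncountable_Omega countable_subset by blast
  then obtain u where "u < Omega" "u \<notin> ?U" by auto
  then show ?thesis by (intro exI[of _ u]) (auto simp: not_less[symmetric] neq_iff)
qed

lemma mc_less_Omega: "mc Omega \<xi> < Omega"
proof -
  have "coeffs Omega \<xi> \<subseteq> {..<Omega}"
  proof (induction \<xi> rule: less_induct)
    case (less \<xi>)
    show ?case
    proof (cases "\<exists>\<alpha> \<beta> \<gamma>. is_nf Omega \<xi> \<alpha> \<beta> \<gamma>")
      case True
      then obtain \<alpha> \<beta> \<gamma> where nf: "is_nf Omega \<xi> \<alpha> \<beta> \<gamma>" by auto
      have "\<beta> < Omega" using nf by (simp add: is_nf_def)
      then show ?thesis unfolding coeffs_nf[OF nf]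
        using less[OF is_nf_bounds(4)[OF nf]] less[OF is_nf_bounds(5)[OF nf]] by simp
    next
      case False
      have "0 < Omega" using zero_less_one one_less_Omega by (rule less_trans)
      then show ?thesis using False by (subst coeffs.simps) auto
    qed
  qed
  then show ?thesis unfolding mc_def using Max_in[OF finite_coeffs coeffs_ne] by blast
qed

text \<open>Every such \<zeta> arises from 0 by finitely many rounds of forming normal forms with
  coefficients at most \<theta>, and each round \<open>T n\<close> is countable.\<close>

lemma countable_mc_bounded:
  assumes "\<theta> < Omega" shows "countable {\<zeta>. below_fixpoint Omega \<zeta> \<and> mc Omega \<zeta> \<le> \<theta>}"
proof -
  define f where "f X = X \<union> (\<lambda>(a,b,g). Omega \<up> a * b + g) ` (X \<times> insert \<theta> {..<\<theta>} \<times> X)" for X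
  define T where "T n = (f ^^ n) {0}" for n
  have TS: "T (Suc n) = f (T n)" for n by (simp add: T_def)
  have "countable (T n)" for n
  proof (induction n)
    case (Suc n)
    then show ?case unfolding TS f_def using countable_lessThan[OF assms] by auto
  qed (simp add: T_def)
  then have "countable (\<Union>n. T n)" by simp
  have mono: "m \<le> n \<Longrightarrow> T m \<subseteq> T n" for m n
    by (rule lift_Suc_mono_le[of T]) (auto simp: TS f_def)
  have "below_fixpoint Omega \<zeta> \<Longrightarrow> mc Omega \<zeta> \<le> \<theta> \<Longrightarrow> \<exists>n. \<zeta> \<in> T n" for \<zeta>
  proof (induction \<zeta> rule: less_induct)
    case (less \<zeta>)
    show ?case
    proof (cases "\<zeta> = 0")
      case True then show ?thesis by (intro exI[of _ 0]) (simp add: T_def)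
    next
      case False
      then obtain a b g where nf: "is_nf Omega \<zeta> a b g"
        using below_fixpoint_ex_nf[OF one_less_Omega less.prems(1)] by blast
      note bd = is_nf_bounds[OF nf]
      have m: "mc Omega a \<le> \<theta>" "mc Omega g \<le> \<theta>" "b \<le> \<theta>" using less.prems(2) unfolding mc_nf[OF nf] by auto
      obtain i j where "a \<in> T i" "g \<in> T j"
        using less.IH[OF bd(5) below_fixpoint_mono[OF less.prems(1)] m(1)]
          less.IH[OF bd(4) below_fixpoint_mono[OF less.prems(1)] m(2)] bd by (auto simp: less_imp_le)
      then have "a \<in> T (max i j)" "g \<in> T (max i j)" using mono[of i "max i j"] mono[of j "max i j"] by auto
      moreover have "\<zeta> = Omega \<up> a * b + g" using nf by (simp add: is_nf_def)
      ultimately have "\<zeta> \<in> T (Suc (max i j))" unfolding TS f_def using m(3)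
        by (intro UnI2 image_eqI[of _ _ "(a,b,g)"]) auto
      then show ?thesis by blast
    qed
  qed
  then have "{\<zeta>. below_fixpoint Omega \<zeta> \<and> mc Omega \<zeta> \<le> \<theta>} \<subseteq> (\<Union>n. T n)" by blast
  then show ?thesis using \<open>countable (\<Union>n. T n)\<close> countable_subset by blast
qed

text \<open>Only countably many \<zeta> < \<chi> have mc at most a given \<theta> < \<Omega>, so
  some \<open>f \<theta>\<close> < \<Omega> exceeds \<theta> and their values. Iterating f from
  mc(\<chi>) reaches a closed ordinal, which bounds the least one.\<close>

lemma AA_omega_less_Omega: "below_fixpoint Omega \<chi> \<Longrightarrow> AA_omega \<chi> < Omega"
proof (induction \<chi> rule: less_induct)
  case (less \<chi>)
  have "\<exists>\<theta>'<Omega. \<theta> < \<theta>' \<and> (\<forall>\<zeta><\<chi>. mc Omega \<zeta> \<le> \<theta> \<longrightarrow> AA_omega \<zeta> < \<theta>')" if "\<theta> < Omega" for \<theta>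
  proof -
    let ?X = "{\<zeta>. \<zeta> < \<chi> \<and> mc Omega \<zeta> \<le> \<theta>}"
    have "?X \<subseteq> {\<zeta>. below_fixpoint Omega \<zeta> \<and> mc Omega \<zeta> \<le> \<theta>}"
      using below_fixpoint_mono[OF less.prems] by (auto simp: less_imp_le)
    then have "countable (insert \<theta> (AA_omega ` ?X))"
      using countable_subset[OF _ countable_mc_bounded[OF that]] by auto
    moreover have "x < Omega" if "x \<in> insert \<theta> (AA_omega ` ?X)" for x
      using that \<open>\<theta> < Omega\<close> less.IH below_fixpoint_mono[OF less.prems] by (auto simp: less_imp_le)
    ultimately obtain u where "u < Omega" "\<forall>x\<in>insert \<theta> (AA_omega ` ?X). x < u"
      using countable_bounded_below_Omega by meson
    then show ?thesis by auto
  qed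
  then obtain f where f: "\<theta> < Omega \<Longrightarrow> f \<theta> < Omega" "\<theta> < Omega \<Longrightarrow> \<theta> < f \<theta>"
    "\<theta> < Omega \<Longrightarrow> \<zeta> < \<chi> \<Longrightarrow> mc Omega \<zeta> \<le> \<theta> \<Longrightarrow> AA_omega \<zeta> < f \<theta>" for \<theta> \<zeta> by metis
  define t where "t n = (f ^^ n) (mc Omega \<chi>)" for n
  have tS: "t (Suc n) = f (t n)" and t0: "t 0 = mc Omega \<chi>" for n by (simp_all add: t_def)
  have t: "t n < Omega" for n by (induction n) (auto simp: tS t0 f mc_less_Omega)
  obtain u where u: "u < Omega" "\<forall>n. t n < u"
    using countable_bounded_below_Omega[of "range t"] t by auto
  \<comment> \<open>As the least strict upper bound of the iterates, \<theta> is closed: mc(\<zeta>)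
    < \<theta> puts mc(\<zeta>) at or below some \<open>t n\<close>, and the value at \<zeta> below
    the next iterate.\<close>
  define \<theta> where "\<theta> = (LEAST u. \<forall>n. t n < u)"
  have th: "\<forall>n. t n < \<theta>" unfolding \<theta>_def by (rule LeastI) (rule u(2))
  have "\<theta> \<le> u" unfolding \<theta>_def by (rule Least_le) (rule u(2))
  have "AA_omega \<chi> \<le> \<theta>" unfolding AA_omega.simps[of \<chi>]
  proof (rule Least_le, intro conjI allI impI)
    show "mc Omega \<chi> < \<theta>" using th t0 by metis
    fix \<zeta> assume z: "\<zeta> < \<chi>" "mc Omega \<zeta> < \<theta>"
    have "\<not> (\<forall>n. t n < mc Omega \<zeta>)" using z(2) unfolding \<theta>_def by (rule not_less_Least)
    then obtain n where "mc Omega \<zeta> \<le> t n" by (auto simp: not_less)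
    then have "AA_omega \<zeta> < t (Suc n)" unfolding tS using f(3) t z(1) by blast
    then show "AA_omega \<zeta> < \<theta>" using th less_trans by blast
  qed
  then show ?case using \<open>\<theta> \<le> u\<close> u(1) by simp
qed

context base_change
begin

lemma AA_omega_up_less:
  assumes l: "l = omega" and g: "good B" and z: "\<zeta> < eps0" "mcn \<zeta> < B" "M \<le> B"
    and nf: "\<And>n. mcn \<zeta> < n \<Longrightarrow> n < M \<Longrightarrow> k_nf k n < \<zeta>"
  shows "\<nu> < \<zeta> \<Longrightarrow> mcn \<nu> < M \<Longrightarrow> AA_omega (up \<nu>) < AA_omega (up \<zeta>)"
proof (induction "mcn \<nu>" arbitrary: \<nu> rule: less_induct)
  case less
  have kap: "\<kappa> = Omega" using l by (simp add: bc_base_def)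
  have n: "\<nu> < eps0" "mcn \<nu> < B" using less.prems z by auto
  \<comment> \<open>The left side is mc(up \<nu>), as the closure property requires. If mc(\<nu>) >
    mc(\<zeta>), it is the value of A_\<omega> at the base change of a normal form below \<zeta>
    with smaller mc, so induction applies.\<close>
  have "c (mcn \<nu>) < AA_omega (up \<zeta>)"
  proof (cases "mcn \<nu> \<le> mcn \<zeta>")
    case True
    then have "c (mcn \<nu>) \<le> mc Omega (up \<zeta>)" using mc_up[OF g z(1,2)] good_mono[OF g True z(2)] kap by simp
    then show ?thesis using AA_omega_props(1) by (rule le_less_trans)
  next
    case False
    then have "0 < mcn \<nu>" "mcn \<zeta> < mcn \<nu>" by auto
    then show ?thesis using less.hyps[of "k_nf k (mcn \<nu>)"] k_nf_props[OF k, of "mcn \<nu>"]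
        nf less.prems(2) c_pos_eq[of "mcn \<nu>"] l by (simp add: AA_at_def)
  qed
  then show ?case using up_less_aux[OF g z(1,2) less.prems(1) n(2)] mc_up[OF g n] kap
    by (intro AA_omega_props) auto
qed

end

section \<open>The case \<open>\<lambda> < \<omega>\<close>\<close>

context base_change
begin

text \<open>Monotonicity keeps nonzero exponents nonzero, and remainders are handled by induction;
  by \<open>is_limit_nf\<close> this suffices.\<close>

lemma is_limit_up:
  assumes kap: "\<kappa> = omega" and g: "good B"
  shows "\<xi> < eps0 \<Longrightarrow> mcn \<xi> < B \<Longrightarrow> is_limit \<xi> \<Longrightarrow> is_limit (up \<xi>)"
proof (induction \<xi> rule: less_induct)
  case (less \<xi>)
  then obtain a b e where nf: "is_nf omega \<xi> a b e" using ex_nf_omega'[OF less.prems(1)] by (auto simp: is_limit_def)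
  note bd = is_nf_bounds[OF nf]
  have m: "mcn a < B" "mcn e < B" using less.prems(2) unfolding mcn_nf[OF nf] by auto
  have a: "a \<noteq> 0" "e = 0 \<or> is_limit e" using less.prems(3) is_limit_nf[OF nf] by auto
  have "up 0 < up a" using a(1) bd less.prems m by (intro up_less_aux[OF g]) (auto simp: pos_iff)
  moreover have "e < eps0" using bd(4) less.prems(1) by simp
  then have "e = 0 \<or> is_limit (up e)" using a(2) less.IH[of e] bd m by auto
  ultimately show ?case using is_nf_up[OF g nf less.prems(1,2)] is_limit_nf unfolding kap by auto
qed

text \<open>\<open>up (d + 1)\<close> need not be \<open>up d + 1\<close>, since \<open>c\<close>
  may jump. It is still a successor, because its finite part is a positive value of
  \<open>c\<close>, and this bound on its predecessor is what the successor clause needs.\<close>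

lemma up_add1:
  assumes kap: "\<kappa> = omega" and g: "good B" and d: "d < eps0" "mcn d < B" "mcn (d + 1) < B"
  shows "\<not> is_limit (up (d + 1))" "up d \<le> opred (up (d + 1))" "up (d + 1) = opred (up (d + 1)) + 1"
proof -
  have d1: "d + 1 < eps0" using add_nat_less_eps0[of d 1] d(1) by simp
  have c: "\<exists>e. c (Suc n) = e + 1" if "Suc n < B" for n
    using nf_omega_coeff_pred[of "c (Suc n)"] good_pos[OF g _ that] good_bound[OF g that] kap by auto
  have "\<exists>e. up (d + 1) = e + 1"
    using limit_or_nat[of d]
  proof (elim disjE exE conjE)
    assume "d < omega"
    then obtain n where n: "d = ord_of_nat n" using less_omega_iff by auto
    then have n1: "d + 1 = ord_of_nat (Suc n)" by simp
    then have "mc omega (d + 1) = ord_of_nat (Suc n)" by (simp only: mc_finite ord_of_nat_less_omega)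
    then have "mcn (d + 1) = Suc n" by (simp only: nat_of_ord_of_nat)
    then show ?thesis using c[of n] d(3) unfolding n1 up_nat by simp
  next
    fix \<alpha> b assume a: "is_limit \<alpha>" "d = \<alpha> + ord_of_nat b"
    have d1: "d + 1 = \<alpha> + ord_of_nat (Suc b)" using a by (simp add: add_assoc_ord)
    have "\<alpha> < eps0" using a d by simp
    then have "Suc b < B" using mcn_limit_add[of \<alpha> "Suc b"] a d(3) unfolding d1 by simp
    then obtain e where "c (Suc b) = e + 1" using c by blast
    then show ?thesis unfolding d1 up_limit_add[OF a(1) \<open>\<alpha> < eps0\<close>]
      by (intro exI[of _ "up \<alpha> + e"]) (simp add: add_assoc_ord)
  qed
  then obtain e where e: "up (d + 1) = e + 1" by blast
  then show "\<not> is_limit (up (d + 1))" "up (d + 1) = opred (up (d + 1)) + 1" by (auto simp: is_limit_def)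
  have "up d < up (d + 1)" using d d1 by (intro up_less_aux[OF g]) auto
  then show "up d \<le> opred (up (d + 1))" unfolding e by (simp add: less_add1_iff)
qed

text \<open>Proved clause by clause. Besides c(x) \<le> y, inequality enters where a predecessor is
  taken: the predecessor of a base-changed coefficient or exponent is at least the base change of
  the predecessor.\<close>

lemma up_fundseq_le:
  assumes kap: "\<kappa> = omega" and g: "good B" and x: "x < B" "c x \<le> ord_of_nat y"
  shows "\<alpha> < eps0 \<Longrightarrow> mcn \<alpha> < B \<Longrightarrow> is_limit \<alpha> \<Longrightarrow> up (fundseq \<alpha> x) \<le> fundseq (up \<alpha>) y"
proof (induction \<alpha> rule: less_induct)
  case (less \<alpha>)
  have upe: "up \<alpha> < eps0" using below_fixpoint_up[OF g less.prems(1,2)] kap below_fixpoint_omega by simp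
  have fe: "fundseq \<alpha> x < eps0" using fundseq_less_eps0 less.prems by simp
  note ul = is_limit_up[OF kap g less.prems]
  show ?case using less.prems(3,1)
  proof (cases rule: fundseq_cases)
    case (rest a b e)
    note bd = is_nf_bounds[OF rest(1)]
    have m: "mcn e < B" using less.prems(2) unfolding mcn_nf[OF rest(1)] by simp
    have "is_limit (up e)" using rest(2) bd less.prems m by (intro is_limit_up[OF kap g]) auto
    then have "0 < up e" by (simp add: is_limit_def pos_iff)
    then have "fundseq (up \<alpha>) y = omega \<up> up a * c (nat_of_ord b) + fundseq (up e) y"
      using fundseq_nf[OF is_nf_up[OF g rest(1) less.prems(1,2), unfolded kap] ul upe] by simp
    moreover have "up (fundseq e x) \<le> fundseq (up e) y" using rest bd less.prems m by (intro less.IH) auto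
    ultimately show ?thesis using up_nf[OF rest(4) fe] kap by simp
  next
    case (coeff a b)
    note bd = is_nf_bounds[OF coeff(1)]
    have a: "a < eps0" using bd less.prems by simp
    \<comment> \<open>\<open>b\<close> is the leading coefficient of the normal form of \<alpha>[0],
      hence positive.\<close>
    have b: "0 < b" "b < omega" using coeff(5)[of 0] by (auto simp: is_nf_def)
    then obtain n where n: "b = ord_of_nat n" "0 < n" using less_omega_iff by (metis gr0I less_irrefl ord_of_nat.simps(1))
    have b1: "nat_of_ord (b + 1) = Suc n" using nat_of_ord_of_nat[of "Suc n"] n by simp
    have m: "mcn a < B" "Suc n < B" using less.prems(2) b1 unfolding mcn_nf[OF coeff(1)] by auto
    have w: "mcn (omega \<up> a) < B" using m n by (simp add: mcn_opow[OF a])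
    have "c n < c (Suc n)" using good_less[OF g _ m(2)] by simp
    moreover have cS: "c (Suc n) = opred (c (Suc n)) + 1"
      using nf_omega_coeff_pred[of "c (Suc n)"] good_pos[OF g _ m(2)] good_bound[OF g m(2)] kap by auto
    ultimately have cn: "c n \<le> opred (c (Suc n))" by (metis less_add1_iff)
    have "0 < c n" using good_pos[OF g n(2)] m by simp
    then have "1 \<le> opred (c (Suc n))" using cn by (simp add: one_le_iff)
    \<comment> \<open>Keeps \<open>up \<alpha>\<close> in the coefficient clause of
      \<open>fundseq\<close>.\<close>
    then have "1 < c (Suc n)" by (metis cS less_add1_iff)
    then have "fundseq (up \<alpha>) y = omega \<up> up a * opred (c (Suc n)) + fundseq (omega \<up> up a) y"
      using fundseq_nf[OF is_nf_up[OF g coeff(1) less.prems(1,2), unfolded kap] ul upe] b1 by simp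
    moreover have "up (fundseq (omega \<up> a) x) \<le> fundseq (omega \<up> up a) y"
      using less.IH[OF coeff(3) _ w coeff(2)] opow_less_eps0[OF a] up_opow[OF a] kap by simp
    moreover have "up (fundseq \<alpha> x) = omega \<up> up a * c n + up (fundseq (omega \<up> a) x)"
      using up_nf[OF coeff(5) fe] kap n by simp
    ultimately show ?thesis using cn by (auto intro!: add_mono_ord mult_mono_ord)
  next
    case (limit a)
    note bd = is_nf_bounds[OF limit(1)]
    have m: "mcn a < B" using less.prems(2) unfolding mcn_nf[OF limit(1)] by simp
    have "is_limit (up a)" using limit(3) bd less.prems m by (intro is_limit_up[OF kap g]) auto
    then have "fundseq (up \<alpha>) y = omega \<up> fundseq (up a) y"
      using fundseq_nf[OF is_nf_up[OF g limit(1) less.prems(1,2), unfolded kap] ul upe] by simp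
    moreover have "up (fundseq a x) \<le> fundseq (up a) y" using limit(3) bd less.prems m by (intro less.IH) auto
    ultimately show ?thesis using up_nf[OF limit(5) fe] kap by (simp add: opow_mono)
  next
    case (succ d)
    note bd = is_nf_bounds[OF succ(1)]
    have d1: "d + 1 < eps0" "mcn (d + 1) < B" using bd less.prems unfolding mcn_nf[OF succ(1)] by auto
    then have de: "d < eps0" using less_add1 less_trans by blast
    have "mcn d \<le> mcn (d + 1)" using mc_le_add1[OF de] mcn_le_iff by simp
    then have dB: "mcn d < B" using d1 by simp
    note u = up_add1[OF kap g de dB d1(2)]
    have f: "fundseq (up \<alpha>) y = omega \<up> opred (up (d + 1)) * ord_of_nat y"
      using fundseq_nf[OF is_nf_up[OF g succ(1) less.prems(1,2), unfolded kap] ul upe] u(1) by simp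
    show ?thesis
    proof (cases "x = 0")
      case True then show ?thesis using succ(3) by simp
    next
      case False
      then have "up (fundseq \<alpha> x) = omega \<up> up d * c x" using up_nf[OF succ(4) fe] kap by simp
      then show ?thesis unfolding f using x(2) u(2) by (simp add: mult_mono2_ord opow_mono)
    qed
  qed
qed

end

section \<open>Comparison of the iterations for finite \<lambda>\<close>

locale base_change_finite = base_change +
  fixes L :: nat
  assumes lL: "l = ord_of_nat L"
begin

lemma kL: "k < L" and L2: "2 \<le> L"
  using kl k unfolding lL by simp_all

lemma base_omega [simp]: "\<kappa> = omega"
  by (simp add: bc_base_def lL)

lemma AA_at_finite [simp]: "AA_at l x = ord_of_nat (AA L x)"
  by (simp add: AA_at_def lL)

abbreviation cn :: "nat \<Rightarrow> nat" where "cn n \<equiv> nat_of_ord (c n)"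

lemma c_cn: "good B \<Longrightarrow> n < B \<Longrightarrow> c n = ord_of_nat (cn n)"
  using good_bound by simp

lemma cn_less: "good B \<Longrightarrow> m < n \<Longrightarrow> n < B \<Longrightarrow> cn m < cn n"
  using good_less[of B m n] c_cn[of B m] c_cn[of B n] by (metis less_trans ord_of_nat_less)

lemma cn_mono: "good B \<Longrightarrow> m \<le> n \<Longrightarrow> n < B \<Longrightarrow> cn m \<le> cn n"
  using cn_less[of B m n] by (cases "m = n") auto

lemma cn_diff: "good B \<Longrightarrow> cn m + d \<le> cn (m + d)" if "m + d < B"
  using that
proof (induction d)
  case (Suc d)
  then show ?case using cn_less[of B "m + d" "m + Suc d"] by simp
qed simp

lemma cn_k_nf: "0 < n \<Longrightarrow> cn n = AA L (up (k_nf k n))"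
  by (simp add: c_pos_eq)

lemma up_less_eps0: "good B \<Longrightarrow> \<xi> < eps0 \<Longrightarrow> mcn \<xi> < B \<Longrightarrow> up \<xi> < eps0"
  using below_fixpoint_up[of B \<xi>] below_fixpoint_omega by simp

lemma mcn_up: "good B \<Longrightarrow> \<xi> < eps0 \<Longrightarrow> mcn \<xi> < B \<Longrightarrow> mcn (up \<xi>) = cn (mcn \<xi>)"
  using mc_up[of B \<xi>] by simp

text \<open>
  Assumption \<open>less\<close> is the induction hypothesis of \<open>AA_up_less\<close> below. It applies to the terms \<open>\<alpha>[z]\<close> because
  they inherit from \<open>\<alpha>\<close> that the normal forms of intermediate numbers lie below them.
\<close>

lemma iterates_up:
  fixes \<alpha> :: ordinal and q M :: nat
  defines "z \<equiv> \<lambda>t. (AA_step k \<alpha> ^^ t) q" and "w \<equiv> \<lambda>t. (AA_step L (up \<alpha>) ^^ t) (cn q)"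
  assumes g: "good B" and MB: "M \<le> B" and a: "is_limit \<alpha>" "\<alpha> < eps0" and q: "mcn \<alpha> \<le> q" "q < M"
    and nf: "\<And>n. q < n \<Longrightarrow> n < M \<Longrightarrow> k_nf k n < \<alpha>"
    and less: "\<And>D M' \<mu>. D < \<alpha> \<Longrightarrow> mcn D < B \<Longrightarrow> M' \<le> B \<Longrightarrow> M' \<le> AA k D \<Longrightarrow>
       (\<And>n. mcn D < n \<Longrightarrow> n < M' \<Longrightarrow> k_nf k n < D) \<Longrightarrow> \<mu> < D \<Longrightarrow> mcn \<mu> < M' \<Longrightarrow>
       AA L (up \<mu>) < AA L (up D)"
  shows "(z t < M \<longrightarrow> cn (z t) \<le> w t) \<and> (\<forall>n<M. n < z t \<longrightarrow> cn n < w t)"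
proof (induction t)
  case 0
  show ?case using cn_less[OF g _ less_le_trans[OF q(2) MB]] by (auto simp: z_def w_def)
next
  case (Suc t)
  have k0: "0 < k" using k by simp
  have aB: "mcn \<alpha> < B" using q MB by simp
  note ul = is_limit_up[OF base_omega g a(2) aB a(1)] and ue = up_less_eps0[OF g a(2) aB]
  define Z W where "Z = z t" and "W = w t"
  have zS: "z (Suc t) = AA_step k \<alpha> Z" and wS: "w (Suc t) = AA_step L (up \<alpha>) W"
    by (simp_all add: z_def w_def Z_def W_def)
  have Zg: "Z < AA_step k \<alpha> Z" and Wg: "W < AA_step L (up \<alpha>) W"
    using AA_step_gt[OF k0 a] AA_step_gt[OF _ ul ue, of L] L2 by auto
  show ?case
  proof (cases "Z < M")
    case False
    \<comment> \<open>The iteration has reached M: the second conjunct already covers all n < M, and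
      the iterates only grow.\<close>
    then have "\<forall>n<M. cn n < W" using Suc.IH by (auto simp: Z_def W_def)
    then show ?thesis unfolding zS wS using False Zg Wg by (auto intro: less_trans)
  next
    case True
    then have IH: "cn Z \<le> W" using Suc.IH by (simp add: Z_def W_def)
    have "q \<le> Z" unfolding Z_def z_def using funpow_gt[of "AA_step k \<alpha>" q t] AA_step_gt[OF k0 a] by simp
    define D where "D = fundseq \<alpha> Z"
    have D: "D < \<alpha>" "D < eps0" "mcn D = Z" "AA k D = AA_step k \<alpha> Z"
      using fundseq_less[of \<alpha> Z] fundseq_less_eps0[OF a] a mcn_fundseq_eq[OF a, of Z] q \<open>q \<le> Z\<close>
      by (auto simp: D_def is_limit_def pos_iff AA_step_def)
    define M' where "M' = min M (AA k D)"
    \<comment> \<open>Inheritance from \<alpha>: a normal form strictly between D and \<alpha> has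
      mc at least Z = mc(D) by domination, so by \<open>AA_mono\<close> its value would exceed
      A_k(D) \<ge> n.\<close>
    have Dnf: "k_nf k n < D \<or> k_nf k n = D \<and> n = AA k D" if n: "Z < n" "n < M" "n \<le> AA k D" for n
    proof -
      have lt: "k_nf k n < \<alpha>" using nf n \<open>q \<le> Z\<close> by simp
      have e: "k_nf k n < eps0" "AA k (k_nf k n) = n" using k_nf_props[OF k, of n] n by auto
      have "\<not> D < k_nf k n"
      proof
        assume gt: "D < k_nf k n"
        then have "\<not> mc omega (k_nf k n) < ord_of_nat Z"
          using less_fundseq[OF a lt, of Z] unfolding D_def by auto
        then have "mcn D \<le> mcn (k_nf k n)" unfolding D(3) by (simp flip: mcn_less_iff)
        then have "AA k D < AA k (k_nf k n)" using AA_mono[OF k e(1) gt] by simp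
        then show False using e n by simp
      qed
      then show ?thesis using e by (metis linorder_neqE)
    qed
    have DB: "mcn D < B" using D(3) True MB by simp
    have AD: "AA L (up D) \<le> w (Suc t)"
    proof -
      have "Z < B" using True MB by simp
      then have "c Z \<le> ord_of_nat W" using IH c_cn[OF g, of Z] by (metis ord_of_nat_le)
      then have "up D \<le> fundseq (up \<alpha>) W" unfolding D_def
        using \<open>Z < B\<close> by (intro up_fundseq_le[OF base_omega g _ _ a(2) aB a(1)])
      moreover have "mcn (up D) \<le> mcn (fundseq (up \<alpha>) W)"
        using mcn_up[OF g D(2) DB] D(3) IH mcn_fundseq[OF ul ue, of W] by simp
      ultimately show ?thesis unfolding wS AA_step_def
        using AA_mono[OF L2 fundseq_less_eps0[OF ul ue], of "up D" W] by (cases "up D = fundseq (up \<alpha>) W") (auto simp: le_less)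
    qed
    have sub: "AA L (up \<mu>) < AA L (up D)" if "\<mu> < D" "mcn \<mu> < M'" for \<mu>
    proof (rule less[OF D(1) DB _ _ _ that])
      show "M' \<le> B" "M' \<le> AA k D" using MB by (auto simp: M'_def)
      show "k_nf k n < D" if "mcn D < n" "n < M'" for n
        using that Dnf[of n] D(3) by (auto simp: M'_def)
    qed
    have nfm: "mcn (k_nf k n) < n" if "Z < n" for n using that k_nf_props[OF k, of n] by simp
    show ?thesis unfolding zS D(4)[symmetric]
    proof (intro conjI allI impI)
      \<comment> \<open>The normal form of A_k(D) may be D itself, hence \<le> in this conjunct and
        < in the other.\<close>
      assume "AA k D < M"
      moreover have "Z < AA k D" using Zg D(4) by simp
      ultimately have "AA L (up (k_nf k (AA k D))) \<le> AA L (up D)"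
        using Dnf[of "AA k D"] sub[of "k_nf k (AA k D)"] nfm[of "AA k D"] by (auto simp: M'_def)
      then show "cn (AA k D) \<le> w (Suc t)" using AD cn_k_nf[of "AA k D"] \<open>Z < AA k D\<close> by simp
    next
      fix n assume n: "n < M" "n < AA k D"
      show "cn n < w (Suc t)"
      proof (cases "n \<le> Z")
        case le: True
        then have "cn n \<le> cn Z" using True MB by (intro cn_mono[OF g]) auto
        then show ?thesis using IH Wg wS by simp
      next
        case False
        then have "AA L (up (k_nf k n)) < AA L (up D)"
          using Dnf[of n] n sub[of "k_nf k n"] nfm[of n] by (auto simp: M'_def)
        then show ?thesis using AD cn_k_nf[of n] False by simp
      qed
    qed
  qed
qed

text \<open>Let \<zeta> = \<alpha> + b and mc(\<nu>) > mc(\<zeta>). By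
  \<open>AA_less_limit_add\<close> it suffices to bound mc(up \<nu>) by L c(b) + L - 1 steps over
  \<open>up \<alpha>\<close>. For \<open>iterates_up\<close> this needs q and N such that N steps
  from q reach A_k(\<zeta>), while N steps from c(q) stay within that budget.\<close>

lemma AA_up_less:
  assumes g: "good B"
  shows "\<zeta> < eps0 \<Longrightarrow> mcn \<zeta> < B \<Longrightarrow> M \<le> B \<Longrightarrow> M \<le> AA k \<zeta> \<Longrightarrow>
    (\<And>n. mcn \<zeta> < n \<Longrightarrow> n < M \<Longrightarrow> k_nf k n < \<zeta>) \<Longrightarrow> \<nu> < \<zeta> \<Longrightarrow> mcn \<nu> < M \<Longrightarrow>
    AA L (up \<nu>) < AA L (up \<zeta>)"
proof (induction \<zeta> arbitrary: M \<nu> rule: less_induct)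
  case (less \<zeta>)
  note ze = less.prems(1) and zB = less.prems(2) and MB = less.prems(3) and MA = less.prems(4)
    and nf = less.prems(5) and lt = less.prems(6) and nM = less.prems(7)
  have ne: "\<nu> < eps0" "mcn \<nu> < B" using lt ze nM MB by auto
  have ult: "up \<nu> < up \<zeta>" using up_less_aux[OF g ze zB lt ne(2)] .
  note ue = up_less_eps0[OF g ze zB]
  show ?case
  proof (cases "mcn \<nu> \<le> mcn \<zeta>")
    case True
    then show ?thesis using AA_mono[OF L2 ue ult] mcn_up[OF g ze zB] mcn_up[OF g ne] cn_mono[OF g True zB] by simp
  next
    case False
    have "\<not> \<zeta> < omega"
    proof
      assume f: "\<zeta> < omega"
      then have "\<nu> < omega" using lt by simp
      then have "mcn \<nu> < mcn \<zeta>" using f lt by (simp add: mc_finite nat_of_ord_less_iff)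
      then show False using False by simp
    qed
    then obtain \<alpha> b where a: "is_limit \<alpha>" and z: "\<zeta> = \<alpha> + ord_of_nat b" using limit_or_nat by blast
    have ae: "\<alpha> < eps0" using ze z by simp
    have mz: "mcn \<zeta> = max (mcn \<alpha>) b" using mcn_limit_add[OF a ae] z by simp
    then have aB: "mcn \<alpha> < B" "b < B" using zB by auto
    have az: "\<alpha> \<le> \<zeta>" using z by simp
    have uz: "up \<zeta> = up \<alpha> + ord_of_nat (cn b)"
      using up_limit_add[OF a ae, of b] c_cn[OF g aB(2)] z by (simp del: ord_of_nat_of_ord)
    have k0: "0 < k" and L0: "0 < L" using k L2 by auto
    note ul = is_limit_up[OF base_omega g ae aB(1) a] and ua = up_less_eps0[OF g ae aB(1)]
    let ?F = "AA_step k \<alpha>" and ?G = "AA_step L (up \<alpha>)"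
    let ?m = "mcn (up \<alpha>)"
    have m: "?m = cn (mcn \<alpha>)" using mcn_up[OF g ae aB(1)] .
    note Fg = AA_step_gt[OF k0 a ae] and Gg = AA_step_gt[OF L0 ul ua]
    \<comment> \<open>If some \<open>\<alpha> + b'\<close> with \<open>b' < b\<close> is a normal form, the base change may jump at \<open>\<AA>\<^sub>k(\<alpha> + b')\<close>, so the comparison of
      iterates has to start at the last such value.\<close>
    define S where "S = {q. mcn \<zeta> \<le> q \<and> q < M \<and> (q = mcn \<zeta> \<or> (\<exists>b'<b. k_nf k q = \<alpha> + ord_of_nat b'))}"
    define q where "q = Max S"
    have "finite S" by (rule finite_subset[of _ "{..<M}"]) (auto simp: S_def)
    moreover have "mcn \<zeta> \<in> S" using False nM by (auto simp: S_def)
    ultimately have qS: "q \<in> S" and qmax: "\<And>q'. q' \<in> S \<Longrightarrow> q' \<le> q" unfolding q_def by (auto intro: Max_in)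
    then have q: "mcn \<zeta> \<le> q" "q < M" "q = mcn \<zeta> \<or> (\<exists>b'<b. k_nf k q = \<alpha> + ord_of_nat b')"
      by (auto simp: S_def)
    \<comment> \<open>A normal form in [\<alpha>, \<zeta>) is \<alpha> + b' with b' < b, so its
      number belongs to S and is at most q.\<close>
    have qnf: "k_nf k n < \<alpha>" if n: "q < n" "n < M" for n
    proof (rule ccontr)
      assume "\<not> k_nf k n < \<alpha>"
      then obtain e where e: "k_nf k n = \<alpha> + e" using le_imp_diff by (meson not_less)
      have "k_nf k n < \<zeta>" using nf n q by simp
      then have "e < ord_of_nat b" using e z by simp
      then obtain b' where "e = ord_of_nat b'" "b' < b"
        using less_omega_iff less_trans[OF _ ord_of_nat_less_omega] by (metis ord_of_nat_less)
      then have "n \<in> S" using n q e by (auto simp: S_def)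
      then show False using qmax n by fastforce
    qed
    have "\<exists>N. AA k \<zeta> \<le> (?F ^^ N) q \<and> (?G ^^ N) (cn q) \<le> (?G ^^ (L * cn b + (L - 1))) ?m"
      using q(3)
    proof
      assume qz: "q = mcn \<zeta>"
      define N where "N = k * Suc b"
      have 1: "AA k \<zeta> \<le> (?F ^^ N) q" unfolding z AA_limit_add[OF a ae] N_def
        using AA_step_mono[OF k a ae] Fg qz mz by (intro funpow_mono_on[where a = "mcn \<alpha>"]) auto
      \<comment> \<open>Follows from b \<le> c(b) and k + 1 \<le> L. The surplus of at least c(b)
        steps lifts mc(up \<alpha>) to at least the starting value c(q).\<close>
      have "N + cn b \<le> L * cn b + (L - 1)"
      proof -
        have "b \<le> cn b" using cn_diff[of 0 b B] g aB by simp
        then have "k * b + cn b \<le> k * cn b + cn b" by simp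
        also have "\<dots> = Suc k * cn b" by simp
        also have "\<dots> \<le> L * cn b" using kL by (intro mult_right_mono) auto
        finally show ?thesis using kL by (simp add: N_def)
      qed
      then obtain r where r: "L * cn b + (L - 1) = N + r" "cn b \<le> r"
        by (metis add_leD1 le_add_diff_inverse nat_add_left_cancel_le)
      have "cn q = max (cn (mcn \<alpha>)) (cn b)" unfolding qz mz
        using cn_mono[OF g, of "mcn \<alpha>" b] cn_mono[OF g, of b "mcn \<alpha>"] aB by (auto simp: max_def)
      also have "\<dots> \<le> (?G ^^ r) ?m" using funpow_gt[of ?G ?m r] Gg r m by auto
      finally have "(?G ^^ N) (cn q) \<le> (?G ^^ N) ((?G ^^ r) ?m)"
        using AA_step_mono[OF L2 ul ua] Gg m cn_mono[OF g, of "mcn \<alpha>" q] q mz MB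
        by (intro funpow_mono_on[where a = ?m]) auto
      then have "(?G ^^ N) (cn q) \<le> (?G ^^ (L * cn b + (L - 1))) ?m" by (simp only: r(1) funpow_add comp_apply)
      with 1 show ?thesis by blast
    next
      assume "\<exists>b'<b. k_nf k q = \<alpha> + ord_of_nat b'"
      then obtain b' where b': "b' < b" "k_nf k q = \<alpha> + ord_of_nat b'" by blast
      have "0 < mcn \<zeta>" using mcn_pos[OF ze] lt by fastforce
      then have q0: "0 < q" using q by simp
      define N where "N = k * (b - b')"
      have "q = (?F ^^ (k * Suc b')) (mcn \<alpha>)"
        using k_nf_props(2)[OF k q0] b' AA_limit_add[OF a ae] by simp
      moreover have "k * Suc b = N + k * Suc b'" using b' by (simp add: N_def flip: add_mult_distrib2)
      ultimately have "AA k \<zeta> = (?F ^^ N) q" unfolding z AA_limit_add[OF a ae] by (simp only: funpow_add comp_apply)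
      moreover have "(?G ^^ N) (cn q) \<le> (?G ^^ (L * cn b + (L - 1))) ?m"
      proof -
        have b'B: "b' < B" using b' aB by simp
        \<comment> \<open>So c(q) is itself on the chain over \<open>up \<alpha>\<close>, after L
          (c(b') + 1) steps.\<close>
        have "cn q = AA L (up \<alpha> + ord_of_nat (cn b'))"
          using cn_k_nf[OF q0] b' up_limit_add[OF a ae, of b'] c_cn[OF g b'B] by (simp del: ord_of_nat_of_ord)
        then have "(?G ^^ N) (cn q) = (?G ^^ (N + L * Suc (cn b'))) ?m"
          by (simp only: AA_limit_add[OF ul ua] funpow_add comp_apply)
        \<comment> \<open>With d = c(b) - c(b') \<ge> b - b', the N = k (b - b') steps satisfy N + d
          \<le> L d, and d > 0 yields the final - 1.\<close>
        moreover have "N + L * Suc (cn b') \<le> L * cn b + (L - 1)"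
        proof -
          have "cn b' + (b - b') \<le> cn b" using cn_diff[of b' "b - b'" B] g aB b' by simp
          then obtain e where "cn b = cn b' + (b - b') + e" using le_Suc_ex by blast
          then obtain d where d: "cn b = cn b' + d" "b - b' \<le> d" "0 < d"
            using b' by (metis add.assoc le_add1 less_le_trans zero_less_diff)
          have "N + d \<le> k * d + d" using d by (simp add: N_def)
          also have "\<dots> = Suc k * d" by simp
          also have "\<dots> \<le> L * d" using kL by (intro mult_right_mono) auto
          finally show ?thesis using d L0 by (simp add: distrib_left)
        qed
        ultimately show ?thesis using funpow_le[of ?G, OF Gg] by simp
      qed
      ultimately show ?thesis by (metis order_refl)
    qed
    then obtain N where N: "AA k \<zeta> \<le> (?F ^^ N) q" "(?G ^^ N) (cn q) \<le> (?G ^^ (L * cn b + (L - 1))) ?m"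
      by blast
    have "cn (mcn \<nu>) < (?G ^^ N) (cn q)"
    proof -
      have "\<forall>n<M. n < (?F ^^ N) q \<longrightarrow> cn n < (?G ^^ N) (cn q)"
      proof (rule iterates_up[OF g MB a ae _ q(2) qnf, THEN conjunct2])
        show "mcn \<alpha> \<le> q" using q mz by simp
        fix D M' \<mu> assume "D < \<alpha>"
        then have "D < \<zeta>" "D < eps0" using az ae by auto
        then show "mcn D < B \<Longrightarrow> M' \<le> B \<Longrightarrow> M' \<le> AA k D \<Longrightarrow>
          (\<And>n. mcn D < n \<Longrightarrow> n < M' \<Longrightarrow> k_nf k n < D) \<Longrightarrow> \<mu> < D \<Longrightarrow> mcn \<mu> < M' \<Longrightarrow>
          AA L (up \<mu>) < AA L (up D)" by (rule less.IH)
      qed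
      then show ?thesis using nM MA N(1) by simp
    qed
    then have "mcn (up \<nu>) < (?G ^^ (L * cn b + (L - 1))) ?m"
      using N(2) mcn_up[OF g ne] by simp
    then show ?thesis unfolding uz using ult uz by (intro AA_less_limit_add[OF L2 ul ua]) auto
  qed
qed

end

section \<open>The greedy sequence of a normal form\<close>

definition nf_chain :: "nat \<Rightarrow> nat \<Rightarrow> nat \<Rightarrow> ordinal" where
  "nf_chain k m i = (nf_next k m ^^ i) 0"

text \<open>Once the value m is reached no candidates remain and the sequence restarts at 0, so the
  first such index is taken.\<close>

definition nf_length :: "nat \<Rightarrow> nat \<Rightarrow> nat" where
  "nf_length k m = (LEAST i. AA k (nf_chain k m i) = m)"

lemma nf_chain_0 [simp]: "nf_chain k m 0 = 0"
  and nf_chain_Suc: "nf_chain k m (Suc i) = nf_next k m (nf_chain k m i)"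
  by (simp_all add: nf_chain_def)

lemma nf_candidates_iff: "\<zeta> \<in> nf_candidates k m \<xi> \<longleftrightarrow> \<zeta> < eps0 \<and> AA k \<zeta> \<le> m \<and> AA k \<xi> \<le> mcn \<zeta>"
  using mcn_less_iff[of \<zeta> "AA k \<xi>"] by (auto simp: nf_candidates_def not_less[symmetric])

lemma nf_next_ge:
  assumes "2 \<le> k" "\<zeta> \<in> nf_candidates k m \<xi>" shows "\<zeta> \<le> nf_next k m \<xi>"
proof -
  let ?C = "nf_candidates k m \<xi>"
  have fin: "finite ?C" by (rule finite_subset[OF _ finite_AA_le[OF assms(1), of m]]) (auto simp: nf_candidates_def)
  have M: "Max ?C \<in> ?C \<and> (\<forall>\<zeta>\<in>?C. \<zeta> \<le> Max ?C)" using Max_in[OF fin] Max_ge[OF fin] assms(2) by blast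
  then have "(THE \<mu>. \<mu> \<in> ?C \<and> (\<forall>\<zeta>\<in>?C. \<zeta> \<le> \<mu>)) = Max ?C"
    by (intro the_equality) (auto intro: antisym)
  then show ?thesis using M assms(2) unfolding nf_next_def by auto
qed

lemma nf_chain_bound:
  assumes "2 \<le> k" "0 < m" shows "nf_chain k m i < eps0 \<and> AA k (nf_chain k m i) \<le> m"
proof (induction i)
  case 0 then show ?case using assms by (simp add: eps0_pos)
next
  case (Suc i)
  show ?case
  proof (cases "nf_candidates k m (nf_chain k m i) = {}")
    case True then show ?thesis using assms by (simp add: nf_chain_Suc nf_next_empty eps0_pos)
  next
    case False
    from nf_next_Max[OF assms(1) this] show ?thesis by (simp add: nf_chain_Suc nf_candidates_iff)
  qed
qed

text \<open>The sequence witnessing \<open>is_k_nf\<close> may pass through 0 again, yet stopping at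
  the first value m also gives a normal form of m; uniqueness identifies the two.\<close>

lemma nf_chain_length:
  assumes "2 \<le> k" "0 < m"
  shows "nf_chain k m (nf_length k m) = k_nf k m" "AA k (nf_chain k m (nf_length k m)) = m"
proof -
  let ?N = "nf_length k m"
  obtain x n where x: "x 0 = 0" "x n = k_nf k m" "\<forall>i<n. x (Suc i) = nf_next k m (x i)"
    using k_nf[OF assms] unfolding is_k_nf_def by blast
  have "i \<le> n \<Longrightarrow> x i = nf_chain k m i" for i
    by (induction i) (use x in \<open>auto simp: nf_chain_Suc\<close>)
  then have "AA k (nf_chain k m n) = m" using x k_nf_props(2)[OF assms] by auto
  then show N: "AA k (nf_chain k m ?N) = m" unfolding nf_length_def by (rule LeastI)
  have "is_k_nf k m (nf_chain k m ?N)" unfolding is_k_nf_def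
    using assms nf_chain_bound[OF assms] N
    by (intro conjI exI[of _ "nf_chain k m"] exI[of _ ?N]) (auto simp: nf_chain_Suc)
  then show "nf_chain k m ?N = k_nf k m" using ex1_k_nf[OF assms] k_nf[OF assms] by blast
qed

lemma nf_chain_less:
  assumes "2 \<le> k" "0 < m" "i < nf_length k m" shows "AA k (nf_chain k m i) < m"
proof -
  have "AA k (nf_chain k m i) \<noteq> m" using not_less_Least assms(3) unfolding nf_length_def by blast
  then show ?thesis using nf_chain_bound[OF assms(1,2), of i] by simp
qed

lemma nf_chain_step:
  assumes "2 \<le> k" "0 < m" "i < nf_length k m"
  shows "AA k (nf_chain k m i) \<le> mcn (nf_chain k m (Suc i))"
proof -
  \<comment> \<open>The finite ordinal m - 1 is a candidate until m is reached, so the default 0 of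
    \<open>nf_next\<close> does not occur.\<close>
  have "AA k (ord_of_nat (m - 1)) = m" "mcn (ord_of_nat (m - 1)) = m - 1"
    using assms(2) by (simp_all add: AA_finite mc_finite)
  then have "ord_of_nat (m - 1) \<in> nf_candidates k m (nf_chain k m i)"
    using nf_chain_less[OF assms] by (simp add: nf_candidates_iff)
  then have "nf_chain k m (Suc i) \<in> nf_candidates k m (nf_chain k m i)"
    unfolding nf_chain_Suc by (intro nf_next_Max[OF assms(1)]) auto
  then show ?thesis by (simp add: nf_candidates_iff)
qed

lemma nf_chain_le_mcn:
  assumes "2 \<le> k" "0 < m"
  shows "i < j \<Longrightarrow> j \<le> nf_length k m \<Longrightarrow> AA k (nf_chain k m i) \<le> mcn (nf_chain k m j)"
proof (induction j)
  case (Suc j)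
  have "AA k (nf_chain k m i) \<le> AA k (nf_chain k m j)"
    using Suc mc_less_A[of k "nf_chain k m j"] nf_chain_bound[OF assms, of j] assms(1)
    by (cases "i = j") auto
  then show ?case using nf_chain_step[OF assms, of j] Suc.prems by simp
qed simp

text \<open>Both sequences maximise under the same lower bound on mc. The next member for m has
  value below n and competes for n; the next member for n has value at most n \<le> m and competes
  for m.\<close>

lemma nf_chain_agree:
  assumes k: "2 \<le> k" and m: "0 < n" "n \<le> m"
  shows "i \<le> nf_length k m \<Longrightarrow> AA k (nf_chain k m i) < n \<Longrightarrow>
    i < nf_length k n \<and> nf_chain k n i = nf_chain k m i"
proof (induction i)
  case 0
  then have "nf_length k n \<noteq> 0" using nf_chain_length(2)[OF k m(1)] by (intro notI) simp
  then show ?case by simp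
next
  case (Suc i)
  have m0: "0 < m" using m by simp
  have i: "i < nf_length k m" using Suc.prems by simp
  note st = nf_chain_step[OF k m0 i]
  have e: "nf_chain k m (Suc i) < eps0" using nf_chain_bound[OF k m0] by blast
  then have "mcn (nf_chain k m (Suc i)) < AA k (nf_chain k m (Suc i))" using k by (intro mc_less_A) auto
  then have IH: "i < nf_length k n" "nf_chain k n i = nf_chain k m i" using Suc st by auto
  have "nf_chain k m (Suc i) \<le> nf_chain k n (Suc i)"
    unfolding nf_chain_Suc[of k n] IH using e st Suc.prems by (intro nf_next_ge[OF k]) (simp add: nf_candidates_iff)
  moreover have "nf_chain k n (Suc i) \<le> nf_chain k m (Suc i)"
    unfolding nf_chain_Suc[of k m] using nf_chain_step[OF k m(1) IH(1)] nf_chain_bound[OF k m(1), of "Suc i"] m IH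
    by (intro nf_next_ge[OF k]) (simp add: nf_candidates_iff)
  ultimately have eq: "nf_chain k n (Suc i) = nf_chain k m (Suc i)" by simp
  then have "Suc i \<noteq> nf_length k n" using nf_chain_length(2)[OF k m(1)] Suc.prems by auto
  then show ?case using IH eq by simp
qed

text \<open>The normal form of n comes strictly after index i in a sequence that agrees with the one
  for m up to i.\<close>

lemma le_mcn_k_nf:
  assumes k: "2 \<le> k" and "n \<le> m" "i \<le> nf_length k m" "AA k (nf_chain k m i) < n"
  shows "AA k (nf_chain k m i) \<le> mcn (k_nf k n)"
proof -
  have n: "0 < n" using assms by simp
  from nf_chain_agree[OF k n assms(2-4)] nf_chain_le_mcn[OF k n, of i "nf_length k n"]
  show ?thesis by (simp add: nf_chain_length(1)[OF k n])
qed

section \<open>The main induction\<close>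

context base_change
begin

lemma finite_or_omega: "l = omega \<or> (\<exists>L. base_change_finite k l L)"
proof (cases "l = omega")
  case False
  then have "l < omega" using l by simp
  then obtain L where "l = ord_of_nat L" using less_omega_iff by auto
  then have "base_change_finite k l L" using base_change_axioms
    by (simp add: base_change_finite_def base_change_finite_axioms_def)
  then show ?thesis by blast
qed simp

lemma AA_at_up_less:
  assumes g: "good B" and z: "\<zeta> < eps0" "mcn \<zeta> < B" and M: "M \<le> B" "M \<le> AA k \<zeta>"
    and nf: "\<And>n. mcn \<zeta> < n \<Longrightarrow> n < M \<Longrightarrow> k_nf k n < \<zeta>" and n: "\<nu> < \<zeta>" "mcn \<nu> < M"
  shows "AA_at l (up \<nu>) < AA_at l (up \<zeta>)"
  using finite_or_omega
proof (elim disjE exE)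
  assume "l = omega"
  then show ?thesis using AA_omega_up_less[OF _ g z M(1) nf n] by (simp add: AA_at_def)
next
  fix L assume "base_change_finite k l L"
  then interpret base_change_finite k l L .
  show ?thesis using AA_up_less[OF g z M nf n] by simp
qed

lemma AA_at_up_bounds:
  assumes g: "good B" and x: "\<xi> < eps0" "mcn \<xi> < B"
  shows "AA_at l (up \<xi>) < \<kappa>" "c (mcn \<xi>) < AA_at l (up \<xi>)"
proof -
  have "AA_at l (up \<xi>) < \<kappa> \<and> c (mcn \<xi>) < AA_at l (up \<xi>)"
    using finite_or_omega
  proof (elim disjE exE)
    assume "l = omega"
    then have "\<kappa> = Omega" "AA_at l (up \<xi>) = AA_omega (up \<xi>)" by (simp_all add: bc_base_def AA_at_def)
    then show ?thesis using AA_omega_less_Omega below_fixpoint_up[OF g x] AA_omega_props(1)[of "up \<xi>"] mc_up[OF g x]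
      by simp
  next
    fix L assume "base_change_finite k l L"
    then interpret base_change_finite k l L .
    have "mcn (up \<xi>) < AA L (up \<xi>)" using up_less_eps0[OF g x] L2 by (intro mc_less_A) auto
    then have "ord_of_nat (cn (mcn \<xi>)) < ord_of_nat (AA L (up \<xi>))" using mcn_up[OF g x] by simp
    then show ?thesis using c_cn[OF g x(2)] by simp
  qed
  then show "AA_at l (up \<xi>) < \<kappa>" "c (mcn \<xi>) < AA_at l (up \<xi>)" by auto
qed

text \<open>For 0 < m < B the normal form of m has value m, so it differs from that of B, and the
  premise at B gives c(m) < c(B). The bound by \<kappa> comes from \<open>AA_at_up_bounds\<close>,
  as the normal form of B has mc below B.\<close>

lemma goodI:
  "(\<And>m \<zeta>. m < B \<Longrightarrow> 0 < m \<Longrightarrow> \<zeta> < eps0 \<Longrightarrow> AA k \<zeta> \<le> m \<Longrightarrow> \<zeta> = k_nf k m \<or> AA_at l (up \<zeta>) < c m) \<Longrightarrow> good B"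
proof (induction B)
  case (Suc B)
  then have g: "good B" by simp
  have "c B < \<kappa> \<and> (\<forall>m<B. c m < c B)"
  proof (cases "B = 0")
    case True
    have "0 < \<kappa>" using zero_less_one one_less_base by (rule less_trans)
    then show ?thesis using True by simp
  next
    case False
    then have B: "0 < B" by simp
    note bd = AA_at_up_bounds[OF g k_nf_props(1,3)[OF k B], folded c_pos_eq[OF B]]
    have "c m < c B" if "m < B" for m
    proof (cases "m = 0")
      case True
      have "0 < c B" using zero_le_ord bd(2) by (rule le_less_trans)
      then show ?thesis using True by simp
    next
      case False
      then have m: "0 < m" by simp
      have "k_nf k m \<noteq> k_nf k B" using k_nf_props(2)[OF k m] k_nf_props(2)[OF k B] that by auto
      then show ?thesis
        using Suc.prems[of B "k_nf k m"] B that k_nf_props(1,2)[OF k m] c_pos_eq[OF m] by simp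
    qed
    then show ?thesis using bd(1) by simp
  qed
  then show ?case using g by (auto simp: good_def less_Suc_eq)
qed (simp add: good_def)

text \<open>Stated for all \<zeta> of value at most m, and strictly: the induction hypothesis then
  gives \<open>good m\<close>, on which the facts about \<open>up\<close> rest, and applies to
  earlier members of the greedy sequence.\<close>

lemma AA_at_up_less_c:
  "0 < m \<Longrightarrow> \<zeta> < eps0 \<Longrightarrow> AA k \<zeta> \<le> m \<Longrightarrow> \<zeta> = k_nf k m \<or> AA_at l (up \<zeta>) < c m"
proof (induction m arbitrary: \<zeta> rule: less_induct)
  case (less m)
  have g: "good m" by (rule goodI) (rule less.IH)
  note m = less.prems(1)
  let ?x = "nf_chain k m" and ?N = "nf_length k m"
  note xb = nf_chain_bound[OF k m] and xN = nf_chain_length[OF k m]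
  have k0: "0 < k" using k by simp
  define \<xi> where "\<xi> = k_nf k m"
  have \<xi>: "\<xi> < eps0" "AA k \<xi> = m" "mcn \<xi> < m" using k_nf_props[OF k m] by (auto simp: \<xi>_def)
  have cm: "c m = AA_at l (up \<xi>)" unfolding \<xi>_def by (rule c_pos_eq[OF m])
  have cx: "c (mcn \<xi>) < c m" unfolding cm using AA_at_up_bounds(2)[OF g \<xi>(1,3)] .
  show ?case
  proof (cases "\<zeta> = 0")
    case True
    show ?thesis
    proof (cases "\<xi> = 0")
      case False
      then have "1 \<le> mcn \<xi>" using mcn_pos[OF \<xi>(1)] by simp
      then have "c 1 \<le> c (mcn \<xi>)" using good_mono[OF g _ \<xi>(3)] by blast
      then have "1 < c m" using cx by simp
      then show ?thesis using True by simp
    qed (simp add: True \<xi>_def)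
  next
    case False
    have zm: "mcn \<zeta> < AA k \<zeta>" using mc_less_A[OF k0 less.prems(2)] .
    \<comment> \<open>Index 0 qualifies since A_k(0) = 1 and \<zeta> \<noteq> 0; the last index does
      not, since mc(\<zeta>) < A_k(\<zeta>) \<le> m.\<close>
    define i where "i = (GREATEST i. i \<le> ?N \<and> AA k (?x i) \<le> mcn \<zeta>)"
    have "0 \<le> ?N \<and> AA k (?x 0) \<le> mcn \<zeta>" using mcn_pos[OF less.prems(2) False] by simp
    then have i: "i \<le> ?N" "AA k (?x i) \<le> mcn \<zeta>" and imax: "\<And>j. j \<le> ?N \<Longrightarrow> AA k (?x j) \<le> mcn \<zeta> \<Longrightarrow> j \<le> i"
      unfolding i_def using GreatestI_nat[of "\<lambda>i. i \<le> ?N \<and> AA k (?x i) \<le> mcn \<zeta>" 0 ?N]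
        Greatest_le_nat[of "\<lambda>i. i \<le> ?N \<and> AA k (?x i) \<le> mcn \<zeta>" _ ?N] by auto
    have "i \<noteq> ?N" using i(2) xN zm less.prems(3) by auto
    then have iN: "Suc i \<le> ?N" using i(1) by simp
    define \<eta> where "\<eta> = ?x (Suc i)"
    have \<eta>: "\<eta> < eps0" "AA k \<eta> \<le> m" using xb by (auto simp: \<eta>_def)
    have zn: "mcn \<zeta> < AA k \<eta>" using imax[OF iN] by (fastforce simp: \<eta>_def)
    have top: "\<rho> \<le> \<eta>" if "\<rho> < eps0" "AA k \<rho> \<le> m" "AA k (?x i) \<le> mcn \<rho>" for \<rho>
      unfolding \<eta>_def nf_chain_Suc using that by (intro nf_next_ge[OF k]) (simp add: nf_candidates_iff)
    have \<eta>m: "mcn \<eta> < AA k \<eta>" using mc_less_A[OF k0 \<eta>(1)] .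
    have st: "AA k (?x i) \<le> mcn \<eta>" unfolding \<eta>_def using iN by (intro nf_chain_step[OF k m]) simp
    have 1: "\<zeta> = \<eta> \<or> AA_at l (up \<zeta>) < AA_at l (up \<eta>)"
    proof (cases "\<zeta> = \<eta>")
      case False
      then have "\<zeta> < \<eta>" using top[OF less.prems(2,3) i(2)] by simp
      \<comment> \<open>\<open>le_mcn_k_nf\<close> makes the normal form of n a competitor in the
        maximisation that produced \<eta>; it differs from \<eta> in value.\<close>
      moreover have "k_nf k n < \<eta>" if n: "mcn \<eta> < n" "n < AA k \<eta>" for n
      proof -
        have "0 < n" using n by simp
        note nf = k_nf_props[OF k this]
        have "AA k (?x i) \<le> mcn (k_nf k n)" using n st \<eta>(2) i(1) by (intro le_mcn_k_nf[OF k, of n m]) auto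
        then have "k_nf k n \<le> \<eta>" using top nf n \<eta>(2) by simp
        moreover have "k_nf k n \<noteq> \<eta>" using nf n by auto
        ultimately show ?thesis by simp
      qed
      ultimately have "AA_at l (up \<zeta>) < AA_at l (up \<eta>)"
        using \<eta>m \<eta>(2) zn by (intro AA_at_up_less[OF g \<eta>(1) _ \<eta>(2)]) auto
      then show ?thesis by simp
    qed simp
    have 2: "\<eta> = \<xi> \<or> AA_at l (up \<eta>) < c m"
    proof (cases "Suc i = ?N")
      case True then show ?thesis using xN by (simp add: \<eta>_def \<xi>_def)
    next
      case False
      then have lt: "Suc i < ?N" using iN by simp
      \<comment> \<open>Here \<eta> is not last, so p < m. Induction bounds A_\<lambda>(up \<eta>)
        by c(p), and p \<le> mc(\<xi>) places c(p) below c(m).\<close>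
      define p where "p = AA k \<eta>"
      have p: "0 < p" "p < m" using nf_chain_less[OF k m lt] \<eta>m by (auto simp: p_def \<eta>_def)
      have "\<eta> = k_nf k p \<or> AA_at l (up \<eta>) < c p" using less.IH[OF p(2,1) \<eta>(1)] by (simp add: p_def)
      then have "AA_at l (up \<eta>) \<le> c p" using c_pos_eq[OF p(1)] by auto
      also have "p \<le> mcn \<xi>" unfolding p_def \<eta>_def \<xi>_def xN(1)[symmetric]
        by (rule nf_chain_le_mcn[OF k m lt order_refl])
      then have "c p \<le> c (mcn \<xi>)" using good_mono[OF g _ \<xi>(3)] by blast
      also note cx
      finally show ?thesis by simp
    qed
    from 1 2 show ?thesis unfolding \<xi>_def[symmetric] using cm by auto
  qed
qed

end

theorem theorem7p3:
  fixes k :: nat and l \<zeta> \<xi> :: ordinal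
  assumes "2 \<le> k" and "ord_of_nat k < l" and "l \<le> omega"
    and "\<zeta> < eps0" and "\<xi> < eps0"
    and "is_k_nf k (AA k \<zeta>) \<xi>"
  shows "AA_at l (bc_ord k l \<zeta>) \<le> AA_at l (bc_ord k l \<xi>)"
proof -
  interpret base_change k l using assms by unfold_locales
  have m: "0 < AA k \<zeta>" using assms(6) by (simp add: is_k_nf_def)
  then have "k_nf k (AA k \<zeta>) = \<xi>" using ex1_k_nf[OF k m] k_nf[OF k m] assms(6) by blast
  then show ?thesis using AA_at_up_less_c[OF m assms(4) order_refl] c_pos_eq[OF m] by auto
qed

end
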